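(* Let $S$ be a finite quantum stop time, let $V$ be an isometric $p$-adapted cocycle and let $t \in (0,\infty)$. If $V$ is strongly continuous (i.e., $r \mapsto V_r$ is strongly continuous on $\mathbb{R}_+$) then the strong operator limit $$V_{S,t} := \lim_\pi V_{S,\pi}, \qquad V_{S,\pi} := \sum_{j=1}^{n+1} V_{\pi_j} S\bigl( (\pi_{j-1},\pi_j] \bigr),$$ taken over finite partitions $\pi = \{0 = \pi_0 < \cdots < \pi_{n+1} = t\}$ of $[0,t]$ ordered by refinement, is well defined on $\mathsf{h} \otimes \mathcal{F}$. Furthermore, $V_{S,t} = V_{S,t} S([0,t])$ and $$\| V_{S,t} z \| \le \| S([0,t]) z \| \qquad \text{for all } z \in \mathsf{h} \otimes \mathcal{F}.$$
   Context: Fock space. Fix a complex Hilbert space $\mathsf{k}$. Inner products are linear in the second variable. $B(H)$ denotes the bounded operators on a Hilbert space $H$. For a subinterval $A$ of $\mathbb{R}_+ = [0,\infty)$, $\mathcal{F}_A$ is the Boson (symmetric) Fock space over $L^2(A;\mathsf{k})$, with exponential vectors $\varepsilon(f)$, $f \in L^2(A;\mathsf{k})$, which are total and satisfy $\langle \varepsilon(f), \varepsilon(g)\rangle = \exp\langle f,g\rangle$. Write $\mathcal{F} = \mathcal{F}_{\mathbb{R}_+}$, $\mathcal{F}_{t)} = \mathcal{F}_{[0,t)}$, $\mathcal{F}_{[t} = \mathcal{F}_{[t,\infty)}$, with identity operators $I$, $I_{t)}$, $I_{[t}$ (so $\mathcal{F}_{0)} = \mathbb{C}$), and identify $\mathcal{F}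 \cong \mathcal{F}_{s)} \otimes \mathcal{F}_{[s}$ via $\varepsilon(f) \leftrightarrow \varepsilon(f|_{[0,s)}) \otimes \varepsilon(f|_{[s,\infty)})$. Stop times. A finite quantum stop time is a map $S$ from the Borel $\sigma$-algebra of $[0,\infty]$ to $B(\mathcal{F})$ such that: each $S(A)$ is an orthogonal projection; $A \mapsto \langle x, S(A) y\rangle$ is a complex measure for all $x,y \in \mathcal{F}$; $S([0,\infty]) = I$; $S([0,t]) \in B(\mathcal{F}_{t)}) \otimes I_{[t}$ for all $t \in (0,\infty)$; $S(\{0\}) = 0$; and $S(\{\infty\}) = 0$ (finiteness). Let $\mathsf{h}$ be a complex Hilbert space; $S$ is extended by ampliation to $\mathsf{h} \otimes \mathcal{F}$, i.e., $S(A)$ also denotes $I_{\mathsf{h}} \otimes S(A)$. CCR flow. For $t \in \mathbb{R}_+$, $\Gamma_t : \mathcal{F} \to \mathcal{F}$ is the isometry with $\Gamma_t\varepsilon(f) = \varepsilon(\theta_t f)$, where $(\theta_t f)(s) = f(s-t)$ if $s \ge t$ and $0$ if $s<t$; it is regarded as an isometric isomorphism of $\mathcal{F}$ onto $\mathcal{F}_{[t} \cong \varepsilon(0|_{[0,t)}) \otimes \mathcal{F}_{[t}$. Put $\sigma_t(X) = I_{t)} \otimes \Gamma_t X \Gamma_t^*$ for $X \in B(\mathcal{F})$, extended by ampliation to a normal unital $*$-endomorphism of $B(\mathsf{h} \otimes \mathcal{F})$ acting trivially on $B(\mathsf{h})$. Cocycles. Let $\mathcal{M} \subseteq B(\mathsf{h})$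 be a von Neumann algebra and $\overline{\otimes}$ the ultraweak tensor product. Let $p \in B(\mathsf{k})$ be an orthogonal projection, acting pointwise on $L^2([t,\infty);\mathsf{k})$, and let $P_{[t} \in B(\mathcal{F}_{[t})$ be its second quantisation: $P_{[t}\varepsilon(f) = \varepsilon(pf)$. A family $V = (V_t)_{t \in \mathbb{R}_+} \subseteq \mathcal{M} \,\overline{\otimes}\, B(\mathcal{F})$ is a $p$-adapted process if $V_t = V_{t)} \otimes P_{[t}$ for all $t \in \mathbb{R}_+$, with $V_{t)} \in \mathcal{M} \,\overline{\otimes}\, B(\mathcal{F}_{t)})$; put $\widehat{V}_t := V_{t)} \otimes I_{[t}$. A $p$-adapted process $V$ is a cocycle if $V_{s+t} = \widehat{V}_s\, \sigma_s(V_t)$ for all $s,t \in \mathbb{R}_+$. It is isometric if $V_{t)}^* V_{t)} = I_{\mathsf{h}} \otimes I_{t)}$ for all $t \in \mathbb{R}_+$. *)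

theory Defs
  imports "HOL-Analysis.Analysis"
begin

section \<open>Complex Hilbert spaces and their operators\<close>

text \<open>The inner product is linear in the second variable; definiteness and positivity are
  contained in the last axiom, completeness in \<^class>\<open>banach\<close>.\<close>

class complex_hilbert = banach +
  fixes scaleC :: "complex \<Rightarrow> 'a \<Rightarrow> 'a"  (infixr "*\<^sub>C" 75)
    and cinner :: "'a \<Rightarrow> 'a \<Rightarrow> complex"
  assumes scaleC_add_right: "c *\<^sub>C (x + y) = c *\<^sub>C x + c *\<^sub>C y"
    and scaleC_add_left: "(c + d) *\<^sub>C x = c *\<^sub>C x + d *\<^sub>C x"
    and scaleC_scaleC: "c *\<^sub>C d *\<^sub>C x = (c * d) *\<^sub>C x"
    and scaleR_scaleC: "r *\<^sub>R x = complex_of_real r *\<^sub>C x"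
    and cinner_commute: "cinner x y = cnj (cinner y x)"
    and cinner_add_right: "cinner x (y + z) = cinner x y + cinner x z"
    and cinner_scaleC_right: "cinner x (c *\<^sub>C y) = c * cinner x y"
    and cinner_self: "cinner x x = complex_of_real ((norm x)\<^sup>2)"

instantiation complex :: complex_hilbert
begin
definition "scaleC_complex = ((*) :: complex \<Rightarrow> complex \<Rightarrow> complex)"
definition "cinner_complex (x::complex) y = cnj x * y"
instance
proof
  fix x :: complex
  show "cinner x x = complex_of_real ((norm x)\<^sup>2)"
    unfolding cinner_complex_def by (metis complex_norm_square mult.commute)
qed (simp_all add: scaleC_complex_def cinner_complex_def ring_distribs scaleR_conv_of_real)
end

global_interpretation complex_vector:
    vector_space "scaleC :: complex \<Rightarrow> 'a \<Rightarrow> 'a::complex_hilbert"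
  defines cspan = complex_vector.span
proof
  fix a b :: complex and x y :: 'a
  show "a *\<^sub>C (x + y) = a *\<^sub>C x + a *\<^sub>C y" by (rule scaleC_add_right)
  show "(a + b) *\<^sub>C x = a *\<^sub>C x + b *\<^sub>C x" by (rule scaleC_add_left)
  show "a *\<^sub>C b *\<^sub>C x = (a * b) *\<^sub>C x" by (rule scaleC_scaleC)
  show "1 *\<^sub>C x = x" using scaleR_scaleC[of 1 x] by simp
qed

definition closed_cspan :: "'a::complex_hilbert set \<Rightarrow> 'a set" where
  "closed_cspan X = closure (cspan X)"

text \<open>\<open>B(H)\<close> for a closed subspace \<open>H\<close> of the ambient Hilbert space. Operators on \<open>H\<close> are
  represented by functions on the ambient space that are set to \<open>0\<close> outside \<open>H\<close>, so that two
  operators are equal iff the representing functions are. For \<open>H = UNIV\<close> the convention is void.\<close>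

definition bounded_ops :: "'a::complex_hilbert set \<Rightarrow> ('a \<Rightarrow> 'a) set" where
  "bounded_ops H = {A. (\<forall>x\<in>H. A x \<in> H) \<and> (\<forall>x. x \<notin> H \<longrightarrow> A x = 0)
     \<and> (\<forall>x\<in>H. \<forall>y\<in>H. A (x + y) = A x + A y) \<and> (\<forall>c. \<forall>x\<in>H. A (c *\<^sub>C x) = c *\<^sub>C A x)
     \<and> (\<exists>K. \<forall>x\<in>H. norm (A x) \<le> K * norm x)}"

definition id_op :: "'a::complex_hilbert set \<Rightarrow> 'a \<Rightarrow> 'a" where
  "id_op H x = (if x \<in> H then x else 0)"

definition adjoint_op :: "'a::complex_hilbert set \<Rightarrow> ('a \<Rightarrow> 'a) \<Rightarrow> 'a \<Rightarrow> 'a" where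
  "adjoint_op H A = (THE B. B \<in> bounded_ops H
     \<and> (\<forall>x\<in>H. \<forall>y\<in>H. cinner (B x) y = cinner x (A y)))"

definition orthogonal_projection :: "('a::complex_hilbert \<Rightarrow> 'a) \<Rightarrow> bool" where
  "orthogonal_projection P \<longleftrightarrow> P \<in> bounded_ops UNIV \<and> P \<circ> P = P \<and> adjoint_op UNIV P = P"

definition commutant :: "('a::complex_hilbert \<Rightarrow> 'a) set \<Rightarrow> ('a \<Rightarrow> 'a) set" where
  "commutant N = {X \<in> bounded_ops UNIV. \<forall>Y\<in>N. X \<circ> Y = Y \<circ> X}"

definition von_neumann_algebra :: "('a::complex_hilbert \<Rightarrow> 'a) set \<Rightarrow> bool" where
  "von_neumann_algebra N \<longleftrightarrow> N \<subseteq> bounded_ops UNIV \<and> (\<forall>X\<in>N. adjoint_op UNIV X \<in> N)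
     \<and> commutant (commutant N) = N"

text \<open>Closure in \<open>B(H)\<close> for the topology generated by the seminorms
  \<open>X \<mapsto> \<bar>\<Sum>n. \<langle>x n, X (y n)\<rangle>\<bar>\<close> with square-summable sequences \<open>x\<close>, \<open>y\<close> in \<open>H\<close>.\<close>

definition square_summable :: "(nat \<Rightarrow> 'a::complex_hilbert) \<Rightarrow> bool" where
  "square_summable x \<longleftrightarrow> summable (\<lambda>n. (norm (x n))\<^sup>2)"

definition ultraweak_closure ::
    "'a::complex_hilbert set \<Rightarrow> ('a \<Rightarrow> 'a) set \<Rightarrow> ('a \<Rightarrow> 'a) set" where
  "ultraweak_closure H N = {X \<in> bounded_ops H. \<forall>\<Phi>. finite \<Phi> \<and>
       (\<forall>(x, y)\<in>\<Phi>. square_summable x \<and> square_summable y \<and> range x \<subseteq> H \<and> range y \<subseteq> H) \<longrightarrow>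
       (\<forall>e>0. \<exists>A\<in>N. \<forall>(x, y)\<in>\<Phi>. cmod (\<Sum>n. cinner (x n) (X (y n) - A (y n))) < e)}"


section \<open>Hilbert space tensor products\<close>

text \<open>\<open>T\<close> exhibits the closed subspace \<open>C\<close> as the Hilbert space tensor product of the closed
  subspaces \<open>A\<close> and \<open>B\<close>. Bilinearity of \<open>T\<close> on \<open>A \<times> B\<close> follows from the first clause, and
  \<open>(C, T)\<close> is determined up to a unique unitary.\<close>

definition hilbert_tensor :: "'a::complex_hilbert set \<Rightarrow> 'b::complex_hilbert set \<Rightarrow>
    'c::complex_hilbert set \<Rightarrow> ('a \<Rightarrow> 'b \<Rightarrow> 'c) \<Rightarrow> bool" where
  "hilbert_tensor A B C T \<longleftrightarrow>
     (\<forall>a\<in>A. \<forall>b\<in>B. \<forall>a'\<in>A. \<forall>b'\<in>B. cinner (T a b) (T a' b') = cinner a a' * cinner b b')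
     \<and> closed_cspan {T a b | a b. a \<in> A \<and> b \<in> B} = C"

text \<open>The operator \<open>X \<otimes> Y\<close> on \<open>C\<close>, for \<open>X\<close> on \<open>A\<close> and \<open>Y\<close> on \<open>B\<close>.\<close>

definition op_tensor :: "('a \<Rightarrow> 'b \<Rightarrow> 'c::complex_hilbert) \<Rightarrow> 'a set \<Rightarrow> 'b set \<Rightarrow> 'c set \<Rightarrow>
    ('a \<Rightarrow> 'a) \<Rightarrow> ('b \<Rightarrow> 'b) \<Rightarrow> 'c \<Rightarrow> 'c" where
  "op_tensor T A B C X Y =
     (THE Z. Z \<in> bounded_ops C \<and> (\<forall>a\<in>A. \<forall>b\<in>B. Z (T a b) = T (X a) (Y b)))"


section \<open>The space \<open>L\<^sup>2(\<real>\<^sub>+; k)\<close>\<close>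

text \<open>Functions on \<open>\<real>\<^sub>+\<close> are extended by \<open>0\<close> to the real line. The noise space \<open>k\<close> need not be
  separable, so measurability is strong (Bochner) measurability. Functions are not identified
  when they agree almost everywhere: all their uses below factor through the quotient.\<close>

definition strongly_measurable :: "(real \<Rightarrow> 'k::topological_space) \<Rightarrow> bool" where
  "strongly_measurable f \<longleftrightarrow>
     (\<exists>s. (\<forall>i. simple_function lborel (s i)) \<and> (\<forall>r. (\<lambda>i::nat. s i r) \<longlonglongrightarrow> f r))"

definition L2 :: "(real \<Rightarrow> 'k::complex_hilbert) set" where
  "L2 = {f. strongly_measurable f \<and> (\<forall>r<0. f r = 0) \<and> integrable lborel (\<lambda>r. (norm (f r))\<^sup>2)}"

definition L2_inner :: "(real \<Rightarrow> 'k::complex_hilbert) \<Rightarrow> (real \<Rightarrow> 'k) \<Rightarrow> complex" where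
  "L2_inner f g = (\<integral>r. cinner (f r) (g r) \<partial>lborel)"

definition cut :: "real set \<Rightarrow> (real \<Rightarrow> 'k::zero) \<Rightarrow> real \<Rightarrow> 'k" where
  "cut A f r = (if r \<in> A then f r else 0)"

definition shift :: "real \<Rightarrow> (real \<Rightarrow> 'k::zero) \<Rightarrow> real \<Rightarrow> 'k" where
  "shift t f r = (if t \<le> r then f (r - t) else 0)"


section \<open>Partitions\<close>

text \<open>A partition \<open>0 = \<pi>\<^sub>0 < \<dots> < \<pi>\<^sub>n\<^sub>+\<^sub>1 = t\<close> is the finite set of its points, so that refinement
  is inclusion; \<open>partition_pt \<pi> j\<close> is \<open>\<pi>\<^sub>j\<close>, and \<open>card \<pi> = n + 2\<close>.\<close>

definition partitions :: "real \<Rightarrow> real set set" where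
  "partitions t = {\<pi>. finite \<pi> \<and> 0 \<in> \<pi> \<and> t \<in> \<pi> \<and> \<pi> \<subseteq> {0..t}}"

definition partition_pt :: "real set \<Rightarrow> nat \<Rightarrow> real" where
  "partition_pt \<pi> j = sorted_list_of_set \<pi> ! j"

definition refinement_filter :: "real \<Rightarrow> real set filter" where
  "refinement_filter t = (INF \<pi>\<^sub>0\<in>partitions t. principal {\<pi> \<in> partitions t. \<pi>\<^sub>0 \<subseteq> \<pi>})"

lemma eventually_refinement_filter:
  assumes "0 \<le> t"
  shows "eventually P (refinement_filter t) \<longleftrightarrow>
    (\<exists>\<pi>\<^sub>0\<in>partitions t. \<forall>\<pi>\<in>partitions t. \<pi>\<^sub>0 \<subseteq> \<pi> \<longrightarrow> P \<pi>)"
proof -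
  have ne: "partitions t \<noteq> {}"
  proof -
    have "{0, t} \<in> partitions t" using assms by (simp add: partitions_def)
    then show ?thesis by blast
  qed
  have "eventually P (refinement_filter t) \<longleftrightarrow>
      (\<exists>\<pi>\<^sub>0\<in>partitions t. eventually P (principal {\<pi> \<in> partitions t. \<pi>\<^sub>0 \<subseteq> \<pi>}))"
    unfolding refinement_filter_def
  proof (rule eventually_INF_base[OF ne])
    fix a b assume ab: "a \<in> partitions t" "b \<in> partitions t"
    show "\<exists>x\<in>partitions t. principal {\<pi> \<in> partitions t. x \<subseteq> \<pi>} \<le>
      inf (principal {\<pi> \<in> partitions t. a \<subseteq> \<pi>}) (principal {\<pi> \<in> partitions t. b \<subseteq> \<pi>})"
    proof (rule bexI)
      show "a \<union> b \<in> partitions t" using ab by (simp add: partitions_def)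
    qed auto
  qed
  then show ?thesis by (simp add: eventually_principal Ball_def imp_conjL)
qed

lemma refinement_filter_neq_bot: "0 \<le> t \<Longrightarrow> refinement_filter t \<noteq> bot"
  by (simp add: trivial_limit_def eventually_refinement_filter) blast


section \<open>Fock space\<close>

text \<open>\<open>expv\<close> exhibits \<open>'f\<close> as the Boson Fock space over \<open>L\<^sup>2(\<real>\<^sub>+; 'k)\<close>, with exponential vectors
  \<open>expv f\<close>, and \<open>tens\<close> exhibits \<open>'hf\<close> as the tensor product of \<open>'h\<close> with it.\<close>

locale ampliated_fock =
  fixes expv :: "(real \<Rightarrow> 'k::complex_hilbert) \<Rightarrow> 'f::complex_hilbert"
    and tens :: "'h::complex_hilbert \<Rightarrow> 'f \<Rightarrow> 'hf::complex_hilbert"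
  assumes cinner_expv:
      "\<And>f g. f \<in> L2 \<Longrightarrow> g \<in> L2 \<Longrightarrow> cinner (expv f) (expv g) = exp (L2_inner f g)"
    and expv_total: "closed_cspan (expv ` L2) = UNIV"
    and tensor: "hilbert_tensor UNIV UNIV UNIV tens"
begin

text \<open>The Fock spaces over \<open>[0,t)\<close> and \<open>[t,\<infinity>)\<close>, embedded in \<open>'f\<close> by extending the arguments of
  exponential vectors by \<open>0\<close>, i.e. by tensoring with the vacuum vector of the other factor.\<close>

definition past :: "real \<Rightarrow> 'f set" where
  "past t = closed_cspan {expv f | f. f \<in> L2 \<and> (\<forall>r\<ge>t. f r = 0)}"

definition future :: "real \<Rightarrow> 'f set" where
  "future t = closed_cspan {expv f | f. f \<in> L2 \<and> (\<forall>r<t. f r = 0)}"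

definition ampl_space :: "'f set \<Rightarrow> 'hf set" where
  "ampl_space K = closed_cspan {tens u x | u x. x \<in> K}"

abbreviation hpast :: "real \<Rightarrow> 'hf set" where "hpast t \<equiv> ampl_space (past t)"
abbreviation hfuture :: "real \<Rightarrow> 'hf set" where "hfuture t \<equiv> ampl_space (future t)"

text \<open>The factorisation \<open>F \<cong> past t \<otimes> future t\<close>, and its two versions for \<open>h \<otimes> F\<close>, with \<open>h\<close>
  attached to the past and to the future respectively. Each map is unique on the relevant
  subspaces.\<close>

definition join :: "real \<Rightarrow> 'f \<Rightarrow> 'f \<Rightarrow> 'f" where
  "join t = (SOME T. hilbert_tensor (past t) (future t) UNIV T
     \<and> (\<forall>f\<in>L2. T (expv (cut {..<t} f)) (expv (cut {t..} f)) = expv f))"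

definition hpast_join :: "real \<Rightarrow> 'hf \<Rightarrow> 'f \<Rightarrow> 'hf" where
  "hpast_join t = (SOME T. hilbert_tensor (hpast t) (future t) UNIV T
     \<and> (\<forall>u. \<forall>x\<in>past t. \<forall>y\<in>future t. T (tens u x) y = tens u (join t x y)))"

definition hfuture_join :: "real \<Rightarrow> 'f \<Rightarrow> 'hf \<Rightarrow> 'hf" where
  "hfuture_join t = (SOME T. hilbert_tensor (past t) (hfuture t) UNIV T
     \<and> (\<forall>u. \<forall>x\<in>past t. \<forall>y\<in>future t. T x (tens u y) = tens u (join t x y)))"

definition ampl :: "('f \<Rightarrow> 'f) \<Rightarrow> 'hf \<Rightarrow> 'hf" where
  "ampl X = op_tensor tens UNIV UNIV UNIV (id_op UNIV) X"

text \<open>\<open>M \<otimes> B(K)\<close>, the ultraweak closure of the algebraic tensor product.\<close>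

definition vn_tensor :: "('h \<Rightarrow> 'h) set \<Rightarrow> 'f set \<Rightarrow> ('hf \<Rightarrow> 'hf) set" where
  "vn_tensor M K = ultraweak_closure (ampl_space K)
     {(\<lambda>z. \<Sum>i<n. op_tensor tens UNIV K (ampl_space K) (a i) (b i) z) | (n::nat) a b.
        \<forall>i<n. a i \<in> M \<and> b i \<in> bounded_ops K}"


subsection \<open>Quantum stop times\<close>

text \<open>Only the values \<open>S A\<close> at Borel sets \<open>A\<close> of \<open>[0,\<infinity>]\<close> matter.\<close>

definition finite_stop_time :: "(ennreal set \<Rightarrow> 'f \<Rightarrow> 'f) \<Rightarrow> bool" where
  "finite_stop_time S \<longleftrightarrow>
     (\<forall>A\<in>sets borel. orthogonal_projection (S A))
     \<and> (\<forall>x y. \<forall>A::nat \<Rightarrow> ennreal set. range A \<subseteq> sets borel \<and> disjoint_family A \<longrightarrow>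
          (\<lambda>n. cinner x (S (A n) y)) sums cinner x (S (\<Union>n. A n) y))
     \<and> S UNIV = id_op UNIV
     \<and> (\<forall>t>0. \<exists>X\<in>bounded_ops (past t).
          S {0..ennreal t} = op_tensor (join t) (past t) (future t) UNIV X (id_op (future t)))
     \<and> S {0} = (\<lambda>x. 0) \<and> S {\<infinity>} = (\<lambda>x. 0)"


subsection \<open>The CCR flow\<close>

definition Gamma :: "real \<Rightarrow> 'f \<Rightarrow> 'f" where
  "Gamma t = (THE G. G \<in> bounded_ops UNIV \<and> (\<forall>f\<in>L2. G (expv f) = expv (shift t f)))"

text \<open>The flow on \<open>B(h \<otimes> F)\<close>. In the ampliation of \<open>X \<mapsto> I \<otimes> \<Gamma>\<^sub>t X \<Gamma>\<^sub>t\<^sup>*\<close>, the isometry \<open>\<Gamma>\<^sub>t\<close> becomes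
  \<open>I \<otimes> \<Gamma>\<^sub>t\<close>, which maps \<open>h \<otimes> F\<close> onto \<open>hfuture t\<close>, and the factor \<open>I\<close> acts on \<open>past t\<close>.
  On \<open>a \<otimes> X\<close> this gives \<open>a \<otimes> (I \<otimes> \<Gamma>\<^sub>t X \<Gamma>\<^sub>t\<^sup>*)\<close>.\<close>

definition flow :: "real \<Rightarrow> ('hf \<Rightarrow> 'hf) \<Rightarrow> 'hf \<Rightarrow> 'hf" where
  "flow t X = op_tensor (hfuture_join t) (past t) (hfuture t) UNIV (id_op (past t))
     (ampl (Gamma t) \<circ> X \<circ> adjoint_op UNIV (ampl (Gamma t)))"


subsection \<open>Cocycles\<close>

definition second_quant :: "('k \<Rightarrow> 'k) \<Rightarrow> real \<Rightarrow> 'f \<Rightarrow> 'f" where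
  "second_quant p t = (THE Q. Q \<in> bounded_ops (future t)
     \<and> (\<forall>f\<in>L2. (\<forall>r<t. f r = 0) \<longrightarrow> Q (expv f) = expv (\<lambda>r. p (f r))))"

definition past_tensor :: "real \<Rightarrow> ('hf \<Rightarrow> 'hf) \<Rightarrow> ('f \<Rightarrow> 'f) \<Rightarrow> 'hf \<Rightarrow> 'hf" where
  "past_tensor t A Y = op_tensor (hpast_join t) (hpast t) (future t) UNIV A Y"

definition adapted_process ::
    "('k \<Rightarrow> 'k) \<Rightarrow> ('h \<Rightarrow> 'h) set \<Rightarrow> (real \<Rightarrow> 'hf \<Rightarrow> 'hf) \<Rightarrow> bool" where
  "adapted_process p M V \<longleftrightarrow> (\<forall>t\<ge>0. V t \<in> vn_tensor M UNIV
     \<and> (\<exists>A\<in>vn_tensor M (past t). V t = past_tensor t A (second_quant p t)))"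

text \<open>The past component \<open>A\<close> of \<open>X = A \<otimes> P\<close> is unique because \<open>P \<noteq> 0\<close> fixes the vacuum.\<close>

definition past_part :: "('k \<Rightarrow> 'k) \<Rightarrow> real \<Rightarrow> ('hf \<Rightarrow> 'hf) \<Rightarrow> 'hf \<Rightarrow> 'hf" where
  "past_part p t X = (THE A. A \<in> bounded_ops (hpast t) \<and> X = past_tensor t A (second_quant p t))"

definition hat :: "('k \<Rightarrow> 'k) \<Rightarrow> (real \<Rightarrow> 'hf \<Rightarrow> 'hf) \<Rightarrow> real \<Rightarrow> 'hf \<Rightarrow> 'hf" where
  "hat p V t = past_tensor t (past_part p t (V t)) (id_op (future t))"

definition cocycle :: "('k \<Rightarrow> 'k) \<Rightarrow> ('h \<Rightarrow> 'h) set \<Rightarrow> (real \<Rightarrow> 'hf \<Rightarrow> 'hf) \<Rightarrow> bool" where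
  "cocycle p M V \<longleftrightarrow> adapted_process p M V
     \<and> (\<forall>s\<ge>0. \<forall>t\<ge>0. V (s + t) = hat p V s \<circ> flow s (V t))"

definition isometric :: "('k \<Rightarrow> 'k) \<Rightarrow> (real \<Rightarrow> 'hf \<Rightarrow> 'hf) \<Rightarrow> bool" where
  "isometric p V \<longleftrightarrow> (\<forall>t\<ge>0. let A = past_part p t (V t) in
     adjoint_op (hpast t) A \<circ> A = id_op (hpast t))"

definition strongly_continuous :: "(real \<Rightarrow> 'hf \<Rightarrow> 'hf) \<Rightarrow> bool" where
  "strongly_continuous V \<longleftrightarrow> (\<forall>z. continuous_on {0..} (\<lambda>r. V r z))"


subsection \<open>Stopped cocycles\<close>

definition stopped_sum ::
    "(real \<Rightarrow> 'hf \<Rightarrow> 'hf) \<Rightarrow> (ennreal set \<Rightarrow> 'f \<Rightarrow> 'f) \<Rightarrow> real set \<Rightarrow> 'hf \<Rightarrow> 'hf" where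
  "stopped_sum V S \<pi> z = (\<Sum>j=1..<card \<pi>. V (partition_pt \<pi> j)
     (ampl (S {ennreal (partition_pt \<pi> (j - 1))<..ennreal (partition_pt \<pi> j)}) z))"

definition stopped ::
    "(real \<Rightarrow> 'hf \<Rightarrow> 'hf) \<Rightarrow> (ennreal set \<Rightarrow> 'f \<Rightarrow> 'f) \<Rightarrow> real \<Rightarrow> 'hf \<Rightarrow> 'hf" where
  "stopped V S t z = Lim (refinement_filter t) (\<lambda>\<pi>. stopped_sum V S \<pi> z)"

end

end

theory Submission
  imports Defs
begin

text \<open>For \<open>s \<le> a\<close> the cocycle identity factorises \<open>V\<^sub>a = W Y\<close>, where the isometry \<open>W\<close> depends
  on \<open>s\<close> only and \<open>Y\<close> acts on \<open>h\<close> and on the future \<open>[s,\<infinity>)\<close> only, hence commutes with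
  \<open>S ((q, r])\<close> for \<open>r \<le> s\<close>. As these projections are mutually orthogonal, so are the terms of
  \<open>V\<^sub>S\<^sub>,\<^sub>\<pi> z\<close> and of the differences \<open>V\<^sub>S\<^sub>,\<^sub>\<pi> z - V\<^sub>S\<^sub>,\<^sub>\<rho> z\<close> for \<open>\<pi> \<subseteq> \<rho>\<close>; this gives the norm estimate. For
  \<open>z = u \<otimes> \<epsilon>(f)\<close> each term of the difference is an increment \<open>(V\<^sub>b - V\<^sub>a) S\<^sub>k z\<close>, with \<open>S\<^sub>k\<close> acting on
  the past of \<open>a \<le> b\<close>, so its norm is \<open>\<parallel>(V\<^sub>b - V\<^sub>a) z\<parallel> \<parallel>S\<^sub>k \<epsilon>(f)\<parallel> / \<parallel>\<epsilon>(f)\<parallel>\<close>, and the uniform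
  continuity of \<open>r \<mapsto> V\<^sub>r z\<close> on \<open>[0,t]\<close> makes the net Cauchy.\<close>

subsection \<open>Inner products\<close>

text \<open>The spaces and maps are known only through defining properties: exponential vectors by
  their Gram matrix, tensor products by inner products of elementary tensors, operators by a choice
  or a definite description. Each must be shown to exist before anything can be computed. Mostly one
  principle does this: values prescribed on a total family extend to a bounded operator once they
  increase the norms of linear combinations by at most a fixed factor, and proportional Gram
  matrices guarantee this.

  The operator \<open>V a\<close> need not be isometric, as it carries the second quantised
  projection on the future; the isometry of the overview is \<open>hat p V s\<close>. Taking
  \<open>V\<close> at the right end of each interval matters: the projection of that interval acts
  on the past of that time. Exponential vectors are used because they split as product vectors at
  every time simultaneously, so one \<open>z\<close> serves all partition points. The weights in the
  estimate are controlled by Bessel's inequality, independently of the number of cells, and the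
  uniform norm bound carries convergence from a total set to all vectors.\<close>

lemma scaleC_zero_left [simp]: "0 *\<^sub>C (x::'a::complex_hilbert) = 0"
  by (rule complex_vector.scale_zero_left)

lemma scaleC_zero_right [simp]: "c *\<^sub>C (0::'a::complex_hilbert) = 0"
  by (rule complex_vector.scale_zero_right)

lemma scaleC_one [simp]: "1 *\<^sub>C (x::'a::complex_hilbert) = x"
  by (rule complex_vector.scale_one)

lemma cinner_add_left: "cinner (x + y) z = cinner x z + cinner y z"
  by (metis cinner_add_right cinner_commute complex_cnj_add)

lemma cinner_scaleC_left: "cinner (c *\<^sub>C x) y = cnj c * cinner x y"
  by (metis cinner_scaleC_right cinner_commute complex_cnj_mult)

lemma cinner_zero_right [simp]: "cinner x 0 = 0"
  using cinner_scaleC_right[of x 0 0] by simp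

lemma cinner_zero_left [simp]: "cinner 0 x = 0"
  using cinner_scaleC_left[of 0 0 x] by simp

lemma cinner_minus_right: "cinner x (- y) = - cinner x y"
  using cinner_add_right[of x y "- y"] by (simp add: eq_neg_iff_add_eq_0 add.commute)

lemma cinner_minus_left: "cinner (- x) y = - cinner x y"
  using cinner_add_left[of x "- x" y] by (simp add: eq_neg_iff_add_eq_0 add.commute)

lemma cinner_diff_right: "cinner x (y - z) = cinner x y - cinner x z"
  using cinner_add_right[of x y "- z"] by (simp add: cinner_minus_right)

lemma cinner_diff_left: "cinner (x - y) z = cinner x z - cinner y z"
  using cinner_add_left[of x "- y" z] by (simp add: cinner_minus_left)

lemma cinner_sum_right: "cinner x (\<Sum>i\<in>F. f i) = (\<Sum>i\<in>F. cinner x (f i))"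
  by (induction F rule: infinite_finite_induct) (simp_all add: cinner_add_right)

lemma cinner_sum_left: "cinner (\<Sum>i\<in>F. f i) x = (\<Sum>i\<in>F. cinner (f i) x)"
  by (induction F rule: infinite_finite_induct) (simp_all add: cinner_add_left)

lemma cinner_eq_zero_iff: "cinner x x = 0 \<longleftrightarrow> x = 0"
  by (simp add: cinner_self)

lemma cinner_ext: "(\<And>w. cinner w x = cinner w y) \<Longrightarrow> x = y"
  using cinner_eq_zero_iff[of "x - y"] by (simp add: cinner_diff_right)

lemma norm_eq_sqrt_cinner: "(norm x)\<^sup>2 = Re (cinner x x)"
  by (simp add: cinner_self)

lemma norm_scaleC: "norm (c *\<^sub>C x) = cmod c * norm (x::'a::complex_hilbert)"
proof -
  have "complex_of_real ((norm (c *\<^sub>C x))\<^sup>2) = complex_of_real ((cmod c * norm x)\<^sup>2)"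
    unfolding cinner_self[where 'a='a, symmetric] power_mult_distrib of_real_mult complex_norm_square
    by (simp add: cinner_self[where 'a='a, symmetric] cinner_scaleC_left cinner_scaleC_right mult_ac)
  then show ?thesis
    unfolding of_real_eq_iff by (rule power2_eq_imp_eq) simp_all
qed

lemma norm_add_square: "(norm (x + y))\<^sup>2 = (norm x)\<^sup>2 + (norm y)\<^sup>2 + 2 * Re (cinner x y)"
proof -
  have "Re (cinner y x) = Re (cinner x y)" by (subst cinner_commute) simp
  then show ?thesis by (simp add: norm_eq_sqrt_cinner cinner_add_left cinner_add_right)
qed

lemma parallelogram:
  "(norm (x + y))\<^sup>2 + (norm (x - y))\<^sup>2 = 2 * (norm x)\<^sup>2 + 2 * (norm (y::'a::complex_hilbert))\<^sup>2"
  using norm_add_square[of x y] norm_add_square[of x "- y"] by (simp add: cinner_minus_right)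

lemma Cauchy_Schwarz: "cmod (cinner x y) \<le> norm x * norm y"
proof (cases "y = 0")
  case False
  define a where "a = cinner y x"
  define z where "z = x - (a / complex_of_real ((norm y)\<^sup>2)) *\<^sub>C y"
  have ny: "(norm y)\<^sup>2 \<noteq> 0" using False by simp
  have yz: "cinner y z = 0"
    using ny by (simp add: z_def cinner_diff_right cinner_scaleC_right cinner_self a_def)
  have xy: "cinner x y = cnj a" by (metis a_def cinner_commute)
  have "cinner z z = cinner x z"
    using yz by (subst z_def) (simp add: cinner_diff_left cinner_scaleC_left)
  also have "\<dots> = complex_of_real ((norm x)\<^sup>2) - a / complex_of_real ((norm y)\<^sup>2) * cnj a"
    by (simp add: z_def cinner_diff_right cinner_scaleC_right cinner_self xy)
  also have "\<dots> = complex_of_real ((norm x)\<^sup>2 - (cmod a)\<^sup>2 / (norm y)\<^sup>2)"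
    by (simp flip: complex_norm_square)
  finally have "(norm z)\<^sup>2 = (norm x)\<^sup>2 - (cmod a)\<^sup>2 / (norm y)\<^sup>2"
    unfolding cinner_self of_real_eq_iff .
  then have "(cmod a)\<^sup>2 / (norm y)\<^sup>2 \<le> (norm x)\<^sup>2" by (metis zero_le_power2 diff_ge_0_iff_ge)
  then have "(cmod a)\<^sup>2 \<le> (norm x * norm y)\<^sup>2"
    using False by (simp add: divide_le_eq power_mult_distrib)
  then have "cmod a \<le> norm x * norm y" by (rule power2_le_imp_le) simp
  then show ?thesis by (simp add: xy)
qed simp

lemma bounded_bilinear_cinner: "bounded_bilinear cinner"
proof
  show "\<exists>K. \<forall>a b. cmod (cinner a b) \<le> norm a * norm b * K"
    by (metis Cauchy_Schwarz mult.right_neutral)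
qed (simp_all add: cinner_add_left cinner_add_right scaleR_scaleC[where 'a='a] cinner_scaleC_left
    cinner_scaleC_right scaleR_conv_of_real)

lemma bounded_linear_scaleC: "bounded_linear (\<lambda>x::'a::complex_hilbert. c *\<^sub>C x)"
  by (rule bounded_linear_intro[where K = "cmod c"])
    (simp_all add: scaleC_add_right scaleR_scaleC scaleC_scaleC norm_scaleC mult.commute)

lemmas tendsto_cinner [tendsto_intros] = bounded_bilinear.tendsto[OF bounded_bilinear_cinner]
lemmas tendsto_scaleC [tendsto_intros] = bounded_linear.tendsto[OF bounded_linear_scaleC]

text \<open>The norm of a linear combination depends on the vectors only through their Gram matrix;
  comparing operators thus reduces to comparing inner products of generators.\<close>

lemma norm_sum_scaleC_square:
  "complex_of_real ((norm (\<Sum>i\<in>F. c i *\<^sub>C x i))\<^sup>2)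
     = (\<Sum>i\<in>F. \<Sum>j\<in>F. cnj (c i) * c j * cinner (x i) (x j))"
  unfolding cinner_self[symmetric]
  by (simp add: cinner_sum_left cinner_sum_right cinner_scaleC_left cinner_scaleC_right
      sum_distrib_left mult.assoc) (subst sum.swap, simp add: mult_ac)

lemma norm_sum_orthogonal:
  assumes "finite F" "\<And>i j. i \<in> F \<Longrightarrow> j \<in> F \<Longrightarrow> i \<noteq> j \<Longrightarrow> cinner (x i) (x j) = 0"
  shows "(norm (\<Sum>i\<in>F. x i))\<^sup>2 = (\<Sum>i\<in>F. (norm (x i))\<^sup>2)"
  using assms
proof (induction F rule: finite_induct)
  case (insert i F)
  have "cinner (x i) (\<Sum>j\<in>F. x j) = 0"
    unfolding cinner_sum_right using insert.hyps insert.prems by (intro sum.neutral) auto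
  then show ?case using insert by (simp add: norm_add_square)
qed simp


subsection \<open>Closed subspaces and bounded operators on them\<close>

definition closed_csubspace :: "'a::complex_hilbert set \<Rightarrow> bool" where
  "closed_csubspace C \<longleftrightarrow> complex_vector.subspace C \<and> closed C"

lemma closed_csubspaceD:
  assumes "closed_csubspace C"
  shows "0 \<in> C" "x \<in> C \<Longrightarrow> y \<in> C \<Longrightarrow> x + y \<in> C" "x \<in> C \<Longrightarrow> c *\<^sub>C x \<in> C"
    "x \<in> C \<Longrightarrow> y \<in> C \<Longrightarrow> x - y \<in> C" "closed C"
  using assms complex_vector.subspace_diff[of C x y]
  unfolding closed_csubspace_def complex_vector.subspace_def by blast+

lemma closed_csubspace_UNIV [simp]: "closed_csubspace UNIV"
  by (simp add: closed_csubspace_def)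

lemma closed_csubspace_zero [simp]: "closed_csubspace {0}"
  by (simp add: closed_csubspace_def)

lemma closed_csubspace_closed_cspan [simp]: "closed_csubspace (closed_cspan X)"
  unfolding closed_csubspace_def complex_vector.subspace_def closed_cspan_def
proof (intro conjI ballI allI)
  have sub: "cspan X \<subseteq> closure (cspan X)" by (rule closure_subset)
  show "0 \<in> closure (cspan X)" using complex_vector.span_zero sub by blast
  fix x assume x: "x \<in> closure (cspan X)"
  then obtain s where s: "\<And>n::nat. s n \<in> cspan X" "s \<longlonglongrightarrow> x"
    unfolding closure_sequential by blast
  show "c *\<^sub>C x \<in> closure (cspan X)" for c
    unfolding closure_sequential
    using s by (intro exI[of _ "\<lambda>n. c *\<^sub>C s n"] conjI allI complex_vector.span_scale tendsto_scaleC)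
  fix y assume y: "y \<in> closure (cspan X)"
  then obtain u where u: "\<And>n::nat. u n \<in> cspan X" "u \<longlonglongrightarrow> y"
    unfolding closure_sequential by blast
  show "x + y \<in> closure (cspan X)"
    unfolding closure_sequential
    using s u by (intro exI[of _ "\<lambda>n. s n + u n"] conjI allI complex_vector.span_add tendsto_add)
qed simp

lemma closed_cspan_superset: "x \<in> X \<Longrightarrow> x \<in> closed_cspan X"
  unfolding closed_cspan_def by (rule subsetD[OF closure_subset complex_vector.span_base])

lemma closed_cspan_minimal: "X \<subseteq> C \<Longrightarrow> closed_csubspace C \<Longrightarrow> closed_cspan X \<subseteq> C"
  unfolding closed_cspan_def closed_csubspace_def
  by (simp add: closure_minimal complex_vector.span_minimal)

lemma closed_cspan_mono: "X \<subseteq> Y \<Longrightarrow> closed_cspan X \<subseteq> closed_cspan Y"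
  by (meson closed_cspan_minimal closed_cspan_superset closed_csubspace_closed_cspan subset_iff)

lemma closed_cspan_self: "closed_csubspace C \<Longrightarrow> closed_cspan C = C"
  by (simp add: closed_cspan_minimal closed_cspan_superset subset_antisym subsetI)

text \<open>Unlike \<open>bounded_ops\<close>, this allows a different target space, keeps the
  constant explicit so that contractions stay visible, and says nothing about values off
  \<open>C\<close>. The constant is not assumed nonnegative;
  \<open>clinear_bounded_on_nonneg\<close> supplies that where constants are multiplied.\<close>

definition clinear_bounded_on ::
    "'a::complex_hilbert set \<Rightarrow> real \<Rightarrow> ('a \<Rightarrow> 'b::complex_hilbert) \<Rightarrow> bool" where
  "clinear_bounded_on C K A \<longleftrightarrow> (\<forall>x\<in>C. \<forall>y\<in>C. A (x + y) = A x + A y)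
     \<and> (\<forall>c. \<forall>x\<in>C. A (c *\<^sub>C x) = c *\<^sub>C A x) \<and> (\<forall>x\<in>C. norm (A x) \<le> K * norm x)"

lemma clinear_bounded_onD:
  assumes "clinear_bounded_on C K A" "x \<in> C"
  shows "y \<in> C \<Longrightarrow> A (x + y) = A x + A y" "A (c *\<^sub>C x) = c *\<^sub>C A x" "norm (A x) \<le> K * norm x"
  using assms by (auto simp: clinear_bounded_on_def)

lemma bounded_ops_iff:
  "A \<in> bounded_ops H \<longleftrightarrow> (\<forall>x\<in>H. A x \<in> H) \<and> (\<forall>x. x \<notin> H \<longrightarrow> A x = 0) \<and> (\<exists>K. clinear_bounded_on H K A)"
  unfolding bounded_ops_def clinear_bounded_on_def by blast

lemma bounded_ops_UNIV_iff: "A \<in> bounded_ops UNIV \<longleftrightarrow> (\<exists>K. clinear_bounded_on UNIV K A)"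
  by (simp add: bounded_ops_iff)

lemma clinear_bounded_on_mono:
  "clinear_bounded_on C K A \<Longrightarrow> K \<le> L \<Longrightarrow> D \<subseteq> C \<Longrightarrow> clinear_bounded_on D L A"
  unfolding clinear_bounded_on_def
  by (meson in_mono mult_right_mono norm_ge_zero order_trans)

lemma clinear_bounded_on_nonneg:
  assumes "clinear_bounded_on C K A"
  obtains L where "0 \<le> L" "clinear_bounded_on C L A"
  using clinear_bounded_on_mono[OF assms, of "max K 0"] by (metis max.cobounded1 max.cobounded2 order_refl)

lemma clinear_bounded_on_comp:
  assumes A: "clinear_bounded_on C K A" and B: "clinear_bounded_on D L B"
    and AC: "\<And>x. x \<in> C \<Longrightarrow> A x \<in> D" and L: "0 \<le> L"
  shows "clinear_bounded_on C (L * K) (\<lambda>x. B (A x))"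
proof -
  have "norm (B (A x)) \<le> L * K * norm x" if "x \<in> C" for x
    using clinear_bounded_onD(3)[OF B AC[OF that]] clinear_bounded_onD(3)[OF A that] L
    by (smt (verit) mult.assoc mult_left_mono)
  then show ?thesis using A B AC by (simp add: clinear_bounded_on_def)
qed

lemma clinear_bounded_on_add:
  assumes "clinear_bounded_on C K A" "clinear_bounded_on C L B"
  shows "clinear_bounded_on C (K + L) (\<lambda>x. A x + B x)"
  using assms unfolding clinear_bounded_on_def
  by (auto simp: scaleC_add_right distrib_right intro: norm_triangle_mono)

lemma clinear_bounded_on_scaleC:
  assumes "clinear_bounded_on C K A"
  shows "clinear_bounded_on C (cmod c * K) (\<lambda>x. c *\<^sub>C A x)"
proof -
  have "c *\<^sub>C d *\<^sub>C y = d *\<^sub>C c *\<^sub>C y" for d and y :: 'b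
    by (simp add: scaleC_scaleC mult.commute)
  then show ?thesis
    using assms unfolding clinear_bounded_on_def
    by (auto simp: scaleC_add_right norm_scaleC mult.assoc intro: mult_left_mono)
qed

lemma clinear_bounded_on_diff:
  assumes "clinear_bounded_on C K A" "clinear_bounded_on C L B"
  shows "clinear_bounded_on C (K + L) (\<lambda>x. A x - B x)"
proof -
  have "(-1) *\<^sub>C y = - y" for y :: 'b using complex_vector.scale_minus_left[of 1 y] by simp
  then show ?thesis
    using clinear_bounded_on_add[OF assms(1) clinear_bounded_on_scaleC[OF assms(2), of "-1"]] by simp
qed

lemma clinear_bounded_on_id: "clinear_bounded_on C 1 (\<lambda>x. x)"
  by (simp add: clinear_bounded_on_def)

lemma clinear_bounded_on_cinner: "clinear_bounded_on C (norm w) (cinner w)"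
  by (simp add: clinear_bounded_on_def cinner_add_right cinner_scaleC_right scaleC_complex_def
      Cauchy_Schwarz)

lemma clinear_bounded_on_cinner_comp:
  assumes "clinear_bounded_on C K A"
  shows "clinear_bounded_on C (norm w * K) (\<lambda>x. cinner w (A x))"
  by (rule clinear_bounded_on_comp[OF assms clinear_bounded_on_cinner[of UNIV]]) simp_all

lemma clinear_bounded_on_minus_arg:
  assumes "clinear_bounded_on C K A" "closed_csubspace C" "x \<in> C" "y \<in> C"
  shows "A (x - y) = A x - A y"
  using clinear_bounded_onD(1)[OF assms(1) closed_csubspaceD(4)[OF assms(2-4)] assms(4)] by simp

lemma clinear_bounded_on_zero_arg:
  assumes "clinear_bounded_on C K A" "closed_csubspace C"
  shows "A 0 = 0"
  using clinear_bounded_on_minus_arg[OF assms, of 0 0] closed_csubspaceD(1)[OF assms(2)] by simp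

lemma clinear_bounded_on_sum_arg:
  assumes "clinear_bounded_on C K A" "closed_csubspace C" "\<And>i. i \<in> F \<Longrightarrow> x i \<in> C"
  shows "A (\<Sum>i\<in>F. x i) = (\<Sum>i\<in>F. A (x i)) \<and> (\<Sum>i\<in>F. x i) \<in> C"
  using assms(3)
  by (induction F rule: infinite_finite_induct)
    (use assms(1,2) in \<open>auto simp: clinear_bounded_on_zero_arg closed_csubspaceD clinear_bounded_onD\<close>)

lemma clinear_bounded_on_tendsto:
  assumes A: "clinear_bounded_on C K A" and C: "closed_csubspace C"
    and s: "\<And>n. s n \<in> C" "s \<longlonglongrightarrow> x"
  shows "x \<in> C" "(\<lambda>n. A (s n)) \<longlonglongrightarrow> A x"
proof -
  show x: "x \<in> C" using C s closed_sequentially[of C s x] by (auto dest: closed_csubspaceD)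
  have "(\<lambda>n. K * norm (s n - x)) \<longlonglongrightarrow> K * norm (x - x)" by (intro tendsto_intros s)
  then have lim: "(\<lambda>n. K * norm (s n - x)) \<longlonglongrightarrow> 0" by simp
  have "norm (A (s n) - A x) \<le> K * norm (s n - x)" for n
    using clinear_bounded_onD(3)[OF A closed_csubspaceD(4)[OF C s(1) x]]
    by (simp add: clinear_bounded_on_minus_arg[OF A C s(1) x])
  then have "(\<lambda>n. A (s n) - A x) \<longlonglongrightarrow> 0"
    by (rule Lim_null_comparison[OF always_eventually[OF allI] lim])
  then show "(\<lambda>n. A (s n)) \<longlonglongrightarrow> A x" by (rule LIM_zero_cancel)
qed

lemma closed_csubspace_vimage:
  assumes A: "clinear_bounded_on C K A" and C: "closed_csubspace C" and D: "closed_csubspace D"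
  shows "closed_csubspace {x \<in> C. A x \<in> D}"
  unfolding closed_csubspace_def complex_vector.subspace_def
proof (intro conjI ballI allI)
  show "closed {x \<in> C. A x \<in> D}"
    unfolding closed_sequential_limits
  proof (intro allI impI, elim conjE)
    fix s l assume s: "\<forall>n. s n \<in> {x \<in> C. A x \<in> D}" "s \<longlonglongrightarrow> l"
    have "l \<in> C" "(\<lambda>n. A (s n)) \<longlonglongrightarrow> A l"
      using clinear_bounded_on_tendsto[OF A C, of s l] s by auto
    then show "l \<in> {x \<in> C. A x \<in> D}"
      using s(1) closed_csubspaceD(5)[OF D] closed_sequentially[of D "\<lambda>n. A (s n)" "A l"] by auto
  qed
qed (use clinear_bounded_on_zero_arg[OF A C] clinear_bounded_onD(1,2)[OF A] closed_csubspaceD[OF C]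
      closed_csubspaceD[OF D] in auto)

text \<open>The vectors that \<open>A\<close> sends into \<open>D\<close> form a closed subspace, so
  it suffices to look at generators. Most density arguments below are instances of this or of the
  next two lemmas.\<close>

lemma clinear_bounded_on_range:
  assumes A: "clinear_bounded_on (closed_cspan X) K A" and D: "closed_csubspace D"
    and X: "\<And>x. x \<in> X \<Longrightarrow> A x \<in> D" and x: "x \<in> closed_cspan X"
  shows "A x \<in> D"
proof -
  have "closed_cspan X \<subseteq> {x \<in> closed_cspan X. A x \<in> D}"
    by (rule closed_cspan_minimal[OF _ closed_csubspace_vimage[OF A _ D]])
      (use X closed_cspan_superset in auto)
  then show ?thesis using x by blast
qed

lemma clinear_bounded_on_eqI:
  assumes "clinear_bounded_on (closed_cspan X) K A" "clinear_bounded_on (closed_cspan X) L B"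
    and "\<And>x. x \<in> X \<Longrightarrow> A x = B x" and "x \<in> closed_cspan X"
  shows "A x = B x"
  using clinear_bounded_on_range[OF clinear_bounded_on_diff[OF assms(1,2)] closed_csubspace_zero _ assms(4)]
    assms(3) by auto

text \<open>One variable is extended at a time; \<open>cinner\<close> is linear only in the second,
  so the first is reached by exchanging the arguments. The primed maps let both isometry and adjoint
  relations be instances.\<close>

lemma cinner_eq_on_closed_cspan:
  assumes A: "clinear_bounded_on (closed_cspan X) K A" and B: "clinear_bounded_on (closed_cspan Y) L B"
    and A': "clinear_bounded_on (closed_cspan X) K' A'" and B': "clinear_bounded_on (closed_cspan Y) L' B'"
    and XY: "\<And>x y. x \<in> X \<Longrightarrow> y \<in> Y \<Longrightarrow> cinner (A x) (B y) = cinner (A' x) (B' y)"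
    and x: "x \<in> closed_cspan X" and y: "y \<in> closed_cspan Y"
  shows "cinner (A x) (B y) = cinner (A' x) (B' y)"
proof -
  have 1: "cinner (A x) (B y) = cinner (A' x) (B' y)" if "x \<in> X" for x
    by (rule clinear_bounded_on_eqI[OF clinear_bounded_on_cinner_comp[OF B]
          clinear_bounded_on_cinner_comp[OF B'] XY y]) (rule that)
  have "cinner (B y) (A x) = cinner (B' y) (A' x)"
    by (rule clinear_bounded_on_eqI[OF clinear_bounded_on_cinner_comp[OF A]
          clinear_bounded_on_cinner_comp[OF A'] _ x]) (metis 1 cinner_commute)
  then show ?thesis by (metis cinner_commute)
qed

subsection \<open>Orthogonal projections and adjoints\<close>

text \<open>A sequence minimising the distance from \<open>x\<close> to \<open>C\<close> is Cauchy
  by the parallelogram law, and the residual at a minimiser is orthogonal to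
  \<open>C\<close>.\<close>

lemma orthogonal_projection_point:
  fixes x :: "'a::complex_hilbert"
  assumes C: "closed_csubspace C"
  shows "\<exists>p\<in>C. \<forall>y\<in>C. cinner y (x - p) = 0"
proof -
  define D where "D = (INF y\<in>C. (norm (x - y))\<^sup>2)"
  have bdd: "bdd_below ((\<lambda>y. (norm (x - y))\<^sup>2) ` C)" by (rule bdd_belowI2[of _ 0]) simp
  have D: "D \<le> (norm (x - y))\<^sup>2" if "y \<in> C" for y
    unfolding D_def by (rule cINF_lower[OF bdd that])
  have ne: "C \<noteq> {}" using closed_csubspaceD(1)[OF C] by blast
  have "\<exists>y\<in>C. (norm (x - y))\<^sup>2 < D + e" if "0 < e" for e
  proof -
    have "D < D + e" using that by simp
    then show ?thesis unfolding D_def cINF_less_iff[OF ne bdd] .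
  qed
  then have "\<forall>n::nat. \<exists>y. y \<in> C \<and> (norm (x - y))\<^sup>2 < D + inverse (Suc n)"
    by (metis inverse_positive_iff_positive of_nat_0_less_iff zero_less_Suc)
  then obtain y where y: "\<And>n. y n \<in> C" "\<And>n. (norm (x - y n))\<^sup>2 < D + inverse (Suc n)"
    unfolding choice_iff by blast
  have close: "(norm (y n - y m))\<^sup>2 < 2 * inverse (Suc n) + 2 * inverse (Suc m)" for n m
  proof -
    \<comment> \<open>The midpoint lies in \<open>C\<close>, hence is no closer to \<open>x\<close>
      than the infimum; the parallelogram law then forces \<open>y n\<close> and \<open>y m\<close>
      together.\<close>
    define w where "w = (1/2) *\<^sub>R (y n + y m)"
    have "w \<in> C" unfolding w_def scaleR_scaleC using y(1) C closed_csubspaceD(2,3) by blast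
    then have "D \<le> (norm (x - w))\<^sup>2" by (rule D)
    moreover have "(x - y n) + (x - y m) = 2 *\<^sub>R (x - w)"
      by (simp add: w_def scaleR_right_diff_distrib scaleR_2)
    moreover have "(x - y n) - (x - y m) = y m - y n" by simp
    ultimately show ?thesis
      using parallelogram[of "x - y n" "x - y m"] y(2)[of n] y(2)[of m]
      by (simp add: norm_minus_commute)
  qed
  have "Cauchy y"
  proof (rule CauchyI)
    fix e :: real assume e: "0 < e"
    obtain N where N: "inverse (Suc N) < e\<^sup>2 / 4"
      using e reals_Archimedean[of "e\<^sup>2 / 4"] by auto
    have "norm (y m - y n) < e" if "N \<le> m" "N \<le> n" for m n
    proof -
      have "inverse (real (Suc m)) \<le> inverse (Suc N)" "inverse (real (Suc n)) \<le> inverse (Suc N)"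
        using that by (simp_all add: inverse_eq_divide frac_le)
      then have "(norm (y m - y n))\<^sup>2 < e\<^sup>2" using close[of m n] N by linarith
      then show ?thesis by (rule power2_less_imp_less) (use e in simp)
    qed
    then show "\<exists>N. \<forall>m\<ge>N. \<forall>n\<ge>N. norm (y m - y n) < e" by blast
  qed
  then obtain p where p: "y \<longlonglongrightarrow> p" using Cauchy_convergent_iff convergent_def by blast
  have pC: "p \<in> C" using closed_sequentially[of C y p] C y(1) p closed_csubspaceD(5) by blast
  have "(\<lambda>n. (norm (x - y n))\<^sup>2) \<longlonglongrightarrow> (norm (x - p))\<^sup>2" by (intro tendsto_intros p)
  moreover have "(\<lambda>n. D + inverse (Suc n)) \<longlonglongrightarrow> D + 0"
    by (intro tendsto_intros LIMSEQ_inverse_real_of_nat)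
  ultimately have pD: "(norm (x - p))\<^sup>2 \<le> D"
    using LIMSEQ_le[of "\<lambda>n. (norm (x - y n))\<^sup>2" _ "\<lambda>n. D + inverse (Suc n)" "D + 0"] y(2)
    by (auto intro: less_imp_le)
  have "cinner u (x - p) = 0" if u: "u \<in> C" for u
  proof (cases "u = 0")
    case False
    define a where "a = cinner u (x - p)"
    \<comment> \<open>The coefficient for which \<open>p + c *\<^sub>C u\<close> is the best
      approximation along \<open>u\<close>; minimality of \<open>p\<close> then forces
      \<open>a = 0\<close>.\<close>
    define c where "c = a / complex_of_real ((norm u)\<^sup>2)"
    have "p + c *\<^sub>C u \<in> C" using pC u C closed_csubspaceD(2,3) by blast
    then have "(norm (x - p))\<^sup>2 \<le> (norm (x - (p + c *\<^sub>C u)))\<^sup>2"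
      using pD by (intro order_trans[OF pD D])
    also have "x - (p + c *\<^sub>C u) = (x - p) + (- c) *\<^sub>C u" by simp
    also have "(norm \<dots>)\<^sup>2 = (norm (x - p))\<^sup>2 + (cmod c * norm u)\<^sup>2 - 2 * Re (c * cnj a)"
      unfolding norm_add_square cinner_scaleC_right norm_scaleC a_def
      by (subst cinner_commute) (simp add: norm_scaleC)
    also have "c * cnj a = complex_of_real ((cmod a)\<^sup>2 / (norm u)\<^sup>2)"
      using complex_norm_square[of a] by (simp add: c_def)
    also have "cmod c * norm u = cmod a / norm u"
      using False by (simp add: c_def norm_divide norm_mult power2_eq_square)
    also have "(cmod a / norm u)\<^sup>2 = (cmod a)\<^sup>2 / (norm u)\<^sup>2" by (rule power_divide)
    finally have "(cmod a)\<^sup>2 / (norm u)\<^sup>2 \<le> 0" by simp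
    then have "(cmod a)\<^sup>2 \<le> 0" using False by (simp add: divide_le_0_iff)
    then show ?thesis by (simp add: a_def)
  qed simp
  with pC show ?thesis by blast
qed

text \<open>The complement of the kernel in \<open>C\<close> is at most a line: every vector of
  \<open>C\<close> is a kernel vector plus a multiple of \<open>w\<close>, the residual of some
  \<open>z\<close> off the kernel.\<close>

lemma Riesz_representation:
  fixes f :: "'a::complex_hilbert \<Rightarrow> complex"
  assumes f: "clinear_bounded_on C K f" and C: "closed_csubspace C"
  obtains v where "v \<in> C" "\<And>x. x \<in> C \<Longrightarrow> f x = cinner v x"
proof (cases "\<forall>x\<in>C. f x = 0")
  case True
  then show ?thesis using that[of 0] closed_csubspaceD(1)[OF C] by simp
next
  case False
  then obtain z where z: "z \<in> C" "f z \<noteq> 0" by blast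
  have N: "closed_csubspace {x \<in> C. f x \<in> {0}}"
    by (rule closed_csubspace_vimage[OF f C closed_csubspace_zero])
  obtain q where q: "q \<in> {x \<in> C. f x \<in> {0}}"
      "\<And>y. y \<in> {x \<in> C. f x \<in> {0}} \<Longrightarrow> cinner y (z - q) = 0"
    using orthogonal_projection_point[OF N, of z] by blast
  define w where "w = z - q"
  have w: "w \<in> C" using z q C closed_csubspaceD(4) unfolding w_def by blast
  have fw: "f w = f z" using clinear_bounded_on_minus_arg[OF f C z(1), of q] q(1) by (simp add: w_def)
  have w0: "w \<noteq> 0" using fw z(2) clinear_bounded_on_zero_arg[OF f C] by auto
  \<comment> \<open>Normalised so that \<open>cinner v w = f w\<close>.\<close>
  define v where "v = (cnj (f w) / complex_of_real ((norm w)\<^sup>2)) *\<^sub>C w"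
  have "f x = cinner v x" if x: "x \<in> C" for x
  proof -
    define y where "y = x - (f x / f w) *\<^sub>C w"
    have cw: "(f x / f w) *\<^sub>C w \<in> C" using w C closed_csubspaceD(3) by blast
    have "f y = 0"
      using clinear_bounded_on_minus_arg[OF f C x cw] clinear_bounded_onD(2)[OF f w] fw z(2)
      by (simp add: y_def scaleC_complex_def)
    then have "cinner y w = 0" using q(2)[of y] closed_csubspaceD(4)[OF C x cw] by (simp add: y_def w_def)
    then have "cinner w y = 0" by (metis cinner_commute complex_cnj_zero)
    then have "cinner w x = f x / f w * complex_of_real ((norm w)\<^sup>2)"
      by (simp add: y_def cinner_diff_right cinner_scaleC_right cinner_self)
    then show ?thesis using fw z(2) w0 by (simp add: v_def cinner_scaleC_left)
  qed
  moreover have "v \<in> C" unfolding v_def using w C closed_csubspaceD(3) by blast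
  ultimately show ?thesis using that by blast
qed

lemma cinner_ext_on:
  assumes "closed_csubspace H" "v \<in> H" "w \<in> H" "\<And>y. y \<in> H \<Longrightarrow> cinner v y = cinner w y"
  shows "v = w"
proof -
  have "cinner (v - w) (v - w) = 0"
    using assms closed_csubspaceD(4)[OF assms(1-3)] by (simp add: cinner_diff_left)
  then show ?thesis by (simp add: cinner_eq_zero_iff)
qed

text \<open>Riesz representation of \<open>\<lambda>y. cinner x (X y)\<close> on \<open>H\<close>
  gives \<open>B0 x\<close>; putting zero off \<open>H\<close> meets the convention of
  \<open>bounded_ops\<close> and makes the operator unique, so the definite description denotes
  it.\<close>

lemma adjoint_op_exists:
  assumes H: "closed_csubspace H" and X: "clinear_bounded_on H K X" and XH: "\<And>x. x \<in> H \<Longrightarrow> X x \<in> H"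
  shows "adjoint_op H X \<in> bounded_ops H
    \<and> (\<forall>x\<in>H. \<forall>y\<in>H. cinner (adjoint_op H X x) y = cinner x (X y))"
proof -
  have "\<exists>v. v \<in> H \<and> (\<forall>y\<in>H. cinner x (X y) = cinner v y)" for x
    by (metis Riesz_representation[OF clinear_bounded_on_cinner_comp[OF X] H])
  then obtain B0 where B0: "\<And>x. B0 x \<in> H" "\<And>x y. y \<in> H \<Longrightarrow> cinner x (X y) = cinner (B0 x) y"
    by metis
  obtain L where L: "0 \<le> L" "clinear_bounded_on H L X" using clinear_bounded_on_nonneg[OF X] .
  define B where "B x = (if x \<in> H then B0 x else 0)" for x
  have "clinear_bounded_on H L B0"
    unfolding clinear_bounded_on_def
  proof (intro conjI ballI allI)
    fix x
    show "B0 (x + y) = B0 x + B0 y" for y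
      by (rule cinner_ext_on[OF H])
        (simp_all add: B0(1) closed_csubspaceD(2)[OF H] cinner_add_left B0(2)[symmetric])
    show "B0 (c *\<^sub>C x) = c *\<^sub>C B0 x" for c
      by (rule cinner_ext_on[OF H])
        (simp_all add: B0(1) closed_csubspaceD(3)[OF H] cinner_scaleC_left B0(2)[symmetric])
    \<comment> \<open>Testing against \<open>B0 x\<close> itself gives the bound by
      \<open>L\<close>.\<close>
    have "complex_of_real ((norm (B0 x))\<^sup>2) = cinner x (X (B0 x))"
      by (simp add: B0 cinner_self)
    then have "(norm (B0 x))\<^sup>2 = cmod (cinner x (X (B0 x)))"
      by (metis norm_of_real abs_of_nonneg zero_le_power2)
    also have "\<dots> \<le> norm x * (L * norm (B0 x))"
      by (rule order_trans[OF Cauchy_Schwarz])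
        (simp add: mult_left_mono clinear_bounded_onD(3)[OF L(2)] B0(1))
    finally have "norm (B0 x) * norm (B0 x) \<le> (L * norm x) * norm (B0 x)"
      by (simp add: power2_eq_square mult_ac)
    then show "norm (B0 x) \<le> L * norm x"
      using L(1) by (cases "B0 x = 0") (simp_all add: mult_le_cancel_right)
  qed
  then have "clinear_bounded_on H L B"
    using H by (auto simp: clinear_bounded_on_def B_def closed_csubspaceD)
  then have B: "B \<in> bounded_ops H" by (auto simp: bounded_ops_iff B_def B0)
  have BX: "\<forall>x\<in>H. \<forall>y\<in>H. cinner (B x) y = cinner x (X y)" by (simp add: B_def B0)
  have "adjoint_op H X = B"
    unfolding adjoint_op_def
  proof (rule the_equality)
    fix B' assume B': "B' \<in> bounded_ops H \<and> (\<forall>x\<in>H. \<forall>y\<in>H. cinner (B' x) y = cinner x (X y))"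
    show "B' = B"
    proof
      fix x show "B' x = B x"
      proof (cases "x \<in> H")
        case True
        show ?thesis by (rule cinner_ext_on[OF H]) (use True B' B BX in \<open>auto simp: bounded_ops_iff\<close>)
      qed (use B' B in \<open>simp add: bounded_ops_iff\<close>)
    qed
  qed (use B BX in blast)
  then show ?thesis using B BX by simp
qed

lemma adjoint_op_UNIV:
  assumes "X \<in> bounded_ops UNIV"
  shows "adjoint_op UNIV X \<in> bounded_ops UNIV" "cinner (adjoint_op UNIV X x) y = cinner x (X y)"
  using adjoint_op_exists[of UNIV _ X] assms by (auto simp: bounded_ops_UNIV_iff)

lemma orthogonal_projectionD:
  assumes "orthogonal_projection P"
  shows "P (P x) = P x" "cinner (P x) y = cinner x (P y)" "clinear_bounded_on UNIV 1 P"
proof -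
  have P: "P \<in> bounded_ops UNIV" "P \<circ> P = P" "adjoint_op UNIV P = P"
    using assms by (auto simp: orthogonal_projection_def)
  show PP: "P (P x) = P x" for x using P(2) by (metis comp_apply)
  show sa: "cinner (P x) y = cinner x (P y)" for x y using adjoint_op_UNIV(2)[OF P(1), of x y] P(3) by simp
  have "norm (P x) \<le> norm x" for x
  proof -
    have "(norm (P x))\<^sup>2 = cmod (cinner (P x) x)"
    proof -
      have "cinner (P x) x = complex_of_real ((norm (P x))\<^sup>2)"
        by (metis PP sa cinner_self)
      then show ?thesis by (simp add: norm_power)
    qed
    also have "\<dots> \<le> norm (P x) * norm x" by (rule Cauchy_Schwarz)
    finally show ?thesis
      by (cases "P x = 0") (simp_all add: power2_eq_square)
  qed
  then show "clinear_bounded_on UNIV 1 P"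
    using P(1) by (auto simp: bounded_ops_UNIV_iff clinear_bounded_on_def)
qed


subsection \<open>Extension of bounded operators\<close>

text \<open>Padding with zero coefficients brings two combinations over different finite sets to one
  index set, as needed for adding elements of a span.\<close>

lemma sum_scaleC_Un:
  fixes v :: "'i \<Rightarrow> 'z::complex_hilbert"
  assumes "finite F" "finite G"
  shows "(\<Sum>i\<in>F \<union> G. ((if i \<in> F then a i else 0) + (if i \<in> G then b i else 0)) *\<^sub>C v i)
    = (\<Sum>i\<in>F. a i *\<^sub>C v i) + (\<Sum>i\<in>G. b i *\<^sub>C v i)"
proof -
  have "(\<Sum>i\<in>F \<union> G. (if i \<in> F then a i else 0) *\<^sub>C v i) = (\<Sum>i\<in>F. a i *\<^sub>C v i)"
    by (rule sum.mono_neutral_cong_right) (use assms in auto)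
  moreover have "(\<Sum>i\<in>F \<union> G. (if i \<in> G then b i else 0) *\<^sub>C v i) = (\<Sum>i\<in>G. b i *\<^sub>C v i)"
    by (rule sum.mono_neutral_cong_right) (use assms in auto)
  ultimately show ?thesis by (simp add: scaleC_add_left sum.distrib)
qed

text \<open>Applied to the difference of two representations of a vector, the bound shows that its
  prescribed value does not depend on the representation; the family \<open>e\<close> may be
  linearly dependent. The map obtained on the span is Lipschitz and extends to the closure.\<close>

lemma clinear_bounded_extension:
  fixes e :: "'i \<Rightarrow> 'a::complex_hilbert" and d :: "'i \<Rightarrow> 'b::complex_hilbert"
  assumes bound: "\<And>F c. finite F \<Longrightarrow> F \<subseteq> I \<Longrightarrow>
      norm (\<Sum>i\<in>F. c i *\<^sub>C d i) \<le> K * norm (\<Sum>i\<in>F. c i *\<^sub>C e i)"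
    and K: "0 \<le> K"
  obtains A where "clinear_bounded_on (closed_cspan (e ` I)) K A" "\<And>i. i \<in> I \<Longrightarrow> A (e i) = d i"
proof -
  \<comment> \<open>The graph of the operator on the span; its single-valuedness is derived before a
    function is chosen from it.\<close>
  define R where "R x y \<longleftrightarrow> (\<exists>F c. finite F \<and> F \<subseteq> I \<and> x = (\<Sum>i\<in>F. c i *\<^sub>C e i)
    \<and> y = (\<Sum>i\<in>F. c i *\<^sub>C d i))" for x y
  have R_gen: "R (e i) (d i)" if "i \<in> I" for i
    unfolding R_def by (rule exI[of _ "{i}"], rule exI[of _ "\<lambda>_. 1"]) (use that in simp)
  have R_bound: "norm y \<le> K * norm x" if "R x y" for x y
    using that bound unfolding R_def by blast
  have R_scale: "R (c *\<^sub>C x) (c *\<^sub>C y)" if xy: "R x y" for c x y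
  proof -
    obtain F a where F: "finite F" "F \<subseteq> I" "x = (\<Sum>i\<in>F. a i *\<^sub>C e i)" "y = (\<Sum>i\<in>F. a i *\<^sub>C d i)"
      using xy unfolding R_def by blast
    then show ?thesis
      unfolding R_def
      by (intro exI[of _ F] exI[of _ "\<lambda>i. c * a i"])
        (simp add: complex_vector.scale_sum_right scaleC_scaleC)
  qed
  have R_add: "R (x + x') (y + y')" if xy: "R x y" and xy': "R x' y'" for x x' y y'
  proof -
    obtain F a where F: "finite F" "F \<subseteq> I" "x = (\<Sum>i\<in>F. a i *\<^sub>C e i)" "y = (\<Sum>i\<in>F. a i *\<^sub>C d i)"
      using xy unfolding R_def by blast
    obtain G b where G: "finite G" "G \<subseteq> I" "x' = (\<Sum>i\<in>G. b i *\<^sub>C e i)" "y' = (\<Sum>i\<in>G. b i *\<^sub>C d i)"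
      using xy' unfolding R_def by blast
    show ?thesis
      unfolding R_def
      by (rule exI[of _ "F \<union> G"],
          rule exI[of _ "\<lambda>i. (if i \<in> F then a i else 0) + (if i \<in> G then b i else 0)"])
        (use F G in \<open>auto simp: sum_scaleC_Un\<close>)
  qed
  have R_diff: "R (x - x') (y - y')" if "R x y" "R x' y'" for x x' y y'
    using R_add[OF that(1) R_scale[OF that(2), of "-1"]] by simp
  have R_total: "\<exists>y. R x y" if "x \<in> cspan (e ` I)" for x
    using that
  proof (induction rule: complex_vector.span_induct_alt)
    case base
    have "R 0 0" unfolding R_def by (intro exI[of _ "{}"]) simp
    then show ?case by blast
  next
    case (step c x y)
    then show ?case using R_add R_scale R_gen by blast
  qed
  have R_unique: "y = y'" if "R x y" "R x y'" for x y y'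
    using R_bound[OF R_diff[OF that]] by simp
  define A0 where "A0 x = (SOME y. R x y)" for x
  have A0: "R x (A0 x)" if "x \<in> cspan (e ` I)" for x
    unfolding A0_def using R_total[OF that] by (rule someI_ex)
  have "uniformly_continuous_on (cspan (e ` I)) A0"
  proof (rule lipschitz_on_uniformly_continuous[of K], rule lipschitz_onI[OF _ K])
    fix x y assume "x \<in> cspan (e ` I)" "y \<in> cspan (e ` I)"
    then show "dist (A0 x) (A0 y) \<le> K * dist x y"
      unfolding dist_norm by (intro R_bound R_diff A0)
  qed
  then obtain A where A: "uniformly_continuous_on (closure (cspan (e ` I))) A"
      "\<And>x. x \<in> cspan (e ` I) \<Longrightarrow> A0 x = A x"
    using uniformly_continuous_on_extension_on_closure by metis
  have cont: "(\<lambda>n. A (s n)) \<longlonglongrightarrow> A x" if "\<And>n. s n \<in> cspan (e ` I)" "s \<longlonglongrightarrow> x" for s x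
  proof (rule continuous_on_tendsto_compose[OF uniformly_continuous_imp_continuous[OF A(1)] that(2)])
    show "x \<in> closure (cspan (e ` I))" unfolding closure_sequential using that by blast
    show "\<forall>\<^sub>F n in sequentially. s n \<in> closure (cspan (e ` I))"
      using that(1) closure_subset by (intro always_eventually) blast
  qed
  have RA: "R x (A x)" if "x \<in> cspan (e ` I)" for x using A0[OF that] A(2)[OF that] by simp
  note span = complex_vector.span_add complex_vector.span_scale
  have "clinear_bounded_on (closed_cspan (e ` I)) K A"
    unfolding clinear_bounded_on_def closed_cspan_def
  proof (intro conjI ballI allI)
    fix x assume "x \<in> closure (cspan (e ` I))"
    then obtain s where s: "\<And>n::nat. s n \<in> cspan (e ` I)" "s \<longlonglongrightarrow> x"
      unfolding closure_sequential by blast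
    show "norm (A x) \<le> K * norm x"
    proof (rule LIMSEQ_le)
      show "(\<lambda>n. norm (A (s n))) \<longlonglongrightarrow> norm (A x)" by (intro tendsto_intros cont s)
      show "(\<lambda>n. K * norm (s n)) \<longlonglongrightarrow> K * norm x" by (intro tendsto_intros s)
      show "\<exists>N. \<forall>n\<ge>N. norm (A (s n)) \<le> K * norm (s n)" using R_bound[OF RA[OF s(1)]] by blast
    qed
    show "A (c *\<^sub>C x) = c *\<^sub>C A x" for c
    proof (rule LIMSEQ_unique)
      show "(\<lambda>n. A (c *\<^sub>C s n)) \<longlonglongrightarrow> A (c *\<^sub>C x)"
        by (rule cont[OF complex_vector.span_scale[OF s(1)] tendsto_scaleC[OF s(2)]])
      have "A (c *\<^sub>C s n) = c *\<^sub>C A (s n)" for n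
        by (rule R_unique[OF RA[OF complex_vector.span_scale[OF s(1)]] R_scale[OF RA[OF s(1)]]])
      then show "(\<lambda>n. A (c *\<^sub>C s n)) \<longlonglongrightarrow> c *\<^sub>C A x"
        using tendsto_scaleC[OF cont[OF s], of c] by simp
    qed
    fix y assume "y \<in> closure (cspan (e ` I))"
    then obtain u where u: "\<And>n::nat. u n \<in> cspan (e ` I)" "u \<longlonglongrightarrow> y"
      unfolding closure_sequential by blast
    show "A (x + y) = A x + A y"
    proof (rule LIMSEQ_unique)
      show "(\<lambda>n. A (s n + u n)) \<longlonglongrightarrow> A (x + y)"
        by (rule cont[OF complex_vector.span_add[OF s(1) u(1)] tendsto_add[OF s(2) u(2)]])
      have "A (s n + u n) = A (s n) + A (u n)" for n
        by (rule R_unique[OF RA[OF complex_vector.span_add[OF s(1) u(1)]]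
              R_add[OF RA[OF s(1)] RA[OF u(1)]]])
      then show "(\<lambda>n. A (s n + u n)) \<longlonglongrightarrow> A x + A y"
        using tendsto_add[OF cont[OF s] cont[OF u]] by simp
    qed
  qed
  moreover have "A (e i) = d i" if "i \<in> I" for i
    by (rule R_unique[OF RA R_gen[OF that]]) (use that in \<open>simp add: complex_vector.span_base\<close>)
  ultimately show ?thesis by (rule that)
qed

text \<open>By the Gram formula the two norms differ exactly by the factor \<open>K\<close>. The
  case \<open>K = 1\<close> produces isometries such as \<open>Gamma\<close>, other values the
  partial maps of a tensor product.\<close>

lemma clinear_extension_gram:
  fixes e :: "'i \<Rightarrow> 'a::complex_hilbert" and d :: "'i \<Rightarrow> 'b::complex_hilbert"
  assumes gram: "\<And>i j. i \<in> I \<Longrightarrow> j \<in> I \<Longrightarrow>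
      cinner (d i) (d j) = complex_of_real (K\<^sup>2) * cinner (e i) (e j)"
    and K: "0 \<le> K"
  obtains A where "clinear_bounded_on (closed_cspan (e ` I)) K A" "\<And>i. i \<in> I \<Longrightarrow> A (e i) = d i"
proof (rule clinear_bounded_extension[OF _ K, of I d e])
  fix F :: "'i set" and c :: "'i \<Rightarrow> complex" assume F: "finite F" "F \<subseteq> I"
  have "complex_of_real ((norm (\<Sum>i\<in>F. c i *\<^sub>C d i))\<^sup>2)
      = complex_of_real (K\<^sup>2) * complex_of_real ((norm (\<Sum>i\<in>F. c i *\<^sub>C e i))\<^sup>2)"
    unfolding norm_sum_scaleC_square sum_distrib_left
    by (intro sum.cong refl) (use gram F in \<open>auto simp: subset_iff\<close>)
  then have "complex_of_real ((norm (\<Sum>i\<in>F. c i *\<^sub>C d i))\<^sup>2)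
      = complex_of_real ((K * norm (\<Sum>i\<in>F. c i *\<^sub>C e i))\<^sup>2)"
    by (simp add: power_mult_distrib)
  then have "(norm (\<Sum>i\<in>F. c i *\<^sub>C d i))\<^sup>2 = (K * norm (\<Sum>i\<in>F. c i *\<^sub>C e i))\<^sup>2"
    unfolding of_real_eq_iff .
  then show "norm (\<Sum>i\<in>F. c i *\<^sub>C d i) \<le> K * norm (\<Sum>i\<in>F. c i *\<^sub>C e i)"
    using K by (simp add: power2_eq_iff_nonneg)
qed (rule that)

subsection \<open>Tensor products\<close>

text \<open>Supplies coordinates for the Schur product argument. The vectors may be dependent, hence
  the free length \<open>m\<close> of the orthonormal system.\<close>

lemma Gram_Schmidt:
  fixes b :: "'i \<Rightarrow> 'b::complex_hilbert"
  assumes "finite F"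
  shows "\<exists>(m::nat) e \<beta>. (\<forall>k<m. \<forall>l<m. cinner (e k) (e l) = (if k = l then 1 else 0))
    \<and> (\<forall>i\<in>F. b i = (\<Sum>k<m. \<beta> i k *\<^sub>C e k))"
  using assms
proof (induction F rule: finite_induct)
  case empty
  show ?case by (rule exI[of _ 0]) simp
next
  case (insert i F)
  then obtain m :: nat and e \<beta> where e: "\<forall>k<m. \<forall>l<m. cinner (e k) (e l) = (if k = l then 1 else 0)"
    and \<beta>: "\<forall>i\<in>F. b i = (\<Sum>k<m. \<beta> i k *\<^sub>C e k)" by blast
  define r where "r = b i - (\<Sum>k<m. cinner (e k) (b i) *\<^sub>C e k)"
  have r: "cinner (e l) r = 0" if "l < m" for l
  proof -
    have "(\<Sum>k<m. cinner (e k) (b i) * cinner (e l) (e k)) = (\<Sum>k<m. if k = l then cinner (e l) (b i) else 0)"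
      by (rule sum.cong) (use e that in auto)
    then show ?thesis using that
      by (simp add: r_def cinner_diff_right cinner_sum_right cinner_scaleC_right)
  qed
  have r': "cinner r (e l) = 0" if "l < m" for l
    using r[OF that] by (metis cinner_commute complex_cnj_zero)
  \<comment> \<open>The normalised residual becomes the new basis vector, used only when
    \<open>r\<close> is nonzero.\<close>
  define e' where "e' k = (if k < m then e k else complex_of_real (inverse (norm r)) *\<^sub>C r)" for k
  define \<beta>' where "\<beta>' j k = (if j = i then if k < m then cinner (e k) (b i) else complex_of_real (norm r)
     else if k < m then \<beta> j k else 0)" for j k
  show ?case
  proof (cases "r = 0")
    case False
    have "b i = (\<Sum>k<m. cinner (e k) (b i) *\<^sub>C e k) + r" by (simp add: r_def)
    then have b: "b j = (\<Sum>k<Suc m. \<beta>' j k *\<^sub>C e' k)" if "j \<in> insert i F" for j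
      using that \<beta> insert.hyps False
      by (cases "j = i") (auto simp: \<beta>'_def e'_def scaleC_scaleC)
    have "complex_of_real (norm r) * complex_of_real (norm r) = cinner r r"
      by (simp add: cinner_self power2_eq_square)
    then have "cinner (e' k) (e' l) = (if k = l then 1 else 0)" if "k < Suc m" "l < Suc m" for k l
      using that e r r' False
      by (auto simp: e'_def less_Suc_eq cinner_scaleC_left cinner_scaleC_right cinner_eq_zero_iff
          field_simps)
    then show ?thesis using b by (intro exI[of _ "Suc m"] exI[of _ e'] exI[of _ \<beta>']) blast
  next
    case True
    then have "b i = (\<Sum>k<m. cinner (e k) (b i) *\<^sub>C e k)" by (simp add: r_def)
    then show ?thesis
      using e \<beta> insert.hyps by (intro exI[of _ m] exI[of _ e] exI[of _ "\<beta>(i := \<lambda>k. cinner (e k) (b i))"]) auto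
  qed
qed

text \<open>Schur product theorem. In orthonormal coordinates the Gram matrix of \<open>b\<close> is
  the sum over \<open>k\<close> of the matrices \<open>cnj (\<beta> i k) * \<beta> j k\<close>, and
  each of these contributes the quadratic form of \<open>H\<close> at the coefficients
  \<open>\<beta> i k\<close>.\<close>

lemma Schur_product_nonneg:
  fixes b :: "'i \<Rightarrow> 'b::complex_hilbert"
  assumes F: "finite F"
    and H: "\<And>c. 0 \<le> Re (\<Sum>i\<in>F. \<Sum>j\<in>F. cnj (c i) * c j * H i j)"
  shows "0 \<le> Re (\<Sum>i\<in>F. \<Sum>j\<in>F. H i j * cinner (b i) (b j))"
proof -
  obtain m :: nat and e \<beta> where e: "\<forall>k<m. \<forall>l<m. cinner (e k) (e l) = (if k = l then 1 else 0)"
    and \<beta>: "\<forall>i\<in>F. b i = (\<Sum>k<m. \<beta> i k *\<^sub>C e k)" using Gram_Schmidt[OF F, of b] by blast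
  have "cinner (b i) (b j) = (\<Sum>k<m. cnj (\<beta> i k) * \<beta> j k)" if "i \<in> F" "j \<in> F" for i j
  proof -
    have "cinner (b i) (b j) = (\<Sum>k<m. \<Sum>l<m. cnj (\<beta> i k) * \<beta> j l * cinner (e k) (e l))"
      using \<beta> that by (simp add: cinner_sum_left cinner_sum_right cinner_scaleC_left
          cinner_scaleC_right sum_distrib_left mult.assoc) (subst sum.swap, simp add: mult_ac)
    also have "\<dots> = (\<Sum>k<m. \<Sum>l<m. if l = k then cnj (\<beta> i k) * \<beta> j k else 0)"
      by (intro sum.cong refl) (use e in auto)
    finally show ?thesis by simp
  qed
  then have "(\<Sum>i\<in>F. \<Sum>j\<in>F. H i j * cinner (b i) (b j))
      = (\<Sum>i\<in>F. \<Sum>j\<in>F. \<Sum>k<m. cnj (\<beta> i k) * \<beta> j k * H i j)"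
    by (intro sum.cong refl) (simp add: sum_distrib_left mult_ac)
  also have "\<dots> = (\<Sum>i\<in>F. \<Sum>k<m. \<Sum>j\<in>F. cnj (\<beta> i k) * \<beta> j k * H i j)"
    by (intro sum.cong refl) (rule sum.swap)
  also have "\<dots> = (\<Sum>k<m. \<Sum>i\<in>F. \<Sum>j\<in>F. cnj (\<beta> i k) * \<beta> j k * H i j)"
    by (rule sum.swap)
  finally show ?thesis using H by (simp add: sum_nonneg)
qed

text \<open>The hypothesis says that \<open>K\<^sup>2\<close> times the Gram matrix of
  \<open>v\<close> minus that of \<open>u\<close> is positive semidefinite; the entrywise product
  with the Gram matrix of \<open>b\<close> stays so. This bounds operators on one tensor factor
  without bases of infinite-dimensional spaces.\<close>

lemma Gram_product_le:
  fixes u :: "'i \<Rightarrow> 'a::complex_hilbert" and v :: "'i \<Rightarrow> 'c::complex_hilbert"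
    and b :: "'i \<Rightarrow> 'b::complex_hilbert"
  assumes F: "finite F"
    and uv: "\<And>c. norm (\<Sum>i\<in>F. c i *\<^sub>C u i) \<le> K * norm (\<Sum>i\<in>F. c i *\<^sub>C v i)"
  shows "Re (\<Sum>i\<in>F. \<Sum>j\<in>F. cinner (u i) (u j) * cinner (b i) (b j))
    \<le> K\<^sup>2 * Re (\<Sum>i\<in>F. \<Sum>j\<in>F. cinner (v i) (v j) * cinner (b i) (b j))"
proof -
  define H where "H i j = complex_of_real (K\<^sup>2) * cinner (v i) (v j) - cinner (u i) (u j)" for i j
  have "0 \<le> Re (\<Sum>i\<in>F. \<Sum>j\<in>F. cnj (c i) * c j * H i j)" for c
  proof -
    have "(\<Sum>i\<in>F. \<Sum>j\<in>F. cnj (c i) * c j * H i j)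
      = complex_of_real (K\<^sup>2) * complex_of_real ((norm (\<Sum>i\<in>F. c i *\<^sub>C v i))\<^sup>2)
        - complex_of_real ((norm (\<Sum>i\<in>F. c i *\<^sub>C u i))\<^sup>2)"
      unfolding norm_sum_scaleC_square H_def sum_distrib_left
      by (simp add: sum_subtractf right_diff_distrib mult_ac)
    then have "Re (\<Sum>i\<in>F. \<Sum>j\<in>F. cnj (c i) * c j * H i j)
      = (K * norm (\<Sum>i\<in>F. c i *\<^sub>C v i))\<^sup>2 - (norm (\<Sum>i\<in>F. c i *\<^sub>C u i))\<^sup>2"
      by (simp add: power_mult_distrib flip: of_real_mult of_real_power)
    then show ?thesis using power_mono[OF uv[of c], of 2] by simp
  qed
  then have "0 \<le> Re (\<Sum>i\<in>F. \<Sum>j\<in>F. H i j * cinner (b i) (b j))"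
    by (rule Schur_product_nonneg[OF F])
  also have "(\<Sum>i\<in>F. \<Sum>j\<in>F. H i j * cinner (b i) (b j))
    = complex_of_real (K\<^sup>2) * (\<Sum>i\<in>F. \<Sum>j\<in>F. cinner (v i) (v j) * cinner (b i) (b j))
      - (\<Sum>i\<in>F. \<Sum>j\<in>F. cinner (u i) (u j) * cinner (b i) (b j))"
    by (simp add: H_def left_diff_distrib sum_subtractf sum_distrib_left mult.assoc)
  finally show ?thesis by (simp flip: of_real_power)
qed

section \<open>Elementary properties of Hilbert tensor products, and operators on them\<close>

lemma hilbert_tensorD:
  assumes "hilbert_tensor A B C T"
  shows "a \<in> A \<Longrightarrow> b \<in> B \<Longrightarrow> a' \<in> A \<Longrightarrow> b' \<in> B \<Longrightarrow>
      cinner (T a b) (T a' b') = cinner a a' * cinner b b'"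
    "C = closed_cspan {T a b | a b. a \<in> A \<and> b \<in> B}"
  using assms by (auto simp: hilbert_tensor_def)

lemma hilbert_tensor_closed:
  assumes "hilbert_tensor A B C T"
  shows "closed_csubspace C"
  unfolding hilbert_tensorD(2)[OF assms] by simp

lemma hilbert_tensor_in:
  assumes "hilbert_tensor A B C T" "a \<in> A" "b \<in> B"
  shows "T a b \<in> C"
  unfolding hilbert_tensorD(2)[OF assms(1)] by (rule closed_cspan_superset) (use assms in blast)

lemma hilbert_tensor_norm:
  assumes "hilbert_tensor A B C T" "a \<in> A" "b \<in> B"
  shows "norm (T a b) = norm a * norm b"
proof -
  have "complex_of_real ((norm (T a b))\<^sup>2) = complex_of_real ((norm a * norm b)\<^sup>2)"
    unfolding cinner_self[symmetric] hilbert_tensorD(1)[OF assms assms(2,3)]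
    by (simp add: cinner_self power_mult_distrib)
  then show ?thesis unfolding of_real_eq_iff by (rule power2_eq_imp_eq) simp_all
qed

text \<open>Linearity in each variable is forced by the inner products: the defect has inner product
  zero with itself.\<close>

lemma clinear_bounded_on_hilbert_tensor:
  assumes T: "hilbert_tensor A B C T" and A: "closed_csubspace A" and B: "closed_csubspace B"
  shows "a \<in> A \<Longrightarrow> clinear_bounded_on B (norm a) (T a)"
    "b \<in> B \<Longrightarrow> clinear_bounded_on A (norm b) (\<lambda>a. T a b)"
proof -
  have zero: "x = 0" if "cinner x x = 0" for x :: 'c using that by (simp add: cinner_eq_zero_iff)
  note in_sp = closed_csubspaceD(2,3)[OF A] closed_csubspaceD(2,3)[OF B]
  note expand = cinner_diff_left cinner_diff_right cinner_scaleC_left cinner_scaleC_right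
    cinner_add_left cinner_add_right hilbert_tensorD(1)[OF T] in_sp
  have 1: "T a (b + b') = T a b + T a b'" if "a \<in> A" "b \<in> B" "b' \<in> B" for a b b'
    using zero[of "T a (b + b') - (T a b + T a b')"] that by (simp add: expand algebra_simps)
  have 2: "T a (c *\<^sub>C b) = c *\<^sub>C T a b" if "a \<in> A" "b \<in> B" for a b c
    using zero[of "T a (c *\<^sub>C b) - c *\<^sub>C T a b"] that by (simp add: expand algebra_simps)
  have 3: "T (a + a') b = T a b + T a' b" if "a \<in> A" "b \<in> B" "a' \<in> A" for a b a'
    using zero[of "T (a + a') b - (T a b + T a' b)"] that by (simp add: expand algebra_simps)
  have 4: "T (c *\<^sub>C a) b = c *\<^sub>C T a b" if "a \<in> A" "b \<in> B" for a b c
    using zero[of "T (c *\<^sub>C a) b - c *\<^sub>C T a b"] that by (simp add: expand algebra_simps)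
  show "a \<in> A \<Longrightarrow> clinear_bounded_on B (norm a) (T a)"
    using 1 2 hilbert_tensor_norm[OF T] by (simp add: clinear_bounded_on_def)
  show "b \<in> B \<Longrightarrow> clinear_bounded_on A (norm b) (\<lambda>a. T a b)"
    using 3 4 hilbert_tensor_norm[OF T] by (simp add: clinear_bounded_on_def mult.commute)
qed

text \<open>Extended one factor at a time. It lets generators such as exponential vectors stand in
  for whole factors.\<close>

lemma hilbert_tensor_total:
  assumes T: "hilbert_tensor (closed_cspan X) (closed_cspan Y) C T"
  shows "C = closed_cspan {T x y | x y. x \<in> X \<and> y \<in> Y}" (is "C = ?D")
proof
  have D: "closed_csubspace ?D" by simp
  note lin = clinear_bounded_on_hilbert_tensor[OF T closed_csubspace_closed_cspan closed_csubspace_closed_cspan]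
  have 1: "T x y \<in> ?D" if "x \<in> closed_cspan X" "y \<in> Y" for x y
    by (rule clinear_bounded_on_range[OF lin(2)[OF closed_cspan_superset[OF that(2)]] D _ that(1)])
      (use that in \<open>auto intro!: closed_cspan_superset\<close>)
  have 2: "T x y \<in> ?D" if "x \<in> closed_cspan X" "y \<in> closed_cspan Y" for x y
    by (rule clinear_bounded_on_range[OF lin(1)[OF that(1)] D _ that(2)]) (rule 1[OF that(1)])
  show "C \<subseteq> ?D"
    unfolding hilbert_tensorD(2)[OF T] by (rule closed_cspan_minimal) (use 2 in auto)
  show "?D \<subseteq> C"
    by (rule closed_cspan_minimal[OF _ hilbert_tensor_closed[OF T]])
      (auto intro!: hilbert_tensor_in[OF T] closed_cspan_superset)
qed

lemma clinear_bounded_on_lincomb: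
  assumes W: "clinear_bounded_on D M W" and D: "closed_csubspace D" and h: "\<And>p. p \<in> F \<Longrightarrow> h p \<in> D"
  shows "norm (\<Sum>p\<in>F. d p *\<^sub>C W (h p)) \<le> M * norm (\<Sum>p\<in>F. d p *\<^sub>C h p)"
proof -
  have sum_arg: "W (\<Sum>p\<in>F. d p *\<^sub>C h p) = (\<Sum>p\<in>F. W (d p *\<^sub>C h p)) \<and> (\<Sum>p\<in>F. d p *\<^sub>C h p) \<in> D"
    by (rule clinear_bounded_on_sum_arg[OF W D closed_csubspaceD(3)[OF D h]])
  have "(\<Sum>p\<in>F. d p *\<^sub>C W (h p)) = (\<Sum>p\<in>F. W (d p *\<^sub>C h p))"
    by (rule sum.cong) (use h in \<open>auto simp: clinear_bounded_onD(2)[OF W]\<close>)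
  also have "\<dots> = W (\<Sum>p\<in>F. d p *\<^sub>C h p)" using sum_arg by simp
  finally show ?thesis using clinear_bounded_onD(3)[OF W conjunct2[OF sum_arg]] by (simp only:)
qed

text \<open>The factors are removed one after the other, \<open>X\<close> with \<open>Y\<close> in
  place and then \<open>Y\<close>, each by the Schur estimate; this gives the constant
  \<open>K * L\<close>. Totality of elementary tensors gives the uniqueness behind the definite
  description.\<close>

lemma op_tensor_exists:
  assumes T: "hilbert_tensor A B C T" and A: "closed_csubspace A" and B: "closed_csubspace B"
    and X: "clinear_bounded_on A K X" "\<And>a. a \<in> A \<Longrightarrow> X a \<in> A" "0 \<le> K"
    and Y: "clinear_bounded_on B L Y" "\<And>b. b \<in> B \<Longrightarrow> Y b \<in> B" "0 \<le> L"
  shows "op_tensor T A B C X Y \<in> bounded_ops C \<and> clinear_bounded_on C (K * L) (op_tensor T A B C X Y)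
    \<and> (\<forall>a\<in>A. \<forall>b\<in>B. op_tensor T A B C X Y (T a b) = T (X a) (Y b))"
proof -
  note lin = clinear_bounded_on_hilbert_tensor[OF T A B]
  have C: "closed_cspan (case_prod T ` (A \<times> B)) = C"
    unfolding hilbert_tensorD(2)[OF T] by (rule arg_cong[of _ _ closed_cspan]) auto
  obtain Z0 where Z0: "clinear_bounded_on (closed_cspan (case_prod T ` (A \<times> B))) (K * L) Z0"
      "\<And>p. p \<in> A \<times> B \<Longrightarrow> Z0 (case_prod T p) = (\<lambda>(a, b). T (X a) (Y b)) p"
  proof (rule clinear_bounded_extension[of "A \<times> B" "\<lambda>(a, b). T (X a) (Y b)" "K * L" "case_prod T"])
    fix F :: "('a \<times> 'b) set" and c assume F: "finite F" "F \<subseteq> A \<times> B"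
    have in_AB: "fst p \<in> A" "snd p \<in> B" if "p \<in> F" for p using F(2) that by auto
    \<comment> \<open>The coefficients can be absorbed into either factor, which leaves the other
      one as a pure Gram matrix.\<close>
    have square: "(norm (\<Sum>p\<in>F. c p *\<^sub>C T (f (fst p)) (g (snd p))))\<^sup>2
        = Re (\<Sum>p\<in>F. \<Sum>q\<in>F. cinner (f (fst p)) (f (fst q)) *
            cinner (c p *\<^sub>C g (snd p)) (c q *\<^sub>C g (snd q)))"
      "(norm (\<Sum>p\<in>F. c p *\<^sub>C T (f (fst p)) (g (snd p))))\<^sup>2
        = Re (\<Sum>p\<in>F. \<Sum>q\<in>F. cinner (g (snd p)) (g (snd q)) *
            cinner (c p *\<^sub>C f (fst p)) (c q *\<^sub>C f (fst q)))"
      if "\<forall>a\<in>A. f a \<in> A" "\<forall>b\<in>B. g b \<in> B" for f g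
    proof -
      have "complex_of_real ((norm (\<Sum>p\<in>F. c p *\<^sub>C T (f (fst p)) (g (snd p))))\<^sup>2)
        = (\<Sum>p\<in>F. \<Sum>q\<in>F. cinner (f (fst p)) (f (fst q)) *
            cinner (c p *\<^sub>C g (snd p)) (c q *\<^sub>C g (snd q)))"
        "complex_of_real ((norm (\<Sum>p\<in>F. c p *\<^sub>C T (f (fst p)) (g (snd p))))\<^sup>2)
        = (\<Sum>p\<in>F. \<Sum>q\<in>F. cinner (g (snd p)) (g (snd q)) *
            cinner (c p *\<^sub>C f (fst p)) (c q *\<^sub>C f (fst q)))"
        unfolding norm_sum_scaleC_square
        by (intro sum.cong refl; simp add: hilbert_tensorD(1)[OF T] that in_AB
            cinner_scaleC_left cinner_scaleC_right)+
      then show "(norm (\<Sum>p\<in>F. c p *\<^sub>C T (f (fst p)) (g (snd p))))\<^sup>2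
        = Re (\<Sum>p\<in>F. \<Sum>q\<in>F. cinner (f (fst p)) (f (fst q)) *
            cinner (c p *\<^sub>C g (snd p)) (c q *\<^sub>C g (snd q)))"
      "(norm (\<Sum>p\<in>F. c p *\<^sub>C T (f (fst p)) (g (snd p))))\<^sup>2
        = Re (\<Sum>p\<in>F. \<Sum>q\<in>F. cinner (g (snd p)) (g (snd q)) *
            cinner (c p *\<^sub>C f (fst p)) (c q *\<^sub>C f (fst q)))"
        by (metis Re_complex_of_real)+
    qed
    have X_le: "Re (\<Sum>p\<in>F. \<Sum>q\<in>F. cinner (X (fst p)) (X (fst q)) *
            cinner (c p *\<^sub>C Y (snd p)) (c q *\<^sub>C Y (snd q)))
        \<le> K\<^sup>2 * Re (\<Sum>p\<in>F. \<Sum>q\<in>F. cinner (fst p) (fst q) *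
            cinner (c p *\<^sub>C Y (snd p)) (c q *\<^sub>C Y (snd q)))"
      by (rule Gram_product_le[OF F(1)]) (rule clinear_bounded_on_lincomb[OF X(1) A in_AB(1)])
    have Y_le: "Re (\<Sum>p\<in>F. \<Sum>q\<in>F. cinner (Y (snd p)) (Y (snd q)) *
            cinner (c p *\<^sub>C fst p) (c q *\<^sub>C fst q))
        \<le> L\<^sup>2 * Re (\<Sum>p\<in>F. \<Sum>q\<in>F. cinner (snd p) (snd q) *
            cinner (c p *\<^sub>C fst p) (c q *\<^sub>C fst q))"
      by (rule Gram_product_le[OF F(1)]) (rule clinear_bounded_on_lincomb[OF Y(1) B in_AB(2)])
    have "(norm (\<Sum>p\<in>F. c p *\<^sub>C T (X (fst p)) (Y (snd p))))\<^sup>2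
        \<le> K\<^sup>2 * (norm (\<Sum>p\<in>F. c p *\<^sub>C T (fst p) (Y (snd p))))\<^sup>2"
      using X_le square(1)[of X Y] square(1)[of "\<lambda>a. a" Y] X(2) Y(2) by simp
    also have "\<dots> \<le> K\<^sup>2 * (L\<^sup>2 * (norm (\<Sum>p\<in>F. c p *\<^sub>C T (fst p) (snd p)))\<^sup>2)"
      using Y_le square(2)[of "\<lambda>a. a" Y] square(2)[of "\<lambda>a. a" "\<lambda>b. b"] Y(2)
      by (intro mult_left_mono) simp_all
    finally have "(norm (\<Sum>p\<in>F. c p *\<^sub>C T (X (fst p)) (Y (snd p))))\<^sup>2
        \<le> (K * L * norm (\<Sum>p\<in>F. c p *\<^sub>C T (fst p) (snd p)))\<^sup>2"
      by (simp add: power_mult_distrib)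
    then show "norm (\<Sum>p\<in>F. c p *\<^sub>C (\<lambda>(a, b). T (X a) (Y b)) p)
        \<le> K * L * norm (\<Sum>p\<in>F. c p *\<^sub>C case_prod T p)"
      unfolding case_prod_unfold by (rule power2_le_imp_le) (use X(3) Y(3) in simp)
  qed (use X(3) Y(3) in auto)
  define Z where "Z x = (if x \<in> C then Z0 x else 0)" for x
  have Z: "clinear_bounded_on C (K * L) Z"
    using Z0(1) closed_csubspaceD[OF hilbert_tensor_closed[OF T]]
    unfolding C by (auto simp: clinear_bounded_on_def Z_def)
  have ZT: "\<forall>a\<in>A. \<forall>b\<in>B. Z (T a b) = T (X a) (Y b)"
    using Z0(2) hilbert_tensor_in[OF T] by (auto simp: Z_def)
  note C_eq = hilbert_tensorD(2)[OF T]
  have ZC: "Z x \<in> C" if x: "x \<in> C" for x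
    by (rule clinear_bounded_on_range[OF Z[unfolded C_eq] hilbert_tensor_closed[OF T] _ x[unfolded C_eq]])
      (auto simp: ZT X Y intro!: hilbert_tensor_in[OF T])
  have Zb: "Z \<in> bounded_ops C" using Z ZC by (auto simp: bounded_ops_iff Z_def)
  have "op_tensor T A B C X Y = Z"
    unfolding op_tensor_def
  proof (rule the_equality)
    fix Z' assume Z': "Z' \<in> bounded_ops C \<and> (\<forall>a\<in>A. \<forall>b\<in>B. Z' (T a b) = T (X a) (Y b))"
    then obtain M where M: "clinear_bounded_on C M Z'" by (auto simp: bounded_ops_iff)
    show "Z' = Z"
    proof
      fix x show "Z' x = Z x"
      proof (cases "x \<in> C")
        case True
        show ?thesis
          by (rule clinear_bounded_on_eqI[of "{T a b |a b. a \<in> A \<and> b \<in> B}" M Z' "K * L" Z])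
            (use M Z True Z' ZT in \<open>auto simp: hilbert_tensorD(2)[OF T, symmetric]\<close>)
      qed (use Z' Zb in \<open>simp add: bounded_ops_iff\<close>)
    qed
  qed (use Zb ZT in blast)
  then show ?thesis using Z Zb ZT by simp
qed

text \<open>For fixed \<open>j\<close> the Gram identity permits extension in the first variable to
  \<open>U j\<close>; for fixed \<open>a\<close> it then permits extension of \<open>U j a\<close>
  in the second. All factorisations of Fock space below arise this way, with vectors
  \<open>d i j\<close> already present in the target.\<close>

lemma hilbert_tensor_exists:
  fixes e :: "'i \<Rightarrow> 'a::complex_hilbert" and g :: "'j \<Rightarrow> 'b::complex_hilbert"
    and d :: "'i \<Rightarrow> 'j \<Rightarrow> 'c::complex_hilbert"
  assumes gram: "\<And>i j i' j'. i \<in> I \<Longrightarrow> j \<in> J \<Longrightarrow> i' \<in> I \<Longrightarrow> j' \<in> J \<Longrightarrow>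
    cinner (d i j) (d i' j') = cinner (e i) (e i') * cinner (g j) (g j')"
  shows "\<exists>T. hilbert_tensor (closed_cspan (e ` I)) (closed_cspan (g ` J))
      (closed_cspan {d i j | i j. i \<in> I \<and> j \<in> J}) T \<and> (\<forall>i\<in>I. \<forall>j\<in>J. T (e i) (g j) = d i j)"
proof -
  let ?A = "closed_cspan (e ` I)" and ?B = "closed_cspan (g ` J)"
  let ?D = "closed_cspan {d i j | i j. i \<in> I \<and> j \<in> J}"
  have "\<exists>U. clinear_bounded_on ?A (norm (g j)) U \<and> (\<forall>i\<in>I. U (e i) = d i j)" if j: "j \<in> J" for j
  proof -
    have "cinner (d i j) (d i' j) = complex_of_real ((norm (g j))\<^sup>2) * cinner (e i) (e i')"
      if "i \<in> I" "i' \<in> I" for i i' using gram that j by (simp add: cinner_self)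
    with clinear_extension_gram[of I "\<lambda>i. d i j" "norm (g j)" e] show ?thesis
      by (metis norm_ge_zero)
  qed
  then obtain U where U: "\<And>j. j \<in> J \<Longrightarrow> clinear_bounded_on ?A (norm (g j)) (U j)"
      "\<And>i j. i \<in> I \<Longrightarrow> j \<in> J \<Longrightarrow> U j (e i) = d i j" by metis
  \<comment> \<open>The Gram identity with the first variable in the closed span, as the second
    extension requires.\<close>
  have UU: "cinner (U j a) (U j' a') = cinner a a' * cinner (g j) (g j')"
    if j: "j \<in> J" "j' \<in> J" and a: "a \<in> ?A" "a' \<in> ?A" for j j' a a'
  proof -
    have "cinner (U j a) (U j' a') = cinner a (cinner (g j) (g j') *\<^sub>C a')"
      by (rule cinner_eq_on_closed_cspan[OF U(1)[OF j(1)] U(1)[OF j(2)] clinear_bounded_on_id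
            clinear_bounded_on_scaleC[OF clinear_bounded_on_id] _ a])
        (use gram j in \<open>auto simp: U cinner_scaleC_right\<close>)
    then show ?thesis by (simp add: cinner_scaleC_right)
  qed
  have "\<exists>W. clinear_bounded_on ?B (norm a) W \<and> (\<forall>j\<in>J. W (g j) = U j a)" if a: "a \<in> ?A" for a
  proof -
    have "cinner (U j a) (U j' a) = complex_of_real ((norm a)\<^sup>2) * cinner (g j) (g j')"
      if "j \<in> J" "j' \<in> J" for j j' using UU that a by (simp add: cinner_self)
    with clinear_extension_gram[of J "\<lambda>j. U j a" "norm a" g] show ?thesis
      by (metis norm_ge_zero)
  qed
  then obtain T where T: "\<And>a. a \<in> ?A \<Longrightarrow> clinear_bounded_on ?B (norm a) (T a)"
      "\<And>a j. a \<in> ?A \<Longrightarrow> j \<in> J \<Longrightarrow> T a (g j) = U j a" by metis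
  have eA: "e i \<in> ?A" if "i \<in> I" for i using that by (simp add: closed_cspan_superset)
  have gB: "g j \<in> ?B" if "j \<in> J" for j using that by (simp add: closed_cspan_superset)
  have Td: "T (e i) (g j) = d i j" if "i \<in> I" "j \<in> J" for i j using that by (simp add: T U eA)
  have TT: "cinner (T a b) (T a' b') = cinner a a' * cinner b b'"
    if a: "a \<in> ?A" "a' \<in> ?A" and b: "b \<in> ?B" "b' \<in> ?B" for a a' b b'
  proof -
    have "cinner (T a b) (T a' b') = cinner b (cinner a a' *\<^sub>C b')"
      by (rule cinner_eq_on_closed_cspan[OF T(1)[OF a(1)] T(1)[OF a(2)] clinear_bounded_on_id
            clinear_bounded_on_scaleC[OF clinear_bounded_on_id] _ b])
        (use UU a in \<open>auto simp: T cinner_scaleC_right\<close>)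
    then show ?thesis by (simp add: cinner_scaleC_right)
  qed
  have dD: "d i j \<in> ?D" if "i \<in> I" "j \<in> J" for i j
    by (rule closed_cspan_superset) (use that in blast)
  have UD: "U j a \<in> ?D" if "j \<in> J" "a \<in> ?A" for j a
    by (rule clinear_bounded_on_range[OF U(1)[OF that(1)] closed_csubspace_closed_cspan _ that(2)])
      (use that dD in \<open>auto simp: U\<close>)
  have TD: "T a b \<in> ?D" if "a \<in> ?A" "b \<in> ?B" for a b
    by (rule clinear_bounded_on_range[OF T(1)[OF that(1)] closed_csubspace_closed_cspan _ that(2)])
      (use that UD in \<open>auto simp: T\<close>)
  have "closed_cspan {T a b | a b. a \<in> ?A \<and> b \<in> ?B} = ?D"
  proof (rule subset_antisym)
    show "closed_cspan {T a b | a b. a \<in> ?A \<and> b \<in> ?B} \<subseteq> ?D"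
      by (rule closed_cspan_minimal) (use TD in auto)
    show "?D \<subseteq> closed_cspan {T a b | a b. a \<in> ?A \<and> b \<in> ?B}"
    proof (rule closed_cspan_mono, rule subsetI)
      fix x assume "x \<in> {d i j | i j. i \<in> I \<and> j \<in> J}"
      then obtain i j where "x = T (e i) (g j)" "i \<in> I" "j \<in> J" using Td by auto
      then show "x \<in> {T a b | a b. a \<in> ?A \<and> b \<in> ?B}" using eA gB by blast
    qed
  qed
  then show ?thesis using TT Td unfolding hilbert_tensor_def by (intro exI[of _ T]) blast
qed

subsection \<open>Square-integrable functions\<close>

text \<open>The composed simple functions converge pointwise; continuity of \<open>h\<close> is
  therefore assumed in sequential form.\<close>

lemma strongly_measurable_compose2:
  assumes f: "strongly_measurable f" and g: "strongly_measurable g"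
    and h: "\<And>s t x y. s \<longlonglongrightarrow> x \<Longrightarrow> t \<longlonglongrightarrow> y \<Longrightarrow> (\<lambda>i::nat. h (s i) (t i)) \<longlonglongrightarrow> h x y"
  shows "strongly_measurable (\<lambda>r. h (f r) (g r))"
proof -
  obtain s where s: "\<And>i. simple_function lborel (s i)" "\<And>r. (\<lambda>i::nat. s i r) \<longlonglongrightarrow> f r"
    using f by (auto simp: strongly_measurable_def)
  obtain s' where s': "\<And>i. simple_function lborel (s' i)" "\<And>r. (\<lambda>i::nat. s' i r) \<longlonglongrightarrow> g r"
    using g by (auto simp: strongly_measurable_def)
  show ?thesis
    unfolding strongly_measurable_def
  proof (intro exI conjI allI)
    show "simple_function lborel (\<lambda>r. h (s i r) (s' i r))" for i
      by (rule simple_function_compose2[OF s(1) s'(1)])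
    show "(\<lambda>i. h (s i r) (s' i r)) \<longlonglongrightarrow> h (f r) (g r)" for r by (rule h[OF s(2) s'(2)])
  qed
qed

lemma strongly_measurable_compose1:
  assumes f: "strongly_measurable f"
    and h: "\<And>s x. s \<longlonglongrightarrow> x \<Longrightarrow> (\<lambda>i::nat. h (s i)) \<longlonglongrightarrow> h x"
  shows "strongly_measurable (\<lambda>r. h (f r))"
  using strongly_measurable_compose2[OF f f, of "\<lambda>x y. h x"] h by simp

lemma strongly_measurable_translate:
  assumes f: "strongly_measurable f"
  shows "strongly_measurable (\<lambda>r. f (r - t))"
proof -
  obtain s where s: "\<And>i. simple_function lborel (s i)" "\<And>r. (\<lambda>i::nat. s i r) \<longlonglongrightarrow> f r"
    using f by (auto simp: strongly_measurable_def)
  have "simple_function lborel (\<lambda>r. s i (r - t))" for i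
    by (rule simple_function_comp[OF _ s(1)]) simp
  then show ?thesis
    unfolding strongly_measurable_def by (intro exI[of _ "\<lambda>i r. s i (r - t)"]) (use s in blast)
qed

lemma strongly_measurable_cut:
  assumes f: "strongly_measurable f" and A: "A \<in> sets borel"
  shows "strongly_measurable (cut A f)"
proof -
  obtain s where s: "\<And>i. simple_function lborel (s i)" "\<And>r. (\<lambda>i::nat. s i r) \<longlonglongrightarrow> f r"
    using f by (auto simp: strongly_measurable_def)
  have "simple_function lborel (cut A (s i))" for i
    unfolding cut_def[abs_def] by (rule simple_function_If_set) (use s A in auto)
  moreover have "(\<lambda>i. cut A (s i) r) \<longlonglongrightarrow> cut A f r" for r
    using s(2) by (simp add: cut_def)
  ultimately show ?thesis
    unfolding strongly_measurable_def by (intro exI[of _ "\<lambda>i. cut A (s i)"]) blast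
qed

text \<open>Applied to the scalar functions built from norms and inner products, since the noise
  space need not be second countable.\<close>

lemma borel_measurable_strongly_measurable:
  fixes f :: "real \<Rightarrow> 'a::{real_normed_vector, second_countable_topology}"
  assumes "strongly_measurable f"
  shows "f \<in> borel_measurable lborel"
proof -
  obtain s where s: "\<And>i. simple_function lborel (s i)" "\<And>r. (\<lambda>i::nat. s i r) \<longlonglongrightarrow> f r"
    using assms by (auto simp: strongly_measurable_def)
  show ?thesis
    by (rule borel_measurable_LIMSEQ_metric[where f = s])
      (rule borel_measurable_simple_function[OF s(1)], rule s(2))
qed

lemma L2D:
  assumes "f \<in> L2"
  shows "strongly_measurable f" "r < 0 \<Longrightarrow> f r = 0" "integrable lborel (\<lambda>r. (norm (f r))\<^sup>2)"
  using assms by (auto simp: L2_def)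

lemma L2_dominated:
  assumes g: "strongly_measurable g" "\<And>r. r < 0 \<Longrightarrow> g r = 0"
    and F: "integrable lborel F" "\<And>r. (norm (g r))\<^sup>2 \<le> F r"
  shows "g \<in> L2"
proof -
  have "strongly_measurable (\<lambda>r. (norm (g r))\<^sup>2)"
    by (rule strongly_measurable_compose1[OF g(1)]) (intro tendsto_intros)
  then have "(\<lambda>r. (norm (g r))\<^sup>2) \<in> borel_measurable lborel"
    by (rule borel_measurable_strongly_measurable)
  moreover have "norm ((norm (g r))\<^sup>2) \<le> norm (F r)" for r using F(2)[of r] by simp
  ultimately have "integrable lborel (\<lambda>r. (norm (g r))\<^sup>2)"
    by (intro Bochner_Integration.integrable_bound[OF F(1)] AE_I2)
  then show ?thesis using g by (simp add: L2_def)
qed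

lemma zero_in_L2: "(\<lambda>r. 0) \<in> L2"
  by (auto simp: L2_def strongly_measurable_def intro!: exI[of _ "\<lambda>i r. 0"])

lemma add_in_L2:
  assumes "f \<in> L2" "g \<in> L2"
  shows "(\<lambda>r. f r + g r) \<in> L2"
proof (rule L2_dominated)
  show "strongly_measurable (\<lambda>r. f r + g r)"
    by (rule strongly_measurable_compose2[OF L2D(1) L2D(1)]) (use assms in \<open>auto intro: tendsto_add\<close>)
  show "integrable lborel (\<lambda>r. 2 * (norm (f r))\<^sup>2 + 2 * (norm (g r))\<^sup>2)"
    using L2D(3)[OF assms(1)] L2D(3)[OF assms(2)] by simp
  show "(norm (f r + g r))\<^sup>2 \<le> 2 * (norm (f r))\<^sup>2 + 2 * (norm (g r))\<^sup>2" for r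
    using parallelogram[of "f r" "g r"] zero_le_power2[of "norm (f r - g r)"] by linarith
qed (simp add: L2D(2)[OF assms(1)] L2D(2)[OF assms(2)])

lemma cut_in_L2:
  assumes "f \<in> L2" "A \<in> sets borel"
  shows "cut A f \<in> L2"
  by (rule L2_dominated[OF strongly_measurable_cut[OF L2D(1)] _ L2D(3)])
    (use assms in \<open>auto simp: cut_def L2D\<close>)

lemma integrable_cinner_L2:
  assumes "f \<in> L2" "g \<in> L2"
  shows "integrable lborel (\<lambda>r. cinner (f r) (g r))"
proof -
  have "strongly_measurable (\<lambda>r. cinner (f r) (g r))"
    by (rule strongly_measurable_compose2[OF L2D(1) L2D(1)]) (use assms in \<open>auto intro: tendsto_cinner\<close>)
  then have m: "(\<lambda>r. cinner (f r) (g r)) \<in> borel_measurable lborel"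
    by (rule borel_measurable_strongly_measurable)
  have "cmod (cinner (f r) (g r)) \<le> (norm (f r))\<^sup>2 + (norm (g r))\<^sup>2" for r
    by (rule order_trans[OF Cauchy_Schwarz])
      (use sum_squares_bound[of "norm (f r)" "norm (g r)"] in
        \<open>simp add: mult_nonneg_nonneg order_trans[of _ "2 * norm (f r) * norm (g r)"]\<close>)
  then show ?thesis
    using L2D(3)[OF assms(1)] L2D(3)[OF assms(2)]
    by (intro Bochner_Integration.integrable_bound[OF _ m, of "\<lambda>r. (norm (f r))\<^sup>2 + (norm (g r))\<^sup>2"])
      (auto intro!: AE_I2)
qed

text \<open>At every point one summand of each pair vanishes, so the mixed terms drop out; after
  \<open>exp\<close> the sum becomes the product required of a tensor product.\<close>

lemma L2_inner_add_split:
  assumes "f \<in> L2" "f' \<in> L2" "g \<in> L2" "g' \<in> L2"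
    and "\<And>r. t \<le> r \<Longrightarrow> f r = 0" "\<And>r. t \<le> r \<Longrightarrow> f' r = 0"
    and "\<And>r. r < t \<Longrightarrow> g r = 0" "\<And>r. r < t \<Longrightarrow> g' r = 0"
  shows "L2_inner (\<lambda>r. f r + g r) (\<lambda>r. f' r + g' r) = L2_inner f f' + L2_inner g g'"
proof -
  have "cinner (f r + g r) (f' r + g' r) = cinner (f r) (f' r) + cinner (g r) (g' r)" for r
    using assms(5-8)[of r] by (cases "t \<le> r") simp_all
  then show ?thesis
    by (simp add: L2_inner_def Bochner_Integration.integral_add integrable_cinner_L2 assms)
qed

text \<open>Elements of \<open>L2\<close> vanish on the negative half-line, so the truncated shift
  is a plain translation and invariance of Lebesgue measure applies.\<close>

lemma shift_eq_translate: "f \<in> L2 \<Longrightarrow> shift t f = (\<lambda>r. f (r - t))"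
  by (rule ext) (simp add: shift_def L2D(2))

lemma shift_in_L2:
  assumes f: "f \<in> L2" and t: "0 \<le> t"
  shows "shift t f \<in> L2"
proof -
  have "integrable lborel (\<lambda>r. (norm (f (r - t)))\<^sup>2)"
    using lborel_integrable_real_affine[OF L2D(3)[OF f], of 1 "-t"] by simp
  then show ?thesis
    unfolding shift_eq_translate[OF f]
    by (intro L2_dominated[OF strongly_measurable_translate[OF L2D(1)[OF f]]])
      (use t in \<open>auto intro: L2D(2)[OF f]\<close>)
qed

lemma L2_inner_shift:
  assumes "f \<in> L2" "g \<in> L2"
  shows "L2_inner (shift t f) (shift t g) = L2_inner f g"
  unfolding L2_inner_def shift_eq_translate[OF assms(1)] shift_eq_translate[OF assms(2)]
  using lborel_integral_real_affine[of 1 "\<lambda>r. cinner (f r) (g r)" "-t"] by simp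

lemma projection_in_L2:
  assumes p: "orthogonal_projection p" and f: "f \<in> L2"
  shows "(\<lambda>r. p (f r)) \<in> L2"
proof -
  note pD = orthogonal_projectionD[OF p]
  have p0: "p 0 = 0" by (rule clinear_bounded_on_zero_arg[OF pD(3)]) simp
  show ?thesis
  proof (rule L2_dominated[OF strongly_measurable_compose1[OF L2D(1)[OF f]] _ L2D(3)[OF f]])
    show "s \<longlonglongrightarrow> x \<Longrightarrow> (\<lambda>i. p (s i)) \<longlonglongrightarrow> p x" for s x
      using clinear_bounded_on_tendsto(2)[OF pD(3)] by simp
    show "(norm (p (f r)))\<^sup>2 \<le> (norm (f r))\<^sup>2" for r
      using clinear_bounded_onD(3)[OF pD(3), of "f r"] by (simp add: power_mono)
  qed (simp add: L2D(2)[OF f] p0)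
qed

lemma L2_inner_projection:
  "orthogonal_projection p \<Longrightarrow> L2_inner (\<lambda>r. p (f r)) g = L2_inner f (\<lambda>r. p (g r))"
  by (simp add: L2_inner_def orthogonal_projectionD(2))


subsection \<open>Factorisations of Fock space\<close>

context ampliated_fock
begin

lemma past_eq: "past t = closed_cspan (expv ` {f \<in> L2. \<forall>r\<ge>t. f r = 0})"
  unfolding past_def by (rule arg_cong[of _ _ closed_cspan]) auto

lemma future_eq: "future t = closed_cspan (expv ` {f \<in> L2. \<forall>r<t. f r = 0})"
  unfolding future_def by (rule arg_cong[of _ _ closed_cspan]) auto

lemma ampl_space_eq: "ampl_space K = closed_cspan (case_prod tens ` (UNIV \<times> K))"
  unfolding ampl_space_def by (rule arg_cong[of _ _ closed_cspan]) auto

lemma closed_csubspace_past [simp]: "closed_csubspace (past t)"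
  and closed_csubspace_future [simp]: "closed_csubspace (future t)"
  and closed_csubspace_ampl_space [simp]: "closed_csubspace (ampl_space K)"
  by (simp_all add: past_def future_def ampl_space_def)

lemma expv_in_past: "f \<in> L2 \<Longrightarrow> (\<And>r. t \<le> r \<Longrightarrow> f r = 0) \<Longrightarrow> expv f \<in> past t"
  unfolding past_eq by (rule closed_cspan_superset) simp

lemma expv_in_future: "f \<in> L2 \<Longrightarrow> (\<And>r. r < t \<Longrightarrow> f r = 0) \<Longrightarrow> expv f \<in> future t"
  unfolding future_eq by (rule closed_cspan_superset) simp

lemma tens_in_ampl_space: "x \<in> K \<Longrightarrow> tens u x \<in> ampl_space K"
  unfolding ampl_space_def by (rule closed_cspan_superset) blast

lemma expv_nonzero: "f \<in> L2 \<Longrightarrow> expv f \<noteq> 0"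
  using cinner_expv[of f f] by auto

text \<open>With sums of functions supported before and after \<open>t\<close> as targets,
  \<open>exp\<close> turns additivity of the inner product into the Gram identity. Cutting an
  arbitrary function at \<open>t\<close> shows that these sums exhaust \<open>L2\<close>.\<close>

lemma join_exists:
  "hilbert_tensor (past t) (future t) UNIV (join t)
     \<and> (\<forall>f\<in>L2. join t (expv (cut {..<t} f)) (expv (cut {t..} f)) = expv f)"
proof -
  let ?I = "{f \<in> L2. \<forall>r\<ge>t. f r = 0}" and ?J = "{f \<in> L2. \<forall>r<t. f r = 0}"
  let ?d = "\<lambda>f g. expv (\<lambda>r. f r + g r)"
  have "\<exists>T. hilbert_tensor (closed_cspan (expv ` ?I)) (closed_cspan (expv ` ?J))
      (closed_cspan {?d f g | f g. f \<in> ?I \<and> g \<in> ?J}) T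
      \<and> (\<forall>f\<in>?I. \<forall>g\<in>?J. T (expv f) (expv g) = ?d f g)"
  proof (rule hilbert_tensor_exists)
    fix f g f' g' :: "real \<Rightarrow> 'k" assume "f \<in> ?I" "g \<in> ?J" "f' \<in> ?I" "g' \<in> ?J"
    then show "cinner (?d f g) (?d f' g') = cinner (expv f) (expv f') * cinner (expv g) (expv g')"
      using L2_inner_add_split[of f f' g g' t] by (simp add: cinner_expv add_in_L2 exp_add)
  qed
  then obtain T where T: "hilbert_tensor (past t) (future t)
      (closed_cspan {?d f g | f g. f \<in> ?I \<and> g \<in> ?J}) T"
      "\<And>f g. f \<in> ?I \<Longrightarrow> g \<in> ?J \<Longrightarrow> T (expv f) (expv g) = ?d f g"
    unfolding past_eq future_eq by blast
  have cut: "cut {..<t} f \<in> ?I" "cut {t..} f \<in> ?J" "(\<lambda>r. cut {..<t} f r + cut {t..} f r) = f"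
    if "f \<in> L2" for f :: "real \<Rightarrow> 'k" using that by (auto simp: cut_in_L2) (auto simp: cut_def)
  have "UNIV = closed_cspan (expv ` L2)" using expv_total by simp
  also have "\<dots> \<subseteq> closed_cspan {?d f g | f g. f \<in> ?I \<and> g \<in> ?J}"
  proof (rule closed_cspan_mono, rule image_subsetI)
    fix f :: "real \<Rightarrow> 'k" assume f: "f \<in> L2"
    then have "expv f = ?d (cut {..<t} f) (cut {t..} f)" by (simp add: cut(3))
    then show "expv f \<in> {?d f g | f g. f \<in> ?I \<and> g \<in> ?J}" using cut(1,2)[OF f] by blast
  qed
  finally have "closed_cspan {?d f g | f g. f \<in> ?I \<and> g \<in> ?J} = UNIV" by blast
  then have "hilbert_tensor (past t) (future t) UNIV T" using T(1) by simp
  moreover have "\<forall>f\<in>L2. T (expv (cut {..<t} f)) (expv (cut {t..} f)) = expv f"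
    using T(2)[OF cut(1,2)] cut(3) by simp
  ultimately have "\<exists>T. hilbert_tensor (past t) (future t) UNIV T
     \<and> (\<forall>f\<in>L2. T (expv (cut {..<t} f)) (expv (cut {t..} f)) = expv f)" by blast
  then show ?thesis unfolding join_def by (rule someI_ex)
qed

lemmas join_tensor = conjunct1[OF join_exists]

lemma join_cut: "f \<in> L2 \<Longrightarrow> join t (expv (cut {..<t} f)) (expv (cut {t..} f)) = expv f"
  using join_exists by blast

lemma join_expv:
  assumes "f \<in> L2" "\<And>r. t \<le> r \<Longrightarrow> f r = 0" "g \<in> L2" "\<And>r. r < t \<Longrightarrow> g r = 0"
  shows "join t (expv f) (expv g) = expv (\<lambda>r. f r + g r)"
proof -
  have "cut {..<t} (\<lambda>r. f r + g r) = f" "cut {t..} (\<lambda>r. f r + g r) = g"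
    using assms(2,4) by (auto simp: cut_def fun_eq_iff not_less not_le)
  then show ?thesis using join_cut[OF add_in_L2[OF assms(1,3)], of t] by simp
qed

lemma tens_join_total: "closed_cspan {tens u (join t x y) | u x y. x \<in> past t \<and> y \<in> future t} = UNIV"
proof -
  let ?J = "{join t x y | x y. x \<in> past t \<and> y \<in> future t}"
  have "hilbert_tensor (closed_cspan UNIV) (closed_cspan ?J) UNIV tens"
    using tensor hilbert_tensorD(2)[OF join_tensor[of t]] by (simp add: closed_cspan_self)
  from hilbert_tensor_total[OF this]
  have "UNIV = closed_cspan {tens u z | u z. u \<in> UNIV \<and> z \<in> ?J}" .
  also have "{tens u z | u z. u \<in> UNIV \<and> z \<in> ?J} = {tens u (join t x y) | u x y. x \<in> past t \<and> y \<in> future t}"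
    by blast
  finally show ?thesis by simp
qed

text \<open>Both bracketings of the threefold tensor product have the same Gram matrix, so the
  existence lemma applies with the pairs \<open>(u, x)\<close> as indices of the first
  factor.\<close>

lemma hpast_join_exists:
  "hilbert_tensor (hpast t) (future t) UNIV (hpast_join t)
     \<and> (\<forall>u. \<forall>x\<in>past t. \<forall>y\<in>future t. hpast_join t (tens u x) y = tens u (join t x y))"
proof -
  let ?d = "\<lambda>(u, x) y. tens u (join t x y)"
  have "\<exists>T. hilbert_tensor (closed_cspan (case_prod tens ` (UNIV \<times> past t)))
      (closed_cspan ((\<lambda>y. y) ` future t))
      (closed_cspan {?d i j | i j. i \<in> UNIV \<times> past t \<and> j \<in> future t}) T
      \<and> (\<forall>i\<in>UNIV \<times> past t. \<forall>y\<in>future t. T (case_prod tens i) y = ?d i y)"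
    by (rule hilbert_tensor_exists)
      (auto simp: hilbert_tensorD(1)[OF tensor] hilbert_tensorD(1)[OF join_tensor])
  moreover have "{?d i j | i j. i \<in> UNIV \<times> past t \<and> j \<in> future t}
      = {tens u (join t x y) | u x y. x \<in> past t \<and> y \<in> future t}" by auto
  ultimately have "\<exists>T. hilbert_tensor (hpast t) (future t) UNIV T
      \<and> (\<forall>u. \<forall>x\<in>past t. \<forall>y\<in>future t. T (tens u x) y = tens u (join t x y))"
    by (simp add: tens_join_total ampl_space_eq closed_cspan_self)
  then show ?thesis unfolding hpast_join_def by (rule someI_ex)
qed

lemma hfuture_join_exists:
  "hilbert_tensor (past t) (hfuture t) UNIV (hfuture_join t)
     \<and> (\<forall>u. \<forall>x\<in>past t. \<forall>y\<in>future t. hfuture_join t x (tens u y) = tens u (join t x y))"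
proof -
  let ?d = "\<lambda>x (u, y). tens u (join t x y)"
  have "\<exists>T. hilbert_tensor (closed_cspan ((\<lambda>x. x) ` past t))
      (closed_cspan (case_prod tens ` (UNIV \<times> future t)))
      (closed_cspan {?d i j | i j. i \<in> past t \<and> j \<in> UNIV \<times> future t}) T
      \<and> (\<forall>x\<in>past t. \<forall>j\<in>UNIV \<times> future t. T x (case_prod tens j) = ?d x j)"
    by (rule hilbert_tensor_exists)
      (auto simp: hilbert_tensorD(1)[OF tensor] hilbert_tensorD(1)[OF join_tensor])
  moreover have "{?d i j | i j. i \<in> past t \<and> j \<in> UNIV \<times> future t}
      = {tens u (join t x y) | u x y. x \<in> past t \<and> y \<in> future t}" by auto
  ultimately have "\<exists>T. hilbert_tensor (past t) (hfuture t) UNIV T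
      \<and> (\<forall>u. \<forall>x\<in>past t. \<forall>y\<in>future t. T x (tens u y) = tens u (join t x y))"
    by (simp add: tens_join_total ampl_space_eq closed_cspan_self) blast
  then show ?thesis unfolding hfuture_join_def by (rule someI_ex)
qed

lemmas hpast_join_tensor = conjunct1[OF hpast_join_exists]
lemmas hfuture_join_tensor = conjunct1[OF hfuture_join_exists]

lemma hfuture_join_tens:
  "x \<in> past t \<Longrightarrow> y \<in> future t \<Longrightarrow> hfuture_join t x (tens u y) = tens u (join t x y)"
  using hfuture_join_exists by blast

lemmas clinear_tens = clinear_bounded_on_hilbert_tensor[OF tensor, simplified]
lemmas clinear_join = clinear_bounded_on_hilbert_tensor[OF join_tensor, simplified]
lemmas clinear_hpast_join = clinear_bounded_on_hilbert_tensor[OF hpast_join_tensor, simplified]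
lemmas clinear_hfuture_join = clinear_bounded_on_hilbert_tensor[OF hfuture_join_tensor, simplified]


subsection \<open>Ampliation, second quantisation and the shift isometries\<close>

lemma id_op_clinear:
  assumes "closed_csubspace H"
  shows "clinear_bounded_on H 1 (id_op H)"
  using closed_csubspaceD[OF assms] by (auto simp: clinear_bounded_on_def id_op_def)

lemma ampl_exists:
  assumes X: "clinear_bounded_on UNIV K X" and K: "0 \<le> K"
  shows "ampl X \<in> bounded_ops UNIV \<and> clinear_bounded_on UNIV K (ampl X)
    \<and> (\<forall>u x. ampl X (tens u x) = tens u (X x))"
  using op_tensor_exists[OF tensor closed_csubspace_UNIV closed_csubspace_UNIV
      id_op_clinear[OF closed_csubspace_UNIV] _ _ X _ K]
  by (simp add: ampl_def id_op_def)

lemma ampl_bounded: "X \<in> bounded_ops UNIV \<Longrightarrow> ampl X \<in> bounded_ops UNIV"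
  using ampl_exists clinear_bounded_on_nonneg unfolding bounded_ops_UNIV_iff by metis

lemma ampl_tens: "X \<in> bounded_ops UNIV \<Longrightarrow> ampl X (tens u x) = tens u (X x)"
  using ampl_exists clinear_bounded_on_nonneg unfolding bounded_ops_UNIV_iff by metis

lemma tens_total: "closed_cspan {tens u x | u x. True} = UNIV"
  using hilbert_tensorD(2)[OF tensor] by simp

lemma tens_expv_total: "closed_cspan {tens u (expv f) | u f. f \<in> L2} = UNIV"
proof -
  have "hilbert_tensor (closed_cspan UNIV) (closed_cspan (expv ` L2)) UNIV tens"
    using tensor expv_total by (simp add: closed_cspan_self)
  from hilbert_tensor_total[OF this]
  have "UNIV = closed_cspan {tens u x | u x. u \<in> UNIV \<and> x \<in> expv ` L2}" .
  also have "{tens u x | u x. u \<in> UNIV \<and> x \<in> expv ` L2} = {tens u (expv f) | u f. f \<in> L2}" by blast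
  finally show ?thesis by simp
qed

lemma bounded_ops_eq_tens:
  assumes "X \<in> bounded_ops UNIV" "Y \<in> bounded_ops UNIV" "\<And>u x. X (tens u x) = Y (tens u x)"
  shows "X z = Y z"
proof -
  obtain K L where "clinear_bounded_on UNIV K X" "clinear_bounded_on UNIV L Y"
    using assms(1,2) unfolding bounded_ops_UNIV_iff by blast
  then show ?thesis
    using clinear_bounded_on_eqI[of "{tens u x | u x. True}" K X L Y z] assms(3)
    unfolding tens_total by blast
qed

text \<open>Shifting preserves inner products in \<open>L2\<close>, hence the Gram matrix of the
  exponential vectors.\<close>

lemma Gamma_exists:
  assumes t: "0 \<le> t"
  shows "Gamma t \<in> bounded_ops UNIV" "f \<in> L2 \<Longrightarrow> Gamma t (expv f) = expv (shift t f)"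
proof -
  have tot: "closed_cspan (expv ` L2) = UNIV" by (rule expv_total)
  obtain G where G: "clinear_bounded_on UNIV 1 G" "\<And>f. f \<in> L2 \<Longrightarrow> G (expv f) = expv (shift t f)"
  proof (rule clinear_extension_gram[of L2 "\<lambda>f. expv (shift t f)" 1 expv, unfolded tot])
    show "cinner (expv (shift t f)) (expv (shift t g)) = complex_of_real (1\<^sup>2) * cinner (expv f) (expv g)"
      if "f \<in> L2" "g \<in> L2" for f g
      using that by (simp add: cinner_expv shift_in_L2[OF _ t] L2_inner_shift)
  qed (auto intro: that)
  have Gb: "G \<in> bounded_ops UNIV" using G(1) by (auto simp: bounded_ops_UNIV_iff)
  have "Gamma t = G"
    unfolding Gamma_def
  proof (rule the_equality)
    fix G' assume G': "G' \<in> bounded_ops UNIV \<and> (\<forall>f\<in>L2. G' (expv f) = expv (shift t f))"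
    then obtain K where "clinear_bounded_on UNIV K G'" by (auto simp: bounded_ops_UNIV_iff)
    then show "G' = G"
      by (intro ext, rule clinear_bounded_on_eqI[of "expv ` L2" K G' 1 G, unfolded tot])
        (use G G' in auto)
  qed (use G Gb in blast)
  then show "Gamma t \<in> bounded_ops UNIV" "f \<in> L2 \<Longrightarrow> Gamma t (expv f) = expv (shift t f)"
    using G Gb by auto
qed

text \<open>The second quantisation is the orthogonal projection onto the span of the \<open>\<epsilon>(f)\<close> with \<open>pf = f\<close>;
  this gives its boundedness for free.\<close>

lemma second_quant_exists:
  assumes p: "orthogonal_projection p"
  shows "clinear_bounded_on (future t) 1 (second_quant p t)
    \<and> (\<forall>x\<in>future t. second_quant p t x \<in> future t)
    \<and> (\<forall>f\<in>L2. (\<forall>r<t. f r = 0) \<longrightarrow> second_quant p t (expv f) = expv (\<lambda>r. p (f r)))"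
proof -
  note pD = orthogonal_projectionD[OF p]
  have p0: "p 0 = 0" by (rule clinear_bounded_on_zero_arg[OF pD(3)]) simp
  let ?G = "expv ` {f \<in> L2. (\<forall>r<t. f r = 0) \<and> (\<forall>r. p (f r) = f r)}"
  define D where "D = closed_cspan ?G"
  have D: "closed_csubspace D" by (simp add: D_def)
  have DF: "D \<subseteq> future t" unfolding D_def future_eq by (rule closed_cspan_mono) auto
  obtain P where P: "\<And>x. P x \<in> D" "\<And>x y. y \<in> D \<Longrightarrow> cinner y (x - P x) = 0"
    using orthogonal_projection_point[OF D] by metis
  have P_eqI: "P x = q" if "q \<in> D" "\<And>y. y \<in> D \<Longrightarrow> cinner y (x - q) = 0" for x q
  proof (rule cinner_ext_on[OF D P(1) that(1)])
    fix y assume "y \<in> D"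
    then have "cinner y (P x) = cinner y q"
      using P(2)[of y x] that(2)[of y] by (simp add: cinner_diff_right)
    then show "cinner (P x) y = cinner q y" by (metis cinner_commute)
  qed
  have P_lin: "clinear_bounded_on UNIV 1 P"
    unfolding clinear_bounded_on_def
  proof (intro conjI ballI allI)
    fix x
    show "P (x + y) = P x + P y" for y
    proof (rule P_eqI[OF closed_csubspaceD(2)[OF D P(1) P(1)]])
      fix z assume "z \<in> D"
      then show "cinner z (x + y - (P x + P y)) = 0"
        using P(2)[of z x] P(2)[of z y] by (simp add: cinner_diff_right cinner_add_right)
    qed
    show "P (c *\<^sub>C x) = c *\<^sub>C P x" for c
    proof (rule P_eqI[OF closed_csubspaceD(3)[OF D P(1)]])
      fix z assume "z \<in> D"
      then show "cinner z (c *\<^sub>C x - c *\<^sub>C P x) = 0"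
        using P(2)[of z x] by (simp add: cinner_diff_right cinner_scaleC_right)
    qed
    have "cinner (P x) (x - P x) = 0" by (rule P(2)[OF P(1)])
    then have "(norm (P x))\<^sup>2 \<le> (norm x)\<^sup>2"
      using norm_add_square[of "P x" "x - P x"] by simp
    then have "norm (P x) \<le> norm x" by (rule power2_le_imp_le) simp
    then show "norm (P x) \<le> 1 * norm x" by simp
  qed
  have P_expv: "P (expv f) = expv (\<lambda>r. p (f r))" if f: "f \<in> L2" "\<forall>r<t. f r = 0" for f
  proof (rule P_eqI)
    note pf = projection_in_L2[OF p f(1)]
    show "expv (\<lambda>r. p (f r)) \<in> D"
      unfolding D_def by (rule closed_cspan_superset) (use pf f p0 pD(1) in auto)
    fix y assume y: "y \<in> D"
    \<comment> \<open>When \<open>p\<close> fixes the values of \<open>g\<close>, the functions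
      \<open>f\<close> and \<open>p f\<close> have the same inner product with \<open>g\<close>; the
      residual is thus orthogonal to the generators of \<open>D\<close>.\<close>
    have "cinner (expv f - expv (\<lambda>r. p (f r))) (expv g) = 0"
      if g: "g \<in> L2" "\<And>r. p (g r) = g r" for g
      using L2_inner_projection[OF p, of f g] g(2)
      by (simp add: cinner_diff_left cinner_expv[OF f(1) g(1)] cinner_expv[OF pf g(1)])
    then have "cinner (expv f - expv (\<lambda>r. p (f r))) y \<in> {0}"
      by (intro clinear_bounded_on_range[OF clinear_bounded_on_cinner closed_csubspace_zero _
            y[unfolded D_def]]) auto
    then show "cinner y (expv f - expv (\<lambda>r. p (f r))) = 0"
      by (metis cinner_commute complex_cnj_zero singletonD)
  qed
  define Q where "Q x = (if x \<in> future t then P x else 0)" for x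
  have Q: "clinear_bounded_on (future t) 1 Q"
    using P_lin closed_csubspaceD[OF closed_csubspace_future[of t]]
    by (auto simp: clinear_bounded_on_def Q_def)
  have QF: "\<forall>x\<in>future t. Q x \<in> future t" using P(1) DF by (auto simp: Q_def)
  have Qb: "Q \<in> bounded_ops (future t)" using Q QF by (auto simp: bounded_ops_iff Q_def)
  have Qe: "\<forall>f\<in>L2. (\<forall>r<t. f r = 0) \<longrightarrow> Q (expv f) = expv (\<lambda>r. p (f r))"
    using P_expv by (auto simp: Q_def expv_in_future)
  have "second_quant p t = Q"
    unfolding second_quant_def
  proof (rule the_equality)
    fix Q' assume Q': "Q' \<in> bounded_ops (future t)
      \<and> (\<forall>f\<in>L2. (\<forall>r<t. f r = 0) \<longrightarrow> Q' (expv f) = expv (\<lambda>r. p (f r)))"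
    then obtain K where K: "clinear_bounded_on (future t) K Q'" by (auto simp: bounded_ops_iff)
    show "Q' = Q"
    proof
      fix x show "Q' x = Q x"
      proof (cases "x \<in> future t")
        case True
        show ?thesis
          by (rule clinear_bounded_on_eqI[OF K[unfolded future_eq] Q[unfolded future_eq] _
                True[unfolded future_eq]]) (use Q' Qe in auto)
      qed (use Q' Qb in \<open>simp add: bounded_ops_iff\<close>)
    qed
  qed (use Qb Qe in blast)
  then show ?thesis using Q QF Qe by simp
qed

end

lemma bounded_ops_UNIV_comp:
  assumes "X \<in> bounded_ops UNIV" "Y \<in> bounded_ops UNIV"
  shows "(\<lambda>z. X (Y z)) \<in> bounded_ops UNIV"
proof -
  obtain K L where "clinear_bounded_on UNIV K X" "clinear_bounded_on UNIV L Y" "0 \<le> K"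
    using assms clinear_bounded_on_nonneg unfolding bounded_ops_UNIV_iff by metis
  then show ?thesis
    unfolding bounded_ops_UNIV_iff by (blast intro: clinear_bounded_on_comp)
qed

lemma bounded_ops_UNIV_diff:
  assumes "X \<in> bounded_ops UNIV" "Y \<in> bounded_ops UNIV"
  shows "(\<lambda>z. X z - Y z) \<in> bounded_ops UNIV"
  using assms clinear_bounded_on_diff unfolding bounded_ops_UNIV_iff by blast

lemma hilbert_tensor_eqI:
  assumes T: "hilbert_tensor A B UNIV T" and X: "X \<in> bounded_ops UNIV" "Y \<in> bounded_ops UNIV"
    and XY: "\<And>a b. a \<in> A \<Longrightarrow> b \<in> B \<Longrightarrow> X (T a b) = Y (T a b)"
  shows "X z = Y z"
proof -
  have tot: "closed_cspan {T a b | a b. a \<in> A \<and> b \<in> B} = UNIV"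
    using hilbert_tensorD(2)[OF T] by simp
  obtain K L where KL: "clinear_bounded_on UNIV K X" "clinear_bounded_on UNIV L Y"
    using X unfolding bounded_ops_UNIV_iff by blast
  show ?thesis
    by (rule clinear_bounded_on_eqI[of "{T a b | a b. a \<in> A \<and> b \<in> B}" K X L Y z, unfolded tot, OF KL])
      (use XY in auto)
qed

context ampliated_fock
begin

subsection \<open>Operators acting on the past or on the future only\<close>

text \<open>Encodes \<open>R = R' \<otimes> I\<close> over \<open>past s\<close> and
  \<open>future s\<close>. As the past is embedded by tensoring with the vacuum, \<open>R'\<close>
  is the restriction of \<open>R\<close> itself.\<close>

definition past_op :: "real \<Rightarrow> ('f \<Rightarrow> 'f) \<Rightarrow> bool" where
  "past_op s R \<longleftrightarrow> R \<in> bounded_ops UNIV \<and> (\<forall>x\<in>past s. R x \<in> past s)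
     \<and> (\<forall>x\<in>past s. \<forall>y\<in>future s. R (join s x y) = join s (R x) y)"

text \<open>Encodes \<open>Y = I \<otimes> Y'\<close> over \<open>past s\<close> and
  \<open>hfuture s\<close>, with \<open>h\<close> attached to the future. Boundedness is demanded of
  \<open>Y\<close>; of \<open>Y'\<close> only its values are recorded.\<close>

definition future_op :: "real \<Rightarrow> ('hf \<Rightarrow> 'hf) \<Rightarrow> bool" where
  "future_op s Y \<longleftrightarrow> Y \<in> bounded_ops UNIV \<and> (\<exists>Y'. (\<forall>w\<in>hfuture s. Y' w \<in> hfuture s)
     \<and> (\<forall>x\<in>past s. \<forall>w\<in>hfuture s. Y (hfuture_join s x w) = hfuture_join s x (Y' w)))"

lemma past_opD:
  assumes "past_op s R"
  shows "R \<in> bounded_ops UNIV" "x \<in> past s \<Longrightarrow> R x \<in> past s"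
    "x \<in> past s \<Longrightarrow> y \<in> future s \<Longrightarrow> R (join s x y) = join s (R x) y"
  using assms by (auto simp: past_op_def)

text \<open>Both sides are bounded and linear in \<open>w\<close>, so \<open>w\<close> may be taken
  as an elementary tensor, where \<open>tens\<close> and \<open>join\<close> can be
  rebracketed.\<close>

lemma ampl_past_op:
  assumes R: "past_op s R" and x: "x \<in> past s" and w: "w \<in> hfuture s"
  shows "ampl R (hfuture_join s x w) = hfuture_join s (R x) w"
proof -
  obtain K where K: "clinear_bounded_on UNIV K (ampl R)" "0 \<le> K"
    using ampl_bounded[OF past_opD(1)[OF R]] clinear_bounded_on_nonneg
    unfolding bounded_ops_UNIV_iff by metis
  show ?thesis
    by (rule clinear_bounded_on_eqI[OF clinear_bounded_on_comp[OF clinear_hfuture_join(1)[OF x] K(1) _ K(2),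
            unfolded ampl_space_def] clinear_hfuture_join(1)[OF past_opD(2)[OF R x], unfolded ampl_space_def]
          _ w[unfolded ampl_space_def]])
      (auto simp: hfuture_join_tens x past_opD[OF R] ampl_tens)
qed

text \<open>On a product vector one operator changes the first factor and the other the second, and
  product vectors are total.\<close>

lemma past_op_future_op_commute:
  assumes R: "past_op s R" and Y: "future_op s Y"
  shows "ampl R (Y z) = Y (ampl R z)"
proof -
  obtain Y' where Y': "\<And>w. w \<in> hfuture s \<Longrightarrow> Y' w \<in> hfuture s"
    "\<And>x w. x \<in> past s \<Longrightarrow> w \<in> hfuture s \<Longrightarrow> Y (hfuture_join s x w) = hfuture_join s x (Y' w)"
    and Yb: "Y \<in> bounded_ops UNIV" using Y unfolding future_op_def by blast
  have Rb: "ampl R \<in> bounded_ops UNIV" by (rule ampl_bounded[OF past_opD(1)[OF R]])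
  show ?thesis
    by (rule hilbert_tensor_eqI[OF hfuture_join_tensor[of s] bounded_ops_UNIV_comp[OF Rb Yb]
          bounded_ops_UNIV_comp[OF Yb Rb]])
      (simp add: Y' ampl_past_op[OF R] past_opD(2)[OF R])
qed

lemma future_op_diff:
  assumes "future_op s Y" "future_op s Z"
  shows "future_op s (\<lambda>z. Y z - Z z)"
proof -
  obtain Y' where Y': "\<And>w. w \<in> hfuture s \<Longrightarrow> Y' w \<in> hfuture s"
    "\<And>x w. x \<in> past s \<Longrightarrow> w \<in> hfuture s \<Longrightarrow> Y (hfuture_join s x w) = hfuture_join s x (Y' w)"
    and Yb: "Y \<in> bounded_ops UNIV" using assms(1) unfolding future_op_def by blast
  obtain Z' where Z': "\<And>w. w \<in> hfuture s \<Longrightarrow> Z' w \<in> hfuture s"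
    "\<And>x w. x \<in> past s \<Longrightarrow> w \<in> hfuture s \<Longrightarrow> Z (hfuture_join s x w) = hfuture_join s x (Z' w)"
    and Zb: "Z \<in> bounded_ops UNIV" using assms(2) unfolding future_op_def by blast
  show ?thesis
    unfolding future_op_def
  proof (intro conjI exI[of _ "\<lambda>w. Y' w - Z' w"] ballI)
    show "(\<lambda>z. Y z - Z z) \<in> bounded_ops UNIV" by (rule bounded_ops_UNIV_diff[OF Yb Zb])
    fix w assume w: "w \<in> hfuture s"
    show "Y' w - Z' w \<in> hfuture s"
      by (rule closed_csubspaceD(4)[OF closed_csubspace_ampl_space Y'(1)[OF w] Z'(1)[OF w]])
    show "Y (hfuture_join s x w) - Z (hfuture_join s x w) = hfuture_join s x (Y' w - Z' w)"
      if x: "x \<in> past s" for x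
      using clinear_bounded_on_minus_arg[OF clinear_hfuture_join(1)[OF x] closed_csubspace_ampl_space
          Y'(1)[OF w] Z'(1)[OF w]] by (simp add: Y'(2)[OF x w] Z'(2)[OF x w])
  qed
qed

text \<open>Both sides factor through \<open>u \<otimes> \<epsilon>(f) = \<epsilon>(f|[0,s)) \<otimes> (u \<otimes> \<epsilon>(f|[s,\<infinity>)))\<close>: \<open>R\<close> only sees the first
  factor, \<open>Y\<close> only the second.\<close>

lemma norm_future_op_past_op:
  assumes R: "past_op s R" and Y: "future_op s Y" and f: "f \<in> L2"
  shows "norm (Y (ampl R (tens u (expv f)))) * norm (expv f)
    = norm (R (expv f)) * norm (Y (tens u (expv f)))"
proof -
  obtain Y' where Y': "\<And>w. w \<in> hfuture s \<Longrightarrow> Y' w \<in> hfuture s"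
    "\<And>x w. x \<in> past s \<Longrightarrow> w \<in> hfuture s \<Longrightarrow> Y (hfuture_join s x w) = hfuture_join s x (Y' w)"
    using Y unfolding future_op_def by blast
  define x where "x = expv (cut {..<s} f)"
  define y where "y = expv (cut {s..} f)"
  have x: "x \<in> past s"
    unfolding x_def by (rule expv_in_past) (use f in \<open>auto simp: cut_in_L2, auto simp: cut_def\<close>)
  have y: "y \<in> future s"
    unfolding y_def by (rule expv_in_future) (use f in \<open>auto simp: cut_in_L2, auto simp: cut_def\<close>)
  have w: "tens u y \<in> hfuture s" by (rule tens_in_ampl_space[OF y])
  have e: "expv f = join s x y" by (simp add: x_def y_def join_cut f)
  have z: "tens u (expv f) = hfuture_join s x (tens u y)" by (simp add: e hfuture_join_tens x y)
  have Rx: "R x \<in> past s" by (rule past_opD(2)[OF R x])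
  note norms = hilbert_tensor_norm[OF join_tensor] hilbert_tensor_norm[OF hfuture_join_tensor]
  show ?thesis
    unfolding z unfolding e past_opD(3)[OF R x y] ampl_past_op[OF R x w] Y'(2)[OF x w] Y'(2)[OF Rx w]
    by (simp add: norms x y w Rx Y'(1))
qed

text \<open>The Fock space over \<open>[0,s)\<close> splits at \<open>r\<close>, and
  \<open>R\<close> leaves the piece over \<open>[r,s)\<close> alone. The associativity of
  \<open>join\<close> behind this is checked on exponential vectors, where \<open>join\<close> adds
  functions, and then extended one factor at a time.\<close>

lemma past_op_mono:
  assumes R: "past_op r R" and rs: "r \<le> s"
  shows "past_op s R"
proof -
  obtain K where K: "clinear_bounded_on UNIV K R" "0 \<le> K"
    using past_opD(1)[OF R] clinear_bounded_on_nonneg unfolding bounded_ops_UNIV_iff by metis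
  have KR: "clinear_bounded_on C K R" for C using clinear_bounded_on_mono[OF K(1)] by simp
  \<comment> \<open>The first factor is an arbitrary past vector because the statement is applied to
    \<open>R (expv k)\<close>, which need not be exponential.\<close>
  have h_past: "join r a (expv h) \<in> past s"
    if a: "a \<in> past r" and h: "h \<in> L2" "\<And>q. q < r \<Longrightarrow> h q = 0" "\<And>q. s \<le> q \<Longrightarrow> h q = 0" for a h
  proof -
    have hF: "expv h \<in> future r" by (rule expv_in_future[OF h(1,2)])
    show ?thesis
    proof (rule clinear_bounded_on_range[OF clinear_join(2)[OF hF, unfolded past_eq]
          closed_csubspace_past _ a[unfolded past_eq]])
      fix x assume "x \<in> expv ` {f \<in> L2. \<forall>q\<ge>r. f q = 0}"
      then obtain f where f: "f \<in> L2" "\<And>q. r \<le> q \<Longrightarrow> f q = 0" "x = expv f" by blast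
      have "expv (\<lambda>q. f q + h q) \<in> past s"
        by (rule expv_in_past) (use f h rs in \<open>auto intro: add_in_L2\<close>)
      also have "expv (\<lambda>q. f q + h q) = join r x (expv h)"
        unfolding f(3) by (rule join_expv[OF f(1,2) h(1,2), symmetric])
      finally show "join r x (expv h) \<in> past s" .
    qed
  qed
  \<comment> \<open>Linearity in \<open>a\<close> reduces the two bracketings to the two ways of
    adding three functions.\<close>
  have assoc: "join r a (expv (\<lambda>q. h q + g q)) = join s (join r a (expv h)) (expv g)"
    if a: "a \<in> past r" and h: "h \<in> L2" "\<And>q. q < r \<Longrightarrow> h q = 0" "\<And>q. s \<le> q \<Longrightarrow> h q = 0"
      and g: "g \<in> L2" "\<And>q. q < s \<Longrightarrow> g q = 0" for a h g
  proof -
    have hF: "expv h \<in> future r" by (rule expv_in_future[OF h(1,2)])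
    have gF: "expv g \<in> future s" by (rule expv_in_future[OF g])
    have hg: "(\<lambda>q. h q + g q) \<in> L2" "\<And>q. q < r \<Longrightarrow> h q + g q = 0"
      using h g rs by (auto intro: add_in_L2)
    have hgF: "expv (\<lambda>q. h q + g q) \<in> future r" by (rule expv_in_future[OF hg])
    show ?thesis
    proof (rule clinear_bounded_on_eqI[OF clinear_join(2)[OF hgF, unfolded past_eq] _ _
          a[unfolded past_eq]])
      show "clinear_bounded_on (closed_cspan (expv ` {f \<in> L2. \<forall>q\<ge>r. f q = 0}))
          (norm (expv g) * norm (expv h)) (\<lambda>a. join s (join r a (expv h)) (expv g))"
        by (rule clinear_bounded_on_comp[OF clinear_join(2)[OF hF] clinear_join(2)[OF gF],
              unfolded past_eq[of r]])
          (use h_past h in \<open>auto simp: past_eq[of r]\<close>)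
      fix x assume "x \<in> expv ` {f \<in> L2. \<forall>q\<ge>r. f q = 0}"
      then obtain f where f: "f \<in> L2" "\<And>q. r \<le> q \<Longrightarrow> f q = 0" "x = expv f" by blast
      have fh: "(\<lambda>q. f q + h q) \<in> L2" "\<And>q. s \<le> q \<Longrightarrow> f q + h q = 0"
        using f h rs by (auto intro: add_in_L2)
      have "join r x (expv (\<lambda>q. h q + g q)) = expv (\<lambda>q. f q + (h q + g q))"
        unfolding f(3) by (rule join_expv[OF f(1,2) hg])
      moreover have "join r x (expv h) = expv (\<lambda>q. f q + h q)"
        unfolding f(3) by (rule join_expv[OF f(1,2) h(1,2)])
      moreover have "join s (expv (\<lambda>q. f q + h q)) (expv g) = expv (\<lambda>q. f q + h q + g q)"
        by (rule join_expv[OF fh g])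
      ultimately show "join r x (expv (\<lambda>q. h q + g q)) = join s (join r x (expv h)) (expv g)"
        by (simp add: add.assoc)
    qed
  qed
  \<comment> \<open>\<open>f\<close> is cut at \<open>r\<close> into \<open>k\<close> and
    \<open>h\<close>, so that \<open>R\<close> meets \<open>expv k\<close> only;
    \<open>assoc\<close> then moves \<open>h\<close> from the future of \<open>r\<close> back to the
    past of \<open>s\<close>.\<close>
  have gen: "R (expv f) \<in> past s \<and> R (join s (expv f) (expv g)) = join s (R (expv f)) (expv g)"
    if f: "f \<in> L2" "\<And>q. s \<le> q \<Longrightarrow> f q = 0" and g: "g \<in> L2" "\<And>q. q < s \<Longrightarrow> g q = 0" for f g
  proof -
    define k where "k = cut {..<r} f"
    define h where "h = cut {r..} f"
    have k: "k \<in> L2" "\<And>q. r \<le> q \<Longrightarrow> k q = 0"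
      unfolding k_def using f by (auto simp: cut_in_L2) (auto simp: cut_def)
    have h: "h \<in> L2" "\<And>q. q < r \<Longrightarrow> h q = 0" "\<And>q. s \<le> q \<Longrightarrow> h q = 0"
      unfolding h_def using f by (auto simp: cut_in_L2) (auto simp: cut_def)
    have kP: "expv k \<in> past r" by (rule expv_in_past[OF k])
    have hF: "expv h \<in> future r" by (rule expv_in_future[OF h(1,2)])
    have hg: "(\<lambda>q. h q + g q) \<in> L2" "\<And>q. q < r \<Longrightarrow> h q + g q = 0"
      using h g rs by (auto intro: add_in_L2)
    have fk: "f = (\<lambda>q. k q + h q)" by (auto simp: k_def h_def cut_def)
    have hgF: "expv (\<lambda>q. h q + g q) \<in> future r" by (rule expv_in_future[OF hg])
    have kh: "join r (expv k) (expv h) = expv (\<lambda>q. k q + h q)" by (rule join_expv[OF k h(1,2)])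
    then have Rf: "R (expv f) = join r (R (expv k)) (expv h)"
      using past_opD(3)[OF R kP hF] fk by simp
    have "join s (expv f) (expv g) = expv (\<lambda>q. f q + g q)" by (rule join_expv[OF f g])
    also have "(\<lambda>q. f q + g q) = (\<lambda>q. k q + (h q + g q))" by (subst fk) (simp add: add.assoc)
    also have "expv \<dots> = join r (expv k) (expv (\<lambda>q. h q + g q))" by (rule join_expv[OF k hg, symmetric])
    finally have "R (join s (expv f) (expv g)) = join r (R (expv k)) (expv (\<lambda>q. h q + g q))"
      using past_opD(3)[OF R kP hgF] by simp
    also have "\<dots> = join s (R (expv f)) (expv g)"
      unfolding Rf by (rule assoc[OF past_opD(2)[OF R kP] h g])
    finally show ?thesis using h_past[OF past_opD(2)[OF R kP] h] Rf by simp
  qed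
  have RP: "R x \<in> past s" if "x \<in> past s" for x
    by (rule clinear_bounded_on_range[OF KR closed_csubspace_past _ that[unfolded past_eq]])
      (use gen[OF _ _ zero_in_L2] in auto)
  have 1: "R (join s x (expv g)) = join s (R x) (expv g)"
    if x: "x \<in> past s" and g: "g \<in> L2" "\<And>q. q < s \<Longrightarrow> g q = 0" for x g
  proof -
    have gF: "expv g \<in> future s" by (rule expv_in_future[OF g])
    note lin = clinear_join(2)[OF gF]
    show ?thesis
      by (rule clinear_bounded_on_eqI[OF
            clinear_bounded_on_comp[OF lin K(1) _ K(2), unfolded past_eq]
            clinear_bounded_on_comp[OF KR lin RP norm_ge_zero, unfolded past_eq] _ x[unfolded past_eq]])
        (use gen g in auto)
  qed
  have "R (join s x y) = join s (R x) y" if x: "x \<in> past s" and y: "y \<in> future s" for x y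
    by (rule clinear_bounded_on_eqI[OF
          clinear_bounded_on_comp[OF clinear_join(1)[OF x] K(1) _ K(2), unfolded future_eq]
          clinear_join(1)[OF RP[OF x], unfolded future_eq] _ y[unfolded future_eq]])
      (use 1 x in auto)
  then show ?thesis using RP past_opD(1)[OF R] by (simp add: past_op_def)
qed


subsection \<open>Isometric cocycles\<close>

lemma vn_tensor_bounded: "A \<in> vn_tensor N K \<Longrightarrow> A \<in> bounded_ops (ampl_space K)"
  by (simp add: vn_tensor_def ultraweak_closure_def)

lemma past_tensor_exists:
  assumes A: "A \<in> bounded_ops (hpast s)" "clinear_bounded_on (hpast s) K A" "0 \<le> K"
    and Q: "clinear_bounded_on (future s) 1 Q" "\<And>y. y \<in> future s \<Longrightarrow> Q y \<in> future s"
  shows "past_tensor s A Q \<in> bounded_ops UNIV \<and> clinear_bounded_on UNIV K (past_tensor s A Q)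
    \<and> (\<forall>z\<in>hpast s. \<forall>y\<in>future s. past_tensor s A Q (hpast_join s z y) = hpast_join s (A z) (Q y))"
  using op_tensor_exists[OF hpast_join_tensor closed_csubspace_ampl_space closed_csubspace_future
      A(2) _ A(3) Q(1) Q(2)] A(1)
  by (simp add: past_tensor_def bounded_ops_iff)

lemma past_part_eqI:
  assumes p: "orthogonal_projection p" and A: "A \<in> bounded_ops (hpast s)"
    and X: "X = past_tensor s A (second_quant p s)"
  shows "past_part p s X = A"
  unfolding past_part_def
proof (rule the_equality)
  note Q = second_quant_exists[OF p, of s]
  let ?\<Omega> = "expv (\<lambda>r. 0)"
  have "p 0 = 0" by (rule clinear_bounded_on_zero_arg[OF orthogonal_projectionD(3)[OF p]]) simp
  then have Q\<Omega>: "second_quant p s ?\<Omega> = ?\<Omega>" using Q zero_in_L2 by auto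
  have \<Omega>: "?\<Omega> \<in> future s" "?\<Omega> \<noteq> 0" by (simp_all add: expv_in_future expv_nonzero zero_in_L2)
  fix B assume B: "B \<in> bounded_ops (hpast s) \<and> X = past_tensor s B (second_quant p s)"
  show "B = A"
  proof
    fix z show "B z = A z"
    proof (cases "z \<in> hpast s")
      case True
      have eval: "past_tensor s C (second_quant p s) (hpast_join s z ?\<Omega>) = hpast_join s (C z) ?\<Omega>
          \<and> C z \<in> hpast s"
        if C: "C \<in> bounded_ops (hpast s)" for C
      proof -
        obtain K where "0 \<le> K" "clinear_bounded_on (hpast s) K C"
          using C clinear_bounded_on_nonneg unfolding bounded_ops_iff by metis
        then show ?thesis using past_tensor_exists[of C s K "second_quant p s"] Q C True \<Omega> Q\<Omega>
          by (auto simp: bounded_ops_iff)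
      qed
      have Bz: "B z \<in> hpast s" and Az: "A z \<in> hpast s" using eval A B by blast+
      have "hpast_join s (B z) ?\<Omega> = hpast_join s (A z) ?\<Omega>" using eval A B X by metis
      then have "hpast_join s (B z - A z) ?\<Omega> = 0"
        using clinear_bounded_on_minus_arg[OF clinear_hpast_join(2)[OF \<Omega>(1)] closed_csubspace_ampl_space Bz Az]
        by simp
      then have "norm (B z - A z) * norm ?\<Omega> = 0"
        using hilbert_tensor_norm[OF hpast_join_tensor
            closed_csubspaceD(4)[OF closed_csubspace_ampl_space Bz Az] \<Omega>(1)] by simp
      then show ?thesis using \<Omega>(2) by simp
    qed (use A B in \<open>simp add: bounded_ops_iff\<close>)
  qed
qed (use A X in blast)

definition future_projection :: "('k \<Rightarrow> 'k) \<Rightarrow> real \<Rightarrow> 'hf \<Rightarrow> 'hf" where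
  "future_projection p s = past_tensor s (id_op (hpast s)) (second_quant p s)"

text \<open>As \<open>V s = A \<otimes> P\<close> with \<open>A\<close> isometric, it is the
  isometry \<open>hat p V s = A \<otimes> I\<close> applied after the contraction
  \<open>I \<otimes> P\<close>.\<close>

lemma cocycle_factorisation:
  assumes p: "orthogonal_projection p" and V: "adapted_process p M V" "isometric p V" and s: "0 \<le> s"
  shows "hat p V s \<in> bounded_ops UNIV" "cinner (hat p V s x) (hat p V s y) = cinner x y"
    "V s z = hat p V s (future_projection p s z)" "norm (future_projection p s z) \<le> norm z"
proof -
  let ?Q = "second_quant p s"
  have Q: "clinear_bounded_on (future s) 1 ?Q" "\<And>y. y \<in> future s \<Longrightarrow> ?Q y \<in> future s"
    using second_quant_exists[OF p, of s] by auto
  obtain A where A: "A \<in> bounded_ops (hpast s)" and VA: "V s = past_tensor s A ?Q"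
    using V(1) s vn_tensor_bounded unfolding adapted_process_def by blast
  have part: "past_part p s (V s) = A" by (rule past_part_eqI[OF p A VA])
  obtain K where K: "0 \<le> K" "clinear_bounded_on (hpast s) K A"
    using A clinear_bounded_on_nonneg unfolding bounded_ops_iff by metis
  have AH: "A z \<in> hpast s" if "z \<in> hpast s" for z using A that by (simp add: bounded_ops_iff)
  have adj: "cinner (adjoint_op (hpast s) A x) y = cinner x (A y)" if "x \<in> hpast s" "y \<in> hpast s" for x y
    using adjoint_op_exists[OF closed_csubspace_ampl_space K(2) AH] that by blast
  have "adjoint_op (hpast s) A \<circ> A = id_op (hpast s)"
    using V(2) s part unfolding isometric_def Let_def by metis
  then have AA: "cinner (A x) (A y) = cinner x y" if "x \<in> hpast s" "y \<in> hpast s" for x y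
    using adj[OF AH[OF that(1)] that(2)] that(1) by (simp add: fun_eq_iff id_op_def)
  have id_future: "clinear_bounded_on (future s) 1 (id_op (future s))" by (simp add: id_op_clinear)
  have id_past: "clinear_bounded_on (hpast s) 1 (id_op (hpast s))" by (simp add: id_op_clinear)
  have id_pastb: "id_op (hpast s) \<in> bounded_ops (hpast s)"
    using id_past by (auto simp: bounded_ops_iff id_op_def)
  have hat: "hat p V s \<in> bounded_ops UNIV" "clinear_bounded_on UNIV K (hat p V s)"
    "\<And>z y. z \<in> hpast s \<Longrightarrow> y \<in> future s \<Longrightarrow> hat p V s (hpast_join s z y) = hpast_join s (A z) y"
    using past_tensor_exists[OF A K(2,1) id_future] unfolding hat_def part by (auto simp: id_op_def)
  have P: "future_projection p s \<in> bounded_ops UNIV" "clinear_bounded_on UNIV 1 (future_projection p s)"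
    "\<And>z y. z \<in> hpast s \<Longrightarrow> y \<in> future s \<Longrightarrow> future_projection p s (hpast_join s z y) = hpast_join s z (?Q y)"
    using past_tensor_exists[OF id_pastb id_past _ Q] unfolding future_projection_def
    by (auto simp: id_op_def)
  have Vb: "V s \<in> bounded_ops UNIV"
    "\<And>z y. z \<in> hpast s \<Longrightarrow> y \<in> future s \<Longrightarrow> V s (hpast_join s z y) = hpast_join s (A z) (?Q y)"
    using past_tensor_exists[OF A K(2,1) Q] unfolding VA by auto
  show "hat p V s \<in> bounded_ops UNIV" by (rule hat(1))
  show "norm (future_projection p s z) \<le> norm z" using clinear_bounded_onD(3)[OF P(2)] by simp
  show "V s z = hat p V s (future_projection p s z)"
    by (rule hilbert_tensor_eqI[OF hpast_join_tensor[of s] Vb(1) bounded_ops_UNIV_comp[OF hat(1) P(1)]])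
      (simp add: hat P Vb Q)
  have tot: "closed_cspan {hpast_join s a b | a b. a \<in> hpast s \<and> b \<in> future s} = UNIV"
    using hilbert_tensorD(2)[OF hpast_join_tensor] by simp
  show "cinner (hat p V s x) (hat p V s y) = cinner x y"
    by (rule cinner_eq_on_closed_cspan[where X = "{hpast_join s a b | a b. a \<in> hpast s \<and> b \<in> future s}"
          and Y = "{hpast_join s a b | a b. a \<in> hpast s \<and> b \<in> future s}", unfolded tot,
          OF hat(2) hat(2) clinear_bounded_on_id clinear_bounded_on_id])
      (auto simp: hat(3) hilbert_tensorD(1)[OF hpast_join_tensor] AA AH)
qed

text \<open>The ampliation of \<open>Gamma s\<close> has its range in \<open>hfuture s\<close>, so
  conjugation with it preserves that space, and the flow leaves the factor \<open>past s\<close>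
  fixed.\<close>

lemma future_op_flow:
  assumes X: "X \<in> bounded_ops UNIV" and s: "0 \<le> s"
  shows "future_op s (flow s X)"
proof -
  have G: "ampl (Gamma s) \<in> bounded_ops UNIV" by (rule ampl_bounded[OF Gamma_exists(1)[OF s]])
  then obtain K where K: "clinear_bounded_on UNIV K (ampl (Gamma s))"
    unfolding bounded_ops_UNIV_iff by blast
  have GF: "ampl (Gamma s) z \<in> hfuture s" for z
  proof (rule clinear_bounded_on_range[of "{tens u (expv f) | u f. f \<in> L2}" K "ampl (Gamma s)" "hfuture s" z])
    fix x assume "x \<in> {tens u (expv f) | u f. f \<in> L2}"
    then obtain u f where f: "f \<in> L2" "x = tens u (expv f)" by blast
    have "expv (shift s f) \<in> future s"
      by (rule expv_in_future[OF shift_in_L2[OF f(1) s]]) (simp add: shift_def)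
    then show "ampl (Gamma s) x \<in> hfuture s"
      by (simp add: f ampl_tens Gamma_exists[OF s] tens_in_ampl_space)
  qed (simp_all add: tens_expv_total K)
  let ?Y = "ampl (Gamma s) \<circ> X \<circ> adjoint_op UNIV (ampl (Gamma s))"
  have "(\<lambda>z. ampl (Gamma s) (X (adjoint_op UNIV (ampl (Gamma s)) z))) \<in> bounded_ops UNIV"
    by (rule bounded_ops_UNIV_comp[OF G bounded_ops_UNIV_comp[OF X adjoint_op_UNIV(1)[OF G]]])
  then have "?Y \<in> bounded_ops UNIV" by (simp add: comp_def)
  then obtain L where L: "0 \<le> L" "clinear_bounded_on UNIV L ?Y"
    using clinear_bounded_on_nonneg unfolding bounded_ops_UNIV_iff by metis
  have "flow s X \<in> bounded_ops UNIV \<and> (\<forall>x\<in>past s. \<forall>w\<in>hfuture s.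
      flow s X (hfuture_join s x w) = hfuture_join s (id_op (past s) x) (?Y w))"
    using op_tensor_exists[OF hfuture_join_tensor closed_csubspace_past closed_csubspace_ampl_space
        id_op_clinear[OF closed_csubspace_past] _ _ clinear_bounded_on_mono[OF L(2) order_refl subset_UNIV] _ L(1)]
      GF unfolding flow_def by (simp add: id_op_def)
  then show ?thesis
    unfolding future_op_def by (intro conjI exI[of _ ?Y]) (use GF in \<open>auto simp: id_op_def\<close>)
qed

lemma adapted_process_bounded: "adapted_process p M V \<Longrightarrow> 0 \<le> s \<Longrightarrow> V s \<in> bounded_ops UNIV"
proof -
  assume "adapted_process p M V" "0 \<le> s"
  then have "V s \<in> bounded_ops (ampl_space UNIV)"
    unfolding adapted_process_def by (blast intro: vn_tensor_bounded)
  moreover have "ampl_space UNIV = UNIV"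
    using tens_total by (simp add: ampl_space_def)
  ultimately show ?thesis by simp
qed

text \<open>The cocycle identity at \<open>a = s + (a - s)\<close>. The left factor is the same for
  all \<open>a\<close> beyond \<open>s\<close>, which makes two such times comparable.\<close>

lemma cocycle_future_op:
  assumes V: "cocycle p M V" and s: "0 \<le> s" "s \<le> a"
  obtains Y where "future_op s Y" "\<And>z. V a z = hat p V s (Y z)"
proof
  have "V (s + (a - s)) = hat p V s \<circ> flow s (V (a - s))"
    using V s unfolding cocycle_def by (metis diff_ge_0_iff_ge)
  then show "V a z = hat p V s (flow s (V (a - s)) z)" for z by simp
  show "future_op s (flow s (V (a - s)))"
    by (rule future_op_flow[OF adapted_process_bounded]) (use V s in \<open>auto simp: cocycle_def\<close>)
qed

end

locale isometric_cocycle = ampliated_fock expv tens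
  for expv :: "(real \<Rightarrow> 'k::complex_hilbert) \<Rightarrow> 'f::complex_hilbert"
    and tens :: "'h::complex_hilbert \<Rightarrow> 'f \<Rightarrow> 'hf::complex_hilbert" +
  fixes p :: "'k \<Rightarrow> 'k" and M :: "('h \<Rightarrow> 'h) set" and V :: "real \<Rightarrow> 'hf \<Rightarrow> 'hf"
  assumes p: "orthogonal_projection p" and V: "cocycle p M V" and iso: "isometric p V"
begin

lemma adapted: "adapted_process p M V"
  using V by (simp add: cocycle_def)

lemmas V_bounded = adapted_process_bounded[OF adapted]
lemmas factorisation = cocycle_factorisation[OF p adapted iso]

lemma norm_hat: "0 \<le> s \<Longrightarrow> norm (hat p V s z) = norm z"
proof -
  assume "0 \<le> s"
  then have "complex_of_real ((norm (hat p V s z))\<^sup>2) = complex_of_real ((norm z)\<^sup>2)"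
    unfolding cinner_self[symmetric] by (rule factorisation(2))
  then show ?thesis unfolding of_real_eq_iff by (simp add: power2_eq_iff_nonneg)
qed

lemma V_contraction: "0 \<le> s \<Longrightarrow> norm (V s z) \<le> norm z"
  using factorisation(3,4) norm_hat by metis

text \<open>The common isometry at time \<open>c\<close> disappears from the inner product. What
  remains acts on the future, so the self-adjoint \<open>ampl R\<close> passes through both
  operators and falls on \<open>w\<close>, which it annihilates.\<close>

lemma V_orthogonal:
  assumes R: "past_op c R" "\<And>x y. cinner (ampl R x) y = cinner x (ampl R y)"
    and c: "0 \<le> c" "c \<le> a" "c \<le> b" and w: "ampl R w = 0"
  shows "cinner (V a (ampl R z)) (V b w) = 0"
proof -
  obtain Y where Y: "future_op c Y" "\<And>z. V a z = hat p V c (Y z)"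
    using cocycle_future_op[OF V c(1,2)] by blast
  obtain Z where Z: "future_op c Z" "\<And>z. V b z = hat p V c (Z z)"
    using cocycle_future_op[OF V c(1,3)] by blast
  obtain L where L: "clinear_bounded_on UNIV L Z"
    using Z(1) unfolding future_op_def bounded_ops_UNIV_iff by blast
  have "cinner (V a (ampl R z)) (V b w) = cinner (ampl R (Y z)) (Z w)"
    by (simp add: Y(2) Z(2) factorisation(2)[OF c(1)] past_op_future_op_commute[OF R(1) Y(1)])
  also have "\<dots> = cinner (Y z) (Z (ampl R w))"
    by (simp add: R(2) past_op_future_op_commute[OF R(1) Z(1)])
  also have "\<dots> = 0" by (simp add: w clinear_bounded_on_zero_arg[OF L])
  finally show ?thesis .
qed

text \<open>Up to the common isometry at \<open>s\<close>, the increment is a difference of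
  operators on the future, for which norms factorise on exponential vectors.\<close>

lemma norm_increment_past_op:
  assumes R: "past_op s R" and s: "0 \<le> s" "s \<le> a" "s \<le> b" and f: "f \<in> L2"
  shows "norm (V a (ampl R (tens u (expv f))) - V b (ampl R (tens u (expv f)))) * norm (expv f)
    = norm (R (expv f)) * norm (V a (tens u (expv f)) - V b (tens u (expv f)))"
proof -
  obtain Y where Y: "future_op s Y" "\<And>z. V a z = hat p V s (Y z)"
    using cocycle_future_op[OF V s(1,2)] by blast
  obtain Z where Z: "future_op s Z" "\<And>z. V b z = hat p V s (Z z)"
    using cocycle_future_op[OF V s(1,3)] by blast
  obtain K where K: "clinear_bounded_on UNIV K (hat p V s)"
    using factorisation(1)[OF s(1)] unfolding bounded_ops_UNIV_iff by blast
  have "V a z - V b z = hat p V s (Y z - Z z)" for z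
    by (simp add: Y(2) Z(2) clinear_bounded_on_minus_arg[OF K])
  then have "norm (V a z - V b z) = norm (Y z - Z z)" for z by (simp add: norm_hat[OF s(1)])
  then show ?thesis using norm_future_op_past_op[OF R future_op_diff[OF Y(1) Z(1)] f] by simp
qed

end

subsection \<open>Partitions and limits along refinement\<close>

text \<open>The net is followed along finite unions of the witnesses for
  \<open>inverse (Suc n)\<close>. Every refinement of a witness stays close to it, so the limit
  along this sequence is the limit of the net.\<close>

lemma refinement_Cauchy_convergent:
  fixes F :: "real set \<Rightarrow> 'a::banach"
  assumes t: "0 \<le> t"
    and C: "\<And>e. 0 < e \<Longrightarrow> \<exists>\<pi>\<^sub>0\<in>partitions t. \<forall>\<pi>\<in>partitions t. \<pi>\<^sub>0 \<subseteq> \<pi> \<longrightarrow> norm (F \<pi>\<^sub>0 - F \<pi>) < e"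
  shows "\<exists>l. (F \<longlongrightarrow> l) (refinement_filter t)"
proof -
  have "\<exists>\<pi>\<^sub>0. \<pi>\<^sub>0 \<in> partitions t \<and> (\<forall>\<pi>\<in>partitions t. \<pi>\<^sub>0 \<subseteq> \<pi> \<longrightarrow> norm (F \<pi>\<^sub>0 - F \<pi>) < inverse (Suc n))" for n
    using C[of "inverse (Suc n)"] by auto
  then obtain G where G: "\<And>n. G n \<in> partitions t"
    "\<And>n \<pi>. \<pi> \<in> partitions t \<Longrightarrow> G n \<subseteq> \<pi> \<Longrightarrow> norm (F (G n) - F \<pi>) < inverse (Suc n)"
    by metis
  define U where "U n = (\<Union>i\<le>n. G i)" for n
  have U: "U n \<in> partitions t" for n using G(1) unfolding U_def partitions_def by fastforce
  have GU: "norm (F (G n) - F (U m)) < inverse (Suc n)" if "n \<le> m" for n m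
    by (rule G(2)[OF U]) (use that in \<open>auto simp: U_def\<close>)
  have "Cauchy (\<lambda>n. F (U n))"
  proof (rule CauchyI)
    fix e :: real assume "0 < e"
    then obtain N where N: "inverse (Suc N) < e / 2" using reals_Archimedean[of "e / 2"] by auto
    have "norm (F (U m) - F (U n)) < e" if "N \<le> m" "N \<le> n" for m n
      using norm_triangle_ineq4[of "F (G N) - F (U n)" "F (G N) - F (U m)"]
        GU[OF that(1)] GU[OF that(2)] N by simp
    then show "\<exists>N. \<forall>m\<ge>N. \<forall>n\<ge>N. norm (F (U m) - F (U n)) < e" by blast
  qed
  then obtain l where l: "(\<lambda>n. F (U n)) \<longlonglongrightarrow> l" using Cauchy_convergent_iff convergent_def by blast
  have Gl: "norm (F (G n) - l) \<le> inverse (Suc n)" for n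
  proof (rule LIMSEQ_le_const2)
    show "(\<lambda>m. norm (F (G n) - F (U m))) \<longlonglongrightarrow> norm (F (G n) - l)" by (intro tendsto_intros l)
    show "\<exists>N. \<forall>m\<ge>N. norm (F (G n) - F (U m)) \<le> inverse (Suc n)"
      using GU by (meson less_imp_le)
  qed
  have "(F \<longlongrightarrow> l) (refinement_filter t)"
  proof (rule tendstoI)
    fix e :: real assume "0 < e"
    then obtain N where N: "inverse (Suc N) < e / 2" using reals_Archimedean[of "e / 2"] by auto
    have "dist (F \<pi>) l < e" if "\<pi> \<in> partitions t" "G N \<subseteq> \<pi>" for \<pi>
      using norm_triangle_ineq4[of "F (G N) - l" "F (G N) - F \<pi>"] G(2)[OF that] Gl[of N] N
      by (simp add: dist_norm)
    then show "\<forall>\<^sub>F \<pi> in refinement_filter t. dist (F \<pi>) l < e"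
      using G(1) by (auto simp: eventually_refinement_filter[OF t])
  qed
  then show ?thesis by blast
qed

lemma eventually_partitions: "0 \<le> t \<Longrightarrow> \<forall>\<^sub>F \<pi> in refinement_filter t. \<pi> \<in> partitions t"
proof -
  assume t: "0 \<le> t"
  then have "{0, t} \<in> partitions t" by (simp add: partitions_def)
  then show ?thesis unfolding eventually_refinement_filter[OF t] by blast
qed

section \<open>Enumeration of the points of a partition\<close>

lemma partition_pt_in:
  assumes "\<pi> \<in> partitions t" "i < card \<pi>"
  shows "partition_pt \<pi> i \<in> \<pi>"
proof -
  have "finite \<pi>" using assms(1) by (simp add: partitions_def)
  then show ?thesis
    using nth_mem[of i "sorted_list_of_set \<pi>"] assms(2) by (simp add: partition_pt_def)
qed

lemma partition_pt_bounds:
  assumes "\<pi> \<in> partitions t" "i < card \<pi>"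
  shows "0 \<le> partition_pt \<pi> i" "partition_pt \<pi> i \<le> t"
  using partition_pt_in[OF assms] assms(1) by (auto simp: partitions_def)

lemma partition_pt_less:
  assumes "\<pi> \<in> partitions t" "i < j" "j < card \<pi>"
  shows "partition_pt \<pi> i < partition_pt \<pi> j"
  using sorted_wrt_nth_less[OF strict_sorted_list_of_set[of \<pi>] assms(2)] assms
  by (simp add: partition_pt_def partitions_def)

lemma partition_pt_le:
  assumes "\<pi> \<in> partitions t" "i \<le> j" "j < card \<pi>"
  shows "partition_pt \<pi> i \<le> partition_pt \<pi> j"
  using partition_pt_less[OF assms(1) _ assms(3), of i] assms(2) by (cases "i = j") auto

lemma partition_pt_surj:
  assumes "\<pi> \<in> partitions t" "q \<in> \<pi>"
  obtains i where "i < card \<pi>" "partition_pt \<pi> i = q"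
  using assms by (metis (no_types, lifting) in_set_conv_nth length_sorted_list_of_set mem_Collect_eq
      partition_pt_def partitions_def set_sorted_list_of_set)

lemma partition_pt_first:
  assumes "\<pi> \<in> partitions t"
  shows "partition_pt \<pi> 0 = 0"
proof -
  have "0 \<in> \<pi>" using assms by (simp add: partitions_def)
  then obtain i where i: "i < card \<pi>" "partition_pt \<pi> i = 0" using partition_pt_surj[OF assms] by blast
  then have "partition_pt \<pi> 0 \<le> 0" using partition_pt_le[OF assms, of 0 i] by simp
  moreover have "0 \<le> partition_pt \<pi> 0" using partition_pt_bounds(1)[OF assms, of 0] i(1) by simp
  ultimately show ?thesis by simp
qed

lemma partition_pt_last:
  assumes "\<pi> \<in> partitions t"
  shows "partition_pt \<pi> (card \<pi> - 1) = t"
proof -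
  have "t \<in> \<pi>" using assms by (simp add: partitions_def)
  then obtain i where i: "i < card \<pi>" "partition_pt \<pi> i = t" using partition_pt_surj[OF assms] by blast
  then have "t \<le> partition_pt \<pi> (card \<pi> - 1)" using partition_pt_le[OF assms, of i "card \<pi> - 1"] by simp
  moreover have "partition_pt \<pi> (card \<pi> - 1) \<le> t" using partition_pt_bounds(2)[OF assms] i(1) by simp
  ultimately show ?thesis by simp
qed

text \<open>The index is that of the first coarse point not below the right end of the fine cell.
  The coarse point before it lies strictly below that end and, being a point of
  \<open>\<pi>'\<close>, is at most the left end.\<close>

lemma partition_pt_refine:
  assumes \<pi>: "\<pi> \<in> partitions t" and \<pi>': "\<pi>' \<in> partitions t" "\<pi> \<subseteq> \<pi>'" and k: "1 \<le> k" "k < card \<pi>'"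
  shows "\<exists>j. 1 \<le> j \<and> j < card \<pi> \<and> partition_pt \<pi> (j - 1) \<le> partition_pt \<pi>' (k - 1)
    \<and> partition_pt \<pi>' k \<le> partition_pt \<pi> j"
proof -
  have n: "card \<pi> > 0" using \<pi> by (auto simp: partitions_def card_gt_0_iff)
  define j where "j = (LEAST j. j < card \<pi> \<and> partition_pt \<pi>' k \<le> partition_pt \<pi> j)"
  have "card \<pi> - 1 < card \<pi> \<and> partition_pt \<pi>' k \<le> partition_pt \<pi> (card \<pi> - 1)"
    using n partition_pt_bounds(2)[OF \<pi>'(1) k(2)] partition_pt_last[OF \<pi>] by simp
  then have j: "j < card \<pi> \<and> partition_pt \<pi>' k \<le> partition_pt \<pi> j" unfolding j_def by (rule LeastI)
  \<comment> \<open>The right end is positive, so the least index is not \<open>0\<close> and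
    \<open>j - 1\<close> is a genuine predecessor.\<close>
  have "0 < partition_pt \<pi>' k"
    using partition_pt_less[OF \<pi>'(1) _ k(2), of 0] partition_pt_first[OF \<pi>'(1)] k(1) by simp
  then have j1: "1 \<le> j" using j partition_pt_first[OF \<pi>] by (cases j) auto
  have "\<not> (j - 1 < card \<pi> \<and> partition_pt \<pi>' k \<le> partition_pt \<pi> (j - 1))"
    using j1 not_less_Least[of "j - 1" "\<lambda>j. j < card \<pi> \<and> partition_pt \<pi>' k \<le> partition_pt \<pi> j"]
    unfolding j_def[symmetric] by simp
  then have lt: "partition_pt \<pi> (j - 1) < partition_pt \<pi>' k" using j by auto
  have "partition_pt \<pi> (j - 1) \<in> \<pi>'" using partition_pt_in[OF \<pi>, of "j - 1"] j \<pi>'(2) by auto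
  then obtain i where i: "i < card \<pi>'" "partition_pt \<pi>' i = partition_pt \<pi> (j - 1)"
    using partition_pt_surj[OF \<pi>'(1)] by blast
  have "i < k" using partition_pt_le[OF \<pi>'(1), of k i] lt i by (cases "i < k") auto
  then have "partition_pt \<pi> (j - 1) \<le> partition_pt \<pi>' (k - 1)"
    using partition_pt_le[OF \<pi>'(1), of i "k - 1"] i k by simp
  then show ?thesis using j j1 by blast
qed

text \<open>An equidistant grid of mesh \<open>t / N\<close>. As \<open>partition_pt\<close> is
  defined by sorting, the successor of a point is bounded by the next grid value instead of being
  computed.\<close>

lemma fine_partition:
  assumes t: "0 < t" and e: "0 < e"
  obtains \<pi> where "\<pi> \<in> partitions t"
    "\<And>j. 1 \<le> j \<Longrightarrow> j < card \<pi> \<Longrightarrow> partition_pt \<pi> j - partition_pt \<pi> (j - 1) < e"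
proof -
  obtain N :: nat where N: "t / e < real N" using reals_Archimedean2 by blast
  then have N0: "0 < real N" using t e by (meson divide_pos_pos less_trans)
  have tN: "t / real N < e" using N N0 e by (simp add: field_simps)
  define \<pi> where "\<pi> = (\<lambda>i. t * real i / real N) ` {..N}"
  have "t * real i / real N \<le> t" if "i \<le> N" for i using that t N0 by (simp add: field_simps)
  moreover have "0 \<in> \<pi>" unfolding \<pi>_def by (rule image_eqI[of _ _ 0]) simp_all
  moreover have "t \<in> \<pi>" unfolding \<pi>_def by (rule image_eqI[of _ _ N]) (use N0 in simp_all)
  ultimately have \<pi>: "\<pi> \<in> partitions t" using t by (auto simp: partitions_def \<pi>_def)
  have "partition_pt \<pi> j - partition_pt \<pi> (j - 1) < e" if j: "1 \<le> j" "j < card \<pi>" for j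
  proof -
    have "partition_pt \<pi> (j - 1) \<in> \<pi>" using partition_pt_in[OF \<pi>] j by simp
    then obtain i where i: "i \<le> N" "partition_pt \<pi> (j - 1) = t * real i / real N"
      unfolding \<pi>_def by auto
    have lt: "partition_pt \<pi> (j - 1) < partition_pt \<pi> j" using partition_pt_less[OF \<pi> _ j(2), of "j - 1"] j by simp
    \<comment> \<open>At \<open>i = N\<close> the point would already be \<open>t\<close>, with no
      partition point after it.\<close>
    have "i \<noteq> N"
    proof
      assume "i = N"
      then show False using i lt partition_pt_bounds(2)[OF \<pi> j(2)] N0 by simp
    qed
    then have "Suc i \<le> N" using i by simp
    then have "t * real (Suc i) / real N \<in> \<pi>" unfolding \<pi>_def by (intro imageI) simp
    then obtain k where k: "k < card \<pi>" "partition_pt \<pi> k = t * real (Suc i) / real N"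
      using partition_pt_surj[OF \<pi>] by blast
    have step: "t * real (Suc i) / real N = partition_pt \<pi> (j - 1) + t / real N"
      unfolding i by (simp add: distrib_left add_divide_distrib)
    have "0 < t / real N" using t N0 by simp
    then have "j - 1 < k"
      using partition_pt_le[OF \<pi>, of k "j - 1"] k(2) step less_imp_diff_less[OF j(2), of 1]
      by (cases "j - 1 < k") auto
    then have "partition_pt \<pi> j \<le> partition_pt \<pi> k" using partition_pt_le[OF \<pi> _ k(1), of j] by simp
    then show ?thesis using k(2) step tN by simp
  qed
  with \<pi> show ?thesis by (rule that)
qed


subsection \<open>Quantum stop times\<close>

locale stop_time = ampliated_fock expv tens
  for expv :: "(real \<Rightarrow> 'k::complex_hilbert) \<Rightarrow> 'f::complex_hilbert"
    and tens :: "'h::complex_hilbert \<Rightarrow> 'f \<Rightarrow> 'hf::complex_hilbert" +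
  fixes S :: "ennreal set \<Rightarrow> 'f \<Rightarrow> 'f"
  assumes S: "finite_stop_time S"
begin

lemma S_projection: "A \<in> sets borel \<Longrightarrow> orthogonal_projection (S A)"
  using S by (simp add: finite_stop_time_def)

lemma S_sums: "range A \<subseteq> sets borel \<Longrightarrow> disjoint_family A \<Longrightarrow>
    (\<lambda>n. cinner x (S (A n) y)) sums cinner x (S (\<Union>n. A n) y)" for A :: "nat \<Rightarrow> ennreal set"
  using S by (simp add: finite_stop_time_def)

lemmas S_D = orthogonal_projectionD[OF S_projection]

lemma S_bounded: "A \<in> sets borel \<Longrightarrow> S A \<in> bounded_ops UNIV"
  using S_projection by (simp add: orthogonal_projection_def)

text \<open>Countable additivity over copies of the empty set makes a constant series converge, so
  its term is zero.\<close>

lemma S_empty: "S {} x = 0"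
proof -
  let ?c = "cinner (S {} x) (S {} x)"
  have "(\<lambda>n. ?c) sums ?c" using S_sums[of "\<lambda>_. {}" "S {} x" x] by (simp add: disjoint_family_on_def)
  then have "(\<lambda>n::nat. ?c) \<longlonglongrightarrow> 0" using summable_LIMSEQ_zero sums_summable by blast
  then have "?c = 0" by (simp add: LIMSEQ_const_iff)
  then show ?thesis by (simp add: cinner_eq_zero_iff)
qed

text \<open>Countable additivity for the sequence that continues \<open>A\<close>, \<open>B\<close>
  by empty sets.\<close>

lemma S_Un:
  assumes A: "A \<in> sets borel" "B \<in> sets borel" "A \<inter> B = {}"
  shows "S (A \<union> B) x = S A x + S B x"
proof (rule cinner_ext)
  fix w
  define C where "C n = (if n = 0 then A else if n = 1 then B else {})" for n :: nat
  have "range C \<subseteq> sets borel" "disjoint_family C"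
    using A by (auto simp: C_def disjoint_family_on_def)
  then have "(\<lambda>n. cinner w (S (C n) x)) sums cinner w (S (\<Union>n. C n) x)" by (rule S_sums)
  moreover have "(\<lambda>n. cinner w (S (C n) x)) sums (\<Sum>n\<in>{0, 1}. cinner w (S (C n) x))"
    by (rule sums_finite) (auto simp: C_def S_empty)
  moreover have "(\<Union>n. C n) = A \<union> B" by (auto simp: C_def split: if_splits)
  ultimately have "cinner w (S (A \<union> B) x) = (\<Sum>n\<in>{0, 1}. cinner w (S (C n) x))"
    using sums_unique2 by metis
  then show "cinner w (S (A \<union> B) x) = cinner w (S A x + S B x)"
    by (simp add: C_def cinner_add_right)
qed

text \<open>If \<open>P\<close>, \<open>Q\<close> and \<open>P + Q\<close> are idempotent then \<open>PQ = - QP\<close>, so \<open>PQ = - PQP = QP\<close> and both vanish.\<close>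

lemma S_disjoint:
  assumes A: "A \<in> sets borel" "B \<in> sets borel" "A \<inter> B = {}"
  shows "S A (S B x) = 0"
proof -
  have lin: "S C (y + z) = S C y + S C z" if "C \<in> sets borel" for C y z
    using clinear_bounded_onD(1)[OF S_D(3)[OF that]] by simp
  have neg: "S C (- z) = - S C z" if "C \<in> sets borel" for C z
    using clinear_bounded_on_minus_arg[OF S_D(3)[OF that], of 0 z]
      clinear_bounded_on_zero_arg[OF S_D(3)[OF that]] by simp
  have AB: "A \<union> B \<in> sets borel" using A by auto
  have anti: "S A (S B y) = - S B (S A y)" for y
    using S_D(1)[OF AB, of y] unfolding S_Un[OF A] lin[OF A(1)] lin[OF A(2)] S_D(1)[OF A(1)] S_D(1)[OF A(2)]
    by (simp add: algebra_simps eq_neg_iff_add_eq_0)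
  have "S A (S B x) = S A (S A (S B x))" by (simp add: S_D(1)[OF A(1)])
  also have "\<dots> = - S A (S B (S A x))" using anti[of x] neg[OF A(1)] by simp
  also have "\<dots> = S B (S A x)" using anti[of "S A x"] by (simp add: S_D(1)[OF A(1)])
  also have "\<dots> = - S A (S B x)" using anti[of x] by simp
  finally have "2 *\<^sub>R S A (S B x) = 0" by (metis scaleR_2 add.right_inverse)
  then show ?thesis by simp
qed

lemma S_subset:
  assumes A: "A \<in> sets borel" "B \<in> sets borel" "A \<subseteq> B"
  shows "S A (S B x) = S A x" "S B (S A x) = S A x"
proof -
  have BA: "B - A \<in> sets borel" using A by auto
  have B: "S B y = S A y + S (B - A) y" for y
    using S_Un[OF A(1) BA, of y] A(3) by (simp add: Un_absorb1)
  have "S A (S A x + S (B - A) x) = S A (S A x) + S A (S (B - A) x)"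
    using clinear_bounded_onD(1)[OF S_D(3)[OF A(1)]] by simp
  then show "S A (S B x) = S A x"
    unfolding B using S_disjoint[OF A(1) BA] S_D(1)[OF A(1)] by simp
  show "S B (S A x) = S A x"
    unfolding B using S_disjoint[OF BA A(1)] S_D(1)[OF A(1)] by (simp add: Int_commute)
qed

lemma S_zero: "S {0} x = 0"
  using S by (simp add: finite_stop_time_def)

lemma interval_Un:
  assumes "0 \<le> a" "a \<le> b"
  shows "{0..ennreal b} = {0..ennreal a} \<union> {ennreal a<..ennreal b}" "{0..ennreal a} \<inter> {ennreal a<..ennreal b} = {}"
  using ennreal_leI[OF assms(2)] by auto

text \<open>Adaptedness speaks of initial intervals; the cells of a partition are reached as
  differences of these.\<close>

lemma S_interval:
  assumes "0 \<le> a" "a \<le> b"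
  shows "S {ennreal a<..ennreal b} x = S {0..ennreal b} x - S {0..ennreal a} x"
  using S_Un[of "{0..ennreal a}" "{ennreal a<..ennreal b}" x] interval_Un[OF assms] by simp

text \<open>Adaptedness provides some \<open>X\<close> on the past; evaluating at vectors tensored
  with the vacuum identifies \<open>X\<close> as the restriction of the projection itself, which is
  the form of \<open>past_op\<close>.\<close>

lemma past_op_S_atMost:
  assumes r: "0 \<le> r"
  shows "past_op r (S {0..ennreal r})"
proof (cases "r = 0")
  case True
  \<comment> \<open>Adaptedness is given for positive times; at time \<open>0\<close> the condition
    \<open>S {0} = 0\<close> takes its place.\<close>
  have "S {0..ennreal r} = (\<lambda>x. 0)" using True S_zero by auto
  then show ?thesis
    using closed_csubspaceD(1)[OF closed_csubspace_past] S_bounded[of "{0..ennreal r}"]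
      clinear_bounded_on_zero_arg[OF clinear_join(2) closed_csubspace_past]
    by (auto simp: past_op_def)
next
  case False
  then obtain X where X: "X \<in> bounded_ops (past r)"
    "S {0..ennreal r} = op_tensor (join r) (past r) (future r) UNIV X (id_op (future r))"
    using S r unfolding finite_stop_time_def by (metis order_le_less)
  obtain K where K: "0 \<le> K" "clinear_bounded_on (past r) K X"
    using X(1) clinear_bounded_on_nonneg unfolding bounded_ops_iff by metis
  have XP: "X x \<in> past r" if "x \<in> past r" for x using X(1) that by (simp add: bounded_ops_iff)
  have SX: "S {0..ennreal r} (join r x y) = join r (X x) y" if "x \<in> past r" "y \<in> future r" for x y
    using op_tensor_exists[OF join_tensor closed_csubspace_past closed_csubspace_future K(2) XP K(1)
        id_op_clinear[OF closed_csubspace_future]] that unfolding X(2) by (auto simp: id_op_def)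
  have vac: "expv (\<lambda>q. 0) \<in> future r" by (rule expv_in_future[OF zero_in_L2]) simp
  have unit: "join r x (expv (\<lambda>q. 0)) = x" if "x \<in> past r" for x
    by (rule clinear_bounded_on_eqI[OF clinear_join(2)[OF vac, unfolded past_eq] clinear_bounded_on_id _
          that[unfolded past_eq]])
      (auto simp: join_expv[OF _ _ zero_in_L2])
  have S_past: "S {0..ennreal r} x = X x" if "x \<in> past r" for x
    using SX[OF that vac] unit[OF that] unit[OF XP[OF that]] by simp
  show ?thesis
    unfolding past_op_def using S_bounded[of "{0..ennreal r}"] SX S_past XP by simp
qed

text \<open>Both initial projections act on the past of the later time \<open>b\<close>, the earlier
  one by monotonicity, hence so does their difference.\<close>

lemma past_op_S_interval:
  assumes "0 \<le> a" "a \<le> b"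
  shows "past_op b (S {ennreal a<..ennreal b})"
proof -
  have b: "past_op b (S {0..ennreal b})" and a: "past_op b (S {0..ennreal a})"
    using past_op_S_atMost past_op_mono[OF past_op_S_atMost] assms by auto
  show ?thesis
    unfolding past_op_def
  proof (intro conjI ballI)
    show "S {ennreal a<..ennreal b} \<in> bounded_ops UNIV" by (rule S_bounded) simp
    fix x assume x: "x \<in> past b"
    note Px = past_opD(2)[OF b x] past_opD(2)[OF a x]
    show "S {ennreal a<..ennreal b} x \<in> past b"
      unfolding S_interval[OF assms] by (rule closed_csubspaceD(4)[OF closed_csubspace_past Px])
    show "S {ennreal a<..ennreal b} (join b x y) = join b (S {ennreal a<..ennreal b} x) y"
      if y: "y \<in> future b" for y
      using clinear_bounded_on_minus_arg[OF clinear_join(2)[OF y] closed_csubspace_past Px]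
      by (simp add: S_interval[OF assms] past_opD(3)[OF b x y] past_opD(3)[OF a x y])
  qed
qed

section \<open>Ampliation of the projections of the stop time, and partition cells\<close>

abbreviation E :: "ennreal set \<Rightarrow> 'hf \<Rightarrow> 'hf" where "E A \<equiv> ampl (S A)"

lemma E_clinear: "A \<in> sets borel \<Longrightarrow> clinear_bounded_on UNIV 1 (E A)"
  using ampl_exists[OF S_D(3)] by simp

lemma E_bounded: "A \<in> sets borel \<Longrightarrow> E A \<in> bounded_ops UNIV"
  by (rule ampl_bounded[OF S_bounded])

lemma E_tens: "A \<in> sets borel \<Longrightarrow> E A (tens u x) = tens u (S A x)"
  by (rule ampl_tens[OF S_bounded])

lemma E_contraction: "A \<in> sets borel \<Longrightarrow> norm (E A z) \<le> norm z"
  using clinear_bounded_onD(3)[OF E_clinear] by simp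

lemma E_self_adjoint:
  assumes A: "A \<in> sets borel"
  shows "cinner (E A x) y = cinner x (E A y)"
  by (rule cinner_eq_on_closed_cspan[of "{tens u x | u x. True}" 1 "E A" "{tens u x | u x. True}" 1 "\<lambda>z. z"
        1 "\<lambda>z. z" 1 "E A", unfolded tens_total])
    (auto simp: E_clinear[OF A] clinear_bounded_on_id E_tens[OF A] hilbert_tensorD(1)[OF tensor] S_D(2)[OF A])

lemma E_comp_eq:
  assumes ABC: "A \<in> sets borel" "B \<in> sets borel" "C \<in> sets borel" and eq: "\<And>x. S A (S B x) = S C x"
  shows "E A (E B z) = E C z"
  by (rule bounded_ops_eq_tens[OF bounded_ops_UNIV_comp[OF E_bounded E_bounded] E_bounded])
    (simp_all add: ABC E_tens eq)

lemma E_subset: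
  assumes "A \<in> sets borel" "B \<in> sets borel" "A \<subseteq> B"
  shows "E A (E B z) = E A z" "E B (E A z) = E A z"
  by (rule E_comp_eq[OF assms(1,2,1) S_subset(1)[OF assms]], rule E_comp_eq[OF assms(2,1,1) S_subset(2)[OF assms]])

lemma E_eq_zero:
  assumes A: "A \<in> sets borel" and zero: "\<And>x. S A x = 0"
  shows "E A z = 0"
proof (rule bounded_ops_eq_tens[where Y = "\<lambda>z. 0", OF E_bounded[OF A]])
  show "(\<lambda>z. 0) \<in> bounded_ops UNIV"
    by (auto simp: bounded_ops_UNIV_iff clinear_bounded_on_def intro!: exI[of _ 0])
  show "E A (tens u x) = 0" for u x
    using clinear_bounded_on_zero_arg[OF clinear_tens(1)] by (simp add: E_tens[OF A] zero)
qed

lemma E_disjoint: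
  assumes "A \<in> sets borel" "B \<in> sets borel" "A \<inter> B = {}"
  shows "E A (E B z) = 0"
proof -
  have "E A (E B z) = E {} z"
    by (rule E_comp_eq) (simp_all add: assms S_disjoint S_empty)
  then show ?thesis by (simp add: E_eq_zero S_empty)
qed

lemma E_interval:
  assumes ab: "0 \<le> a" "a \<le> b"
  shows "E {ennreal a<..ennreal b} z = E {0..ennreal b} z - E {0..ennreal a} z"
proof (rule bounded_ops_eq_tens[OF E_bounded bounded_ops_UNIV_diff[OF E_bounded E_bounded]])
  show "E {ennreal a<..ennreal b} (tens u x) = E {0..ennreal b} (tens u x) - E {0..ennreal a} (tens u x)" for u x
    using clinear_bounded_on_minus_arg[OF clinear_tens(1)[of u]]
    by (simp add: E_tens S_interval[OF ab])
qed simp_all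

lemma E_zero: "E {0..ennreal 0} z = 0"
  by (rule E_eq_zero) (simp_all add: S_zero)

text \<open>For \<open>j = 0\<close> truncated subtraction makes the cell empty, so lemmas on cells
  hold for all \<open>j < card \<pi>\<close>, while the sums begin at \<open>1\<close>.\<close>

definition cell :: "real set \<Rightarrow> nat \<Rightarrow> ennreal set" where
  "cell \<pi> j = {ennreal (partition_pt \<pi> (j - 1))<..ennreal (partition_pt \<pi> j)}"

lemma cell_borel [simp]: "cell \<pi> j \<in> sets borel"
  by (simp add: cell_def)

lemma cell_disjoint:
  assumes \<pi>: "\<pi> \<in> partitions t" and i: "i < j" "j < card \<pi>"
  shows "cell \<pi> i \<inter> cell \<pi> j = {}"
proof -
  have "ennreal (partition_pt \<pi> i) \<le> ennreal (partition_pt \<pi> (j - 1))"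
    by (rule ennreal_leI[OF partition_pt_le[OF \<pi>]]) (use i in auto)
  then show ?thesis unfolding cell_def by (auto dest: order.strict_trans1)
qed

lemma cell_subset:
  assumes "\<pi> \<in> partitions t" "j < card \<pi>"
  shows "cell \<pi> j \<subseteq> {0..ennreal t}"
  using ennreal_leI[OF partition_pt_bounds(2)[OF assms]] unfolding cell_def by (auto intro: order_trans)

lemma past_op_cell:
  assumes \<pi>: "\<pi> \<in> partitions t" and j: "j < card \<pi>"
  shows "past_op (partition_pt \<pi> j) (S (cell \<pi> j))"
  unfolding cell_def by (rule past_op_S_interval) (use j partition_pt_bounds[OF \<pi>] partition_pt_le[OF \<pi>] in auto)

lemma E_cells_disjoint:
  assumes \<pi>: "\<pi> \<in> partitions t" and j: "i < card \<pi>" "j < card \<pi>" "i \<noteq> j"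
  shows "E (cell \<pi> i) (E (cell \<pi> j) z) = 0"
proof (rule E_disjoint)
  show "cell \<pi> i \<inter> cell \<pi> j = {}"
    using cell_disjoint[OF \<pi>, of i j] cell_disjoint[OF \<pi>, of j i] j by (auto simp: nat_neq_iff)
qed simp_all

text \<open>The initial projections telescope; the lower end contributes nothing because
  \<open>S {0} = 0\<close>.\<close>

lemma sum_E_cells:
  assumes \<pi>: "\<pi> \<in> partitions t"
  shows "(\<Sum>j=1..<card \<pi>. E (cell \<pi> j) z) = E {0..ennreal t} z"
proof -
  have n: "card \<pi> > 0" using \<pi> by (auto simp: partitions_def card_gt_0_iff)
  have "m < card \<pi> \<Longrightarrow> (\<Sum>j=1..<Suc m. E (cell \<pi> j) z) = E {0..ennreal (partition_pt \<pi> m)} z" for m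
  proof (induction m)
    case 0
    then show ?case using E_zero by (simp add: partition_pt_first[OF \<pi>])
  next
    case (Suc m)
    have "E (cell \<pi> (Suc m)) z
        = E {0..ennreal (partition_pt \<pi> (Suc m))} z - E {0..ennreal (partition_pt \<pi> m)} z"
      unfolding cell_def using Suc.prems partition_pt_bounds(1)[OF \<pi>, of m] partition_pt_le[OF \<pi>, of m "Suc m"]
      by (simp add: E_interval)
    then show ?case using Suc by simp
  qed
  from this[of "card \<pi> - 1"] show ?thesis using n partition_pt_last[OF \<pi>] by simp
qed

text \<open>Bessel's inequality for mutually orthogonal projections; it keeps the convergence
  estimate independent of the number of cells.\<close>

lemma sum_norm_S_cells_le:
  assumes \<pi>: "\<pi> \<in> partitions t"
  shows "(\<Sum>j=1..<card \<pi>. (norm (S (cell \<pi> j) x))\<^sup>2) \<le> (norm x)\<^sup>2"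
proof -
  have disj: "cell \<pi> i \<inter> cell \<pi> j = {}" if "i < card \<pi>" "j < card \<pi>" "i \<noteq> j" for i j
    using cell_disjoint[OF \<pi>, of i j] cell_disjoint[OF \<pi>, of j i] that by (auto simp: nat_neq_iff)
  let ?y = "\<Sum>j=1..<card \<pi>. S (cell \<pi> j) x"
  have "cinner x ?y = complex_of_real (\<Sum>j=1..<card \<pi>. (norm (S (cell \<pi> j) x))\<^sup>2)"
    unfolding cinner_sum_right of_real_sum
    by (intro sum.cong refl) (metis S_D(1,2) cell_borel cinner_self)
  moreover have eq: "(norm ?y)\<^sup>2 = (\<Sum>j=1..<card \<pi>. (norm (S (cell \<pi> j) x))\<^sup>2)"
    by (rule norm_sum_orthogonal) (auto simp: S_D(2) S_disjoint disj)
  ultimately have "cinner x ?y = complex_of_real ((norm ?y)\<^sup>2)" by (simp only:)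
  then have "(norm ?y)\<^sup>2 = cmod (cinner x ?y)" by (metis abs_of_nonneg norm_of_real zero_le_power2)
  also have "\<dots> \<le> norm x * norm ?y" by (rule Cauchy_Schwarz)
  finally have "norm ?y \<le> norm x"
    by (cases "norm ?y = 0") (simp_all add: power2_eq_square)
  then show ?thesis unfolding eq[symmetric] by (simp add: power_mono)
qed

end

subsection \<open>Convergence of the stopped sums\<close>

locale stopped_cocycle = isometric_cocycle expv tens p M V + stop_time expv tens S
  for expv :: "(real \<Rightarrow> 'k::complex_hilbert) \<Rightarrow> 'f::complex_hilbert"
    and tens :: "'h::complex_hilbert \<Rightarrow> 'f \<Rightarrow> 'hf::complex_hilbert"
    and p :: "'k \<Rightarrow> 'k" and M :: "('h \<Rightarrow> 'h) set" and V :: "real \<Rightarrow> 'hf \<Rightarrow> 'hf"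
    and S :: "ennreal set \<Rightarrow> 'f \<Rightarrow> 'f" +
  fixes t :: real
  assumes cont: "strongly_continuous V" and t_pos: "0 < t"
begin

lemma V_clinear: "0 \<le> s \<Longrightarrow> clinear_bounded_on UNIV 1 (V s)"
  using V_bounded V_contraction unfolding bounded_ops_UNIV_iff clinear_bounded_on_def by auto

lemma stopped_sum_eq: "stopped_sum V S \<pi> z = (\<Sum>j=1..<card \<pi>. V (partition_pt \<pi> j) (E (cell \<pi> j) z))"
  by (simp add: stopped_sum_def cell_def)

text \<open>The projection of the earlier cell acts on the past of both times and annihilates the
  later cell. The times are left free because comparing two partitions mixes endpoints of
  both.\<close>

lemma V_cells_orthogonal:
  assumes \<pi>: "\<pi> \<in> partitions t" and k: "k < l" "l < card \<pi>"
    and a: "partition_pt \<pi> k \<le> a" and b: "partition_pt \<pi> k \<le> b"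
  shows "cinner (V a (E (cell \<pi> k) z)) (V b (E (cell \<pi> l) z)) = 0"
  by (rule V_orthogonal[OF past_op_cell[OF \<pi>] E_self_adjoint partition_pt_bounds(1)[OF \<pi>] a b])
    (use k E_cells_disjoint[OF \<pi>, of k l] in auto)

lemma norm_stopped_sum_le:
  assumes \<pi>: "\<pi> \<in> partitions t"
  shows "norm (stopped_sum V S \<pi> z) \<le> norm (E {0..ennreal t} z)"
proof -
  let ?x = "\<lambda>j. V (partition_pt \<pi> j) (E (cell \<pi> j) z)"
  have lt: "cinner (?x i) (?x j) = 0" if "i < j" "j < card \<pi>" for i j
    by (rule V_cells_orthogonal[OF \<pi> that]) (use that partition_pt_le[OF \<pi>, of i j] in auto)
  have orth: "cinner (?x i) (?x j) = 0" if "i < card \<pi>" "j < card \<pi>" "i \<noteq> j" for i j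
    using lt[of i j] lt[of j i] that by (metis cinner_commute complex_cnj_zero nat_neq_iff)
  have "(norm (stopped_sum V S \<pi> z))\<^sup>2 = (\<Sum>j=1..<card \<pi>. (norm (?x j))\<^sup>2)"
    unfolding stopped_sum_eq by (rule norm_sum_orthogonal) (auto simp: orth)
  also have "\<dots> \<le> (\<Sum>j=1..<card \<pi>. (norm (E (cell \<pi> j) z))\<^sup>2)"
    by (intro sum_mono power_mono V_contraction partition_pt_bounds(1)[OF \<pi>]) auto
  \<comment> \<open>Without \<open>V\<close> the cells are orthogonal as well, and they recombine to
    the projection of \<open>[0,t]\<close>.\<close>
  also have "\<dots> = (norm (\<Sum>j=1..<card \<pi>. E (cell \<pi> j) z))\<^sup>2"
    by (rule norm_sum_orthogonal[symmetric]) (auto simp: E_self_adjoint E_cells_disjoint[OF \<pi>])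
  finally have "(norm (stopped_sum V S \<pi> z))\<^sup>2 \<le> (norm (E {0..ennreal t} z))\<^sup>2"
    by (simp only: sum_E_cells[OF \<pi>])
  then show ?thesis by (rule power2_le_imp_le) simp
qed

lemma stopped_sum_clinear:
  assumes \<pi>: "\<pi> \<in> partitions t"
  shows "clinear_bounded_on UNIV 1 (stopped_sum V S \<pi>)"
  unfolding clinear_bounded_on_def
proof (intro conjI ballI allI)
  have V: "clinear_bounded_on UNIV 1 (V (partition_pt \<pi> j))" if "j < card \<pi>" for j
    by (rule V_clinear[OF partition_pt_bounds(1)[OF \<pi> that]])
  have E: "clinear_bounded_on UNIV 1 (E (cell \<pi> j))" for j by (rule E_clinear) simp
  fix x
  show "stopped_sum V S \<pi> (x + y) = stopped_sum V S \<pi> x + stopped_sum V S \<pi> y" for y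
    unfolding stopped_sum_eq sum.distrib[symmetric]
    by (rule sum.cong) (auto simp: clinear_bounded_onD(1)[OF E] clinear_bounded_onD(1)[OF V])
  show "stopped_sum V S \<pi> (c *\<^sub>C x) = c *\<^sub>C stopped_sum V S \<pi> x" for c
    unfolding stopped_sum_eq complex_vector.scale_sum_right
    by (rule sum.cong) (auto simp: clinear_bounded_onD(2)[OF E] clinear_bounded_onD(2)[OF V])
  show "norm (stopped_sum V S \<pi> x) \<le> 1 * norm x"
    using norm_stopped_sum_le[OF \<pi>, of x] E_contraction[of "{0..ennreal t}" x] by simp
qed

lemma stopped_sum_E:
  assumes \<pi>: "\<pi> \<in> partitions t"
  shows "stopped_sum V S \<pi> (E {0..ennreal t} z) = stopped_sum V S \<pi> z"
  unfolding stopped_sum_eq by (rule sum.cong) (auto simp: E_subset cell_subset[OF \<pi>])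

text \<open>A coarse projection is the sum of those of the fine cells inside it, so the coarse sum
  becomes one over fine cells with \<open>V\<close> still taken at the coarse right end. Here
  \<open>\<tau> k\<close> is the coarse cell that contains the fine cell \<open>k\<close>.\<close>

lemma stopped_sum_refine:
  assumes \<pi>: "\<pi> \<in> partitions t" and \<pi>': "\<pi>' \<in> partitions t"
    and \<tau>: "\<And>k. 1 \<le> k \<Longrightarrow> k < card \<pi>' \<Longrightarrow> 1 \<le> \<tau> k \<and> \<tau> k < card \<pi>
      \<and> partition_pt \<pi> (\<tau> k - 1) \<le> partition_pt \<pi>' (k - 1) \<and> partition_pt \<pi>' k \<le> partition_pt \<pi> (\<tau> k)"
  shows "stopped_sum V S \<pi> z = (\<Sum>k=1..<card \<pi>'. V (partition_pt \<pi> (\<tau> k)) (E (cell \<pi>' k) z))"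
proof -
  have sub: "cell \<pi>' k \<subseteq> cell \<pi> (\<tau> k)" if "1 \<le> k" "k < card \<pi>'" for k
  proof -
    have "ennreal (partition_pt \<pi> (\<tau> k - 1)) \<le> ennreal (partition_pt \<pi>' (k - 1))"
      "ennreal (partition_pt \<pi>' k) \<le> ennreal (partition_pt \<pi> (\<tau> k))"
      using \<tau>[OF that] by (auto intro: ennreal_leI)
    then show ?thesis unfolding cell_def by (auto intro: order.strict_trans1 order_trans)
  qed
  have comp: "E (cell \<pi> j) (E (cell \<pi>' k) z) = (if j = \<tau> k then E (cell \<pi>' k) z else 0)"
    if j: "j < card \<pi>" and k: "1 \<le> k" "k < card \<pi>'" for j k
  proof (cases "j = \<tau> k")
    case True
    then show ?thesis using E_subset(2)[OF cell_borel cell_borel sub[OF k]] by simp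
  next
    case False
    have "E (cell \<pi> j) (E (cell \<pi>' k) z) = E (cell \<pi> j) (E (cell \<pi> (\<tau> k)) (E (cell \<pi>' k) z))"
      using E_subset(2)[OF cell_borel cell_borel sub[OF k]] by simp
    then show ?thesis using False E_cells_disjoint[OF \<pi> j] \<tau>[OF k] by simp
  qed
  \<comment> \<open>The fine projections resolve that of \<open>[0,t]\<close>; the coarse one
    retains precisely those with \<open>\<tau> k = j\<close>.\<close>
  have V_term: "V (partition_pt \<pi> j) (E (cell \<pi> j) z)
      = (\<Sum>k=1..<card \<pi>'. if j = \<tau> k then V (partition_pt \<pi> (\<tau> k)) (E (cell \<pi>' k) z) else 0)"
    if j: "j < card \<pi>" for j
  proof -
    have Vj: "clinear_bounded_on UNIV 1 (V (partition_pt \<pi> j))"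
      by (rule V_clinear[OF partition_pt_bounds(1)[OF \<pi> j]])
    have Ej: "clinear_bounded_on UNIV 1 (E (cell \<pi> j))" by (rule E_clinear) simp
    have "E (cell \<pi> j) z = E (cell \<pi> j) (E {0..ennreal t} z)"
      by (simp add: E_subset cell_subset[OF \<pi> j])
    also have "\<dots> = E (cell \<pi> j) (\<Sum>k=1..<card \<pi>'. E (cell \<pi>' k) z)" by (simp only: sum_E_cells[OF \<pi>'])
    also have "\<dots> = (\<Sum>k=1..<card \<pi>'. E (cell \<pi> j) (E (cell \<pi>' k) z))"
      using clinear_bounded_on_sum_arg[OF Ej] by simp
    also have "V (partition_pt \<pi> j) \<dots> = (\<Sum>k=1..<card \<pi>'. V (partition_pt \<pi> j) (E (cell \<pi> j) (E (cell \<pi>' k) z)))"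
      using clinear_bounded_on_sum_arg[OF Vj] by simp
    also have "\<dots> = (\<Sum>k=1..<card \<pi>'. if j = \<tau> k then V (partition_pt \<pi> (\<tau> k)) (E (cell \<pi>' k) z) else 0)"
      by (rule sum.cong) (auto simp: comp[OF j] clinear_bounded_on_zero_arg[OF Vj])
    finally show ?thesis .
  qed
  have "stopped_sum V S \<pi> z = (\<Sum>j=1..<card \<pi>. \<Sum>k=1..<card \<pi>'.
      if j = \<tau> k then V (partition_pt \<pi> (\<tau> k)) (E (cell \<pi>' k) z) else 0)"
    unfolding stopped_sum_eq by (rule sum.cong) (auto simp: V_term)
  also have "\<dots> = (\<Sum>k=1..<card \<pi>'. \<Sum>j=1..<card \<pi>.
      if j = \<tau> k then V (partition_pt \<pi> (\<tau> k)) (E (cell \<pi>' k) z) else 0)" by (rule sum.swap)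
  also have "\<dots> = (\<Sum>k=1..<card \<pi>'. V (partition_pt \<pi> (\<tau> k)) (E (cell \<pi>' k) z))"
    by (rule sum.cong) (use \<tau> in auto)
  finally show ?thesis .
qed

text \<open>Pythagoras over the fine cells: each difference is at most \<open>d\<close> times
  \<open>norm (S (cell \<pi>' k) (expv f)) / norm (expv f)\<close>, and by Bessel the squares of
  these weights sum to at most one.\<close>

lemma stopped_sum_increment:
  assumes f: "f \<in> L2" and z: "z = tens u (expv f)" and d: "0 \<le> d"
    and \<pi>: "\<pi> \<in> partitions t" and \<pi>': "\<pi>' \<in> partitions t" "\<pi> \<subseteq> \<pi>'"
    and close: "\<And>j r. 1 \<le> j \<Longrightarrow> j < card \<pi> \<Longrightarrow> partition_pt \<pi> (j - 1) \<le> r \<Longrightarrow> r \<le> partition_pt \<pi> j \<Longrightarrow>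
      norm (V (partition_pt \<pi> j) z - V r z) \<le> d"
  shows "norm (stopped_sum V S \<pi> z - stopped_sum V S \<pi>' z) \<le> d"
proof -
  have "\<forall>k. \<exists>j. 1 \<le> k \<longrightarrow> k < card \<pi>' \<longrightarrow> 1 \<le> j \<and> j < card \<pi>
      \<and> partition_pt \<pi> (j - 1) \<le> partition_pt \<pi>' (k - 1) \<and> partition_pt \<pi>' k \<le> partition_pt \<pi> j"
    using partition_pt_refine[OF \<pi> \<pi>'] by blast
  then obtain \<tau> where \<tau>: "\<And>k. 1 \<le> k \<Longrightarrow> k < card \<pi>' \<Longrightarrow> 1 \<le> \<tau> k \<and> \<tau> k < card \<pi>
      \<and> partition_pt \<pi> (\<tau> k - 1) \<le> partition_pt \<pi>' (k - 1) \<and> partition_pt \<pi>' k \<le> partition_pt \<pi> (\<tau> k)"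
    by metis
  \<comment> \<open>\<open>v k\<close> is the coarse and \<open>r k\<close> the fine time at which
    cell \<open>k\<close> is evaluated. As \<open>r k\<close> lies in the coarse cell,
    \<open>close\<close> applies to the pair.\<close>
  define v where "v k = partition_pt \<pi> (\<tau> k)" for k
  define r where "r k = partition_pt \<pi>' k" for k
  define D where "D k = V (v k) (E (cell \<pi>' k) z) - V (r k) (E (cell \<pi>' k) z)" for k
  have rv: "r k \<le> v k" if "1 \<le> k" "k < card \<pi>'" for k using \<tau>[OF that] by (simp add: r_def v_def)
  have r_mono: "r k \<le> r l" if "k \<le> l" "l < card \<pi>'" for k l
    using partition_pt_le[OF \<pi>'(1) that] by (simp add: r_def)
  \<comment> \<open>The end \<open>r k\<close> of the earlier cell precedes all four times involved,
    so the four inner products in the expansion vanish.\<close>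
  have lt: "cinner (D k) (D l) = 0" if kl: "1 \<le> k" "k < l" "l < card \<pi>'" for k l
  proof -
    have "r k \<le> v k" "r k \<le> r l" "r k \<le> v l"
      using rv[of k] rv[of l] r_mono[of k l] kl by auto
    then have "cinner (V a (E (cell \<pi>' k) z)) (V b (E (cell \<pi>' l) z)) = 0"
      if "a \<in> {v k, r k}" "b \<in> {v l, r l}" for a b
      using V_cells_orthogonal[OF \<pi>'(1) kl(2,3)] that unfolding r_def[of k] by auto
    then show ?thesis by (simp add: D_def cinner_diff_left cinner_diff_right)
  qed
  have orth: "cinner (D k) (D l) = 0" if "1 \<le> k" "k < card \<pi>'" "1 \<le> l" "l < card \<pi>'" "k \<noteq> l" for k l
    using lt[of k l] lt[of l k] that by (metis cinner_commute complex_cnj_zero nat_neq_iff)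
  have refine: "stopped_sum V S \<pi> z = (\<Sum>k=1..<card \<pi>'. V (partition_pt \<pi> (\<tau> k)) (E (cell \<pi>' k) z))"
    by (rule stopped_sum_refine[OF \<pi> \<pi>'(1) \<tau>])
  have "stopped_sum V S \<pi> z - stopped_sum V S \<pi>' z = (\<Sum>k=1..<card \<pi>'. D k)"
    unfolding refine stopped_sum_eq[of \<pi>'] D_def v_def r_def
    by (rule sum_subtractf[symmetric])
  then have "(norm (stopped_sum V S \<pi> z - stopped_sum V S \<pi>' z))\<^sup>2 = (\<Sum>k=1..<card \<pi>'. (norm (D k))\<^sup>2)"
    by (simp only:) (rule norm_sum_orthogonal, auto simp: orth)
  \<comment> \<open>Multiplied by the squared norm of \<open>expv f\<close> to match the increment
    identity; the factor is cancelled at the end because exponential vectors are nonzero.\<close>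
  then have "(norm (stopped_sum V S \<pi> z - stopped_sum V S \<pi>' z))\<^sup>2 * (norm (expv f))\<^sup>2
      = (\<Sum>k=1..<card \<pi>'. (norm (D k) * norm (expv f))\<^sup>2)"
    by (simp add: sum_distrib_right power_mult_distrib)
  also have "\<dots> \<le> (\<Sum>k=1..<card \<pi>'. d\<^sup>2 * (norm (S (cell \<pi>' k) (expv f)))\<^sup>2)"
  proof (rule sum_mono)
    fix k assume "k \<in> {1..<card \<pi>'}"
    then have k: "1 \<le> k" "k < card \<pi>'" by auto
    have "partition_pt \<pi> (\<tau> k - 1) \<le> r k"
      using \<tau>[OF k] r_mono[of "k - 1" k] k by (simp add: r_def)
    then have "norm (V (v k) z - V (r k) z) \<le> d"
      unfolding v_def using close[of "\<tau> k" "r k"] \<tau>[OF k] by (simp add: r_def)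
    moreover have "norm (D k) * norm (expv f) = norm (S (cell \<pi>' k) (expv f)) * norm (V (v k) z - V (r k) z)"
      unfolding D_def z
      by (rule norm_increment_past_op[OF past_op_cell[OF \<pi>'(1) k(2), folded r_def] _ rv[OF k] order_refl f])
        (use partition_pt_bounds(1)[OF \<pi>'(1) k(2)] in \<open>simp add: r_def\<close>)
    ultimately have "norm (D k) * norm (expv f) \<le> d * norm (S (cell \<pi>' k) (expv f))"
      by (metis mult.commute mult_right_mono norm_ge_zero)
    then have "(norm (D k) * norm (expv f))\<^sup>2 \<le> (d * norm (S (cell \<pi>' k) (expv f)))\<^sup>2"
      by (rule power_mono) simp
    then show "(norm (D k) * norm (expv f))\<^sup>2 \<le> d\<^sup>2 * (norm (S (cell \<pi>' k) (expv f)))\<^sup>2"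
      by (simp add: power_mult_distrib)
  qed
  also have "\<dots> \<le> d\<^sup>2 * (norm (expv f))\<^sup>2"
    unfolding sum_distrib_left[symmetric]
    by (rule mult_left_mono[OF sum_norm_S_cells_le[OF \<pi>'(1)]]) simp
  finally have "(norm (stopped_sum V S \<pi> z - stopped_sum V S \<pi>' z))\<^sup>2 \<le> d\<^sup>2"
    using expv_nonzero[OF f] by simp
  then show ?thesis by (rule power2_le_imp_le[OF _ d])
qed

lemma stopped_sum_convergent_expv:
  assumes f: "f \<in> L2"
  shows "\<exists>l. ((\<lambda>\<pi>. stopped_sum V S \<pi> (tens u (expv f))) \<longlongrightarrow> l) (refinement_filter t)"
proof (rule refinement_Cauchy_convergent)
  show "0 \<le> t" using t_pos by simp
  fix e :: real assume e: "0 < e"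
  let ?z = "tens u (expv f)"
  \<comment> \<open>Compactness makes the continuity uniform, so a single mesh bound serves all
    cells.\<close>
  have "uniformly_continuous_on {0..t} (\<lambda>r. V r ?z)"
  proof (rule compact_uniformly_continuous)
    show "continuous_on {0..t} (\<lambda>r. V r ?z)"
      by (rule continuous_on_subset[of "{0..}"]) (use cont in \<open>auto simp: strongly_continuous_def\<close>)
  qed simp
  then obtain \<eta> where \<eta>: "0 < \<eta>"
    "\<And>r s. r \<in> {0..t} \<Longrightarrow> s \<in> {0..t} \<Longrightarrow> dist r s < \<eta> \<Longrightarrow> dist (V r ?z) (V s ?z) < e / 2"
    unfolding uniformly_continuous_on_def using half_gt_zero[OF e] by metis
  obtain \<pi> where \<pi>: "\<pi> \<in> partitions t"
    "\<And>j. 1 \<le> j \<Longrightarrow> j < card \<pi> \<Longrightarrow> partition_pt \<pi> j - partition_pt \<pi> (j - 1) < \<eta>"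
    using fine_partition[OF t_pos \<eta>(1)] by blast
  have "norm (stopped_sum V S \<pi> ?z - stopped_sum V S \<pi>' ?z) \<le> e / 2"
    if "\<pi>' \<in> partitions t" "\<pi> \<subseteq> \<pi>'" for \<pi>'
  proof (rule stopped_sum_increment[OF f refl _ \<pi>(1) that])
    fix j r assume j: "1 \<le> j" "j < card \<pi>" and r: "partition_pt \<pi> (j - 1) \<le> r" "r \<le> partition_pt \<pi> j"
    have "0 \<le> partition_pt \<pi> (j - 1)" using partition_pt_bounds(1)[OF \<pi>(1)] j by simp
    then have "dist (V (partition_pt \<pi> j) ?z) (V r ?z) < e / 2"
      using \<pi>(2)[OF j] r partition_pt_bounds[OF \<pi>(1) j(2)] by (intro \<eta>(2)) (auto simp: dist_real_def)
    then show "norm (V (partition_pt \<pi> j) ?z - V r ?z) \<le> e / 2" by (simp add: dist_norm)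
  qed (use e in simp)
  then have "\<forall>\<pi>'\<in>partitions t. \<pi> \<subseteq> \<pi>' \<longrightarrow> norm (stopped_sum V S \<pi> ?z - stopped_sum V S \<pi>' ?z) < e"
    using e by fastforce
  then show "\<exists>\<pi>\<^sub>0\<in>partitions t. \<forall>\<pi>\<in>partitions t. \<pi>\<^sub>0 \<subseteq> \<pi> \<longrightarrow>
      norm (stopped_sum V S \<pi>\<^sub>0 ?z - stopped_sum V S \<pi> ?z) < e" using \<pi>(1) by blast
qed

text \<open>All stopped sums are contractions, so the vectors at which the net converges form a
  closed subspace, and this contains the total set of vectors
  \<open>tens u (expv f)\<close>.\<close>

lemma stopped_sum_convergent:
  "\<exists>l. ((\<lambda>\<pi>. stopped_sum V S \<pi> z) \<longlongrightarrow> l) (refinement_filter t)"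
proof -
  let ?F = "refinement_filter t"
  have ne: "?F \<noteq> bot" using refinement_filter_neq_bot t_pos by simp
  have ev: "\<forall>\<^sub>F \<pi> in ?F. \<pi> \<in> partitions t" using eventually_partitions t_pos by simp
  let ?C = "{z. \<exists>l. ((\<lambda>\<pi>. stopped_sum V S \<pi> z) \<longlongrightarrow> l) ?F}"
  \<comment> \<open>Limits inherit the contraction bound; hence the limits along a Cauchy sequence
    of vectors form a Cauchy sequence.\<close>
  have diff_le: "norm (l - l') \<le> norm (z - z')"
    if l: "((\<lambda>\<pi>. stopped_sum V S \<pi> z) \<longlongrightarrow> l) ?F" "((\<lambda>\<pi>. stopped_sum V S \<pi> z') \<longlongrightarrow> l') ?F" for z z' l l'
  proof (rule tendsto_upperbound[OF tendsto_norm[OF tendsto_diff[OF l]] _ ne])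
    show "\<forall>\<^sub>F \<pi> in ?F. norm (stopped_sum V S \<pi> z - stopped_sum V S \<pi> z') \<le> norm (z - z')"
      using ev
    proof eventually_elim
      case (elim \<pi>)
      show ?case
        using clinear_bounded_onD(3)[OF stopped_sum_clinear[OF elim], of "z - z'"]
          clinear_bounded_on_minus_arg[OF stopped_sum_clinear[OF elim]] by simp
    qed
  qed
  have "closed_csubspace ?C"
    unfolding closed_csubspace_def complex_vector.subspace_def
  proof (intro conjI ballI allI)
    have "((\<lambda>\<pi>. stopped_sum V S \<pi> 0) \<longlongrightarrow> 0) ?F"
      by (rule tendsto_eventually)
        (use ev in eventually_elim, use clinear_bounded_on_zero_arg[OF stopped_sum_clinear] in simp)
    then show "0 \<in> ?C" by blast
  next
    fix x y assume "x \<in> ?C" "y \<in> ?C"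
    then obtain l l' where l: "((\<lambda>\<pi>. stopped_sum V S \<pi> x) \<longlongrightarrow> l) ?F" "((\<lambda>\<pi>. stopped_sum V S \<pi> y) \<longlongrightarrow> l') ?F"
      by blast
    have "\<forall>\<^sub>F \<pi> in ?F. stopped_sum V S \<pi> x + stopped_sum V S \<pi> y = stopped_sum V S \<pi> (x + y)"
      using ev by eventually_elim (simp add: clinear_bounded_onD(1)[OF stopped_sum_clinear])
    from Lim_transform_eventually[OF tendsto_add[OF l] this] show "x + y \<in> ?C" by blast
  next
    fix c x assume "x \<in> ?C"
    then obtain l where l: "((\<lambda>\<pi>. stopped_sum V S \<pi> x) \<longlongrightarrow> l) ?F" by blast
    have "\<forall>\<^sub>F \<pi> in ?F. c *\<^sub>C stopped_sum V S \<pi> x = stopped_sum V S \<pi> (c *\<^sub>C x)"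
      using ev by eventually_elim (simp add: clinear_bounded_onD(2)[OF stopped_sum_clinear])
    from Lim_transform_eventually[OF tendsto_scaleC[OF l] this] show "c *\<^sub>C x \<in> ?C" by blast
  next
    show "closed ?C"
      unfolding closed_sequential_limits
    proof (intro allI impI, elim conjE)
      fix s x assume s: "\<forall>n. s n \<in> ?C" and x: "s \<longlonglongrightarrow> x"
      then obtain l where l: "\<And>n. ((\<lambda>\<pi>. stopped_sum V S \<pi> (s n)) \<longlongrightarrow> l n) ?F" by (simp, metis)
      have "Cauchy s" using x by (rule LIMSEQ_imp_Cauchy)
      then have "Cauchy l"
        unfolding Cauchy_iff using diff_le[OF l l] by (meson le_less_trans)
      then obtain L where L: "l \<longlonglongrightarrow> L" using Cauchy_convergent_iff convergent_def by blast
      have "((\<lambda>\<pi>. stopped_sum V S \<pi> x) \<longlongrightarrow> L) ?F"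
      proof (rule tendstoI)
        fix e :: real assume "0 < e"
        then have e: "0 < e / 3" by simp
        have "\<forall>\<^sub>F n in sequentially. dist (s n) x < e / 3 \<and> dist (l n) L < e / 3"
          using tendstoD[OF x e] tendstoD[OF L e] by eventually_elim simp
        from eventually_happens'[OF sequentially_bot this]
        obtain n where n: "dist (s n) x < e / 3" "dist (l n) L < e / 3" by blast
        show "\<forall>\<^sub>F \<pi> in ?F. dist (stopped_sum V S \<pi> x) L < e"
          using ev tendstoD[OF l[of n] e]
        proof eventually_elim
          case (elim \<pi>)
          have "dist (stopped_sum V S \<pi> x) (stopped_sum V S \<pi> (s n)) \<le> dist (s n) x"
            using clinear_bounded_onD(3)[OF stopped_sum_clinear[OF elim(1)], of "x - s n"]
              clinear_bounded_on_minus_arg[OF stopped_sum_clinear[OF elim(1)]]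
            by (simp add: dist_norm norm_minus_commute)
          then show ?case
            using elim(2) n dist_triangle[of "stopped_sum V S \<pi> x" L "stopped_sum V S \<pi> (s n)"]
              dist_triangle[of "stopped_sum V S \<pi> (s n)" L "l n"] by linarith
        qed
      qed
      then show "x \<in> ?C" by blast
    qed
  qed
  then have "closed_cspan {tens u (expv f) | u f. f \<in> L2} \<subseteq> ?C"
    by (intro closed_cspan_minimal) (use stopped_sum_convergent_expv in blast)
  then show ?thesis unfolding tens_expv_total by blast
qed

section \<open>The limit operator\<close>

lemma stopped_tendsto: "((\<lambda>\<pi>. stopped_sum V S \<pi> z) \<longlongrightarrow> stopped V S t z) (refinement_filter t)"
proof -
  obtain l where l: "((\<lambda>\<pi>. stopped_sum V S \<pi> z) \<longlongrightarrow> l) (refinement_filter t)"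
    using stopped_sum_convergent by blast
  then show ?thesis
    unfolding stopped_def using tendsto_Lim[OF refinement_filter_neq_bot l] t_pos by simp
qed

text \<open>Identities valid for every finite sum pass to the limit; linearity and the relation with
  the projection of \<open>[0,t]\<close> are obtained this way.\<close>

lemma stopped_eqI:
  assumes "(F \<longlongrightarrow> l) (refinement_filter t)" "\<And>\<pi>. \<pi> \<in> partitions t \<Longrightarrow> stopped_sum V S \<pi> z = F \<pi>"
  shows "stopped V S t z = l"
proof (rule tendsto_unique[OF refinement_filter_neq_bot stopped_tendsto])
  have "\<forall>\<^sub>F \<pi> in refinement_filter t. F \<pi> = stopped_sum V S \<pi> z"
    using eventually_partitions[of t] t_pos by (auto elim!: eventually_mono simp: assms(2))
  then show "((\<lambda>\<pi>. stopped_sum V S \<pi> z) \<longlongrightarrow> l) (refinement_filter t)"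
    by (rule Lim_transform_eventually[OF assms(1)])
qed (use t_pos in simp)

lemma stopped_E: "stopped V S t (E {0..ennreal t} z) = stopped V S t z"
  by (rule stopped_eqI[OF stopped_tendsto stopped_sum_E])

lemma norm_stopped_le: "norm (stopped V S t z) \<le> norm (E {0..ennreal t} z)"
proof (rule tendsto_upperbound[OF tendsto_norm[OF stopped_tendsto]])
  show "\<forall>\<^sub>F \<pi> in refinement_filter t. norm (stopped_sum V S \<pi> z) \<le> norm (E {0..ennreal t} z)"
    using eventually_partitions[of t] t_pos by (auto elim!: eventually_mono intro: norm_stopped_sum_le)
  show "refinement_filter t \<noteq> bot" using refinement_filter_neq_bot t_pos by simp
qed

lemma stopped_bounded: "stopped V S t \<in> bounded_ops UNIV"
  unfolding bounded_ops_UNIV_iff clinear_bounded_on_def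
proof (intro exI[of _ 1] conjI ballI allI)
  fix x
  show "stopped V S t (x + y) = stopped V S t x + stopped V S t y" for y
    by (rule stopped_eqI[OF tendsto_add[OF stopped_tendsto stopped_tendsto]])
      (simp add: clinear_bounded_onD(1)[OF stopped_sum_clinear])
  show "stopped V S t (c *\<^sub>C x) = c *\<^sub>C stopped V S t x" for c
    by (rule stopped_eqI[OF tendsto_scaleC[OF stopped_tendsto]])
      (simp add: clinear_bounded_onD(2)[OF stopped_sum_clinear])
  show "norm (stopped V S t x) \<le> 1 * norm x"
    using norm_stopped_le[of x] E_contraction[of "{0..ennreal t}" x] by simp
qed

end

text \<open>\<open>Lim\<close> has a value even where nothing converges, so well-definedness is
  expressed by convergence of the net at each vector together with boundedness of the limit
  operator.\<close>

theorem theorem6p5: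
  fixes expv :: "(real \<Rightarrow> 'k::complex_hilbert) \<Rightarrow> 'f::complex_hilbert"
    and tens :: "'h::complex_hilbert \<Rightarrow> 'f \<Rightarrow> 'hf::complex_hilbert"
    and p :: "'k \<Rightarrow> 'k" and M :: "('h \<Rightarrow> 'h) set"
    and S :: "ennreal set \<Rightarrow> 'f \<Rightarrow> 'f" and V :: "real \<Rightarrow> 'hf \<Rightarrow> 'hf" and t :: real
  assumes "ampliated_fock expv tens"
    and "orthogonal_projection p"
    and "von_neumann_algebra M"
    and "ampliated_fock.finite_stop_time expv S"
    and "ampliated_fock.cocycle expv tens p M V"
    and "ampliated_fock.isometric expv tens p V"
    and "ampliated_fock.strongly_continuous V"
    and "t > 0"
  shows "ampliated_fock.stopped tens V S t \<in> bounded_ops UNIV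
    \<and> (\<forall>z. ((\<lambda>\<pi>. ampliated_fock.stopped_sum tens V S \<pi> z)
          \<longlongrightarrow> ampliated_fock.stopped tens V S t z) (refinement_filter t))
    \<and> ampliated_fock.stopped tens V S t
        = ampliated_fock.stopped tens V S t \<circ> ampliated_fock.ampl tens (S {0..ennreal t})
    \<and> (\<forall>z. norm (ampliated_fock.stopped tens V S t z)
          \<le> norm (ampliated_fock.ampl tens (S {0..ennreal t}) z))"
proof -
  interpret ampliated_fock expv tens by (rule assms(1))
  interpret stopped_cocycle expv tens p M V S t
    by unfold_locales (rule assms)+
  show ?thesis
    using stopped_bounded stopped_tendsto stopped_E norm_stopped_le by (auto simp: fun_eq_iff)
qed

end
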